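(* Let $\psi:\mathbb{R}\to\mathbb{R}$ be an even continuous strictly positive function that is monotone increasing for $x\ge0$, with $\int_{-\infty}^\infty e^{-\psi^2(t)}dt<\infty$ and $\int_{-\infty}^{\infty}(1+\psi^2(s))^m e^{-\psi^2(s)}ds<\infty$ for all $m\in\mathbb{N}$. Let $\alpha\in\{0,1\}$ and let $X^{(\alpha,3)}=X^{(\alpha,3)}_{N,c,R}$ be the random variable defined in the context. Then for every $k\ge1$ there exist numbers $\Theta_k^{(\alpha,\mathrm{i})}$, $\Theta_k^{(\alpha,\mathrm{ii})}(s)$ and $\Theta_k^{(\alpha,\mathrm{iii})}$ such that, with $(N,c,R)_0\to\infty$ denoting the limiting transition $N,c,R\to\infty$ with $R=o(N)$, $c=o(N)$: (i) if $c^2R/N^2\gg1$, then $$\lim_{(N,c,R)_0\to\infty}\frac1{cR}\,\mathrm{Cum}_k\left(\frac{N^2}{c^2R}X^{(\alpha,3)}\right)=\Theta_k^{(\alpha,\mathrm{i})};$$ (ii) if $c^2R/N^2=s$ ($s>0$ fixed), then $$\lim_{(N,c,R)_0\to\infty}\frac1{cR}\,\mathrm{Cum}_k\big(X^{(\alpha,3)}\big)=\Theta_k^{(\alpha,\mathrm{ii})}(s);$$ (iii) if $c^2R/N^2\ll1$, then $$\lim_{(N,c,R)_0\to\infty}\frac{N^2}{c^3R^2}\,\mathrm{Cum}_k\big(X^{(\alpha,3)}\big)=\Theta_k^{(\alpha,\mathrm{iii})}=6^{k-1}\tilde H_k^{(\alpha,3)},$$ where $$\tilde H_k^{(\alpha,3)}=\frac1{2\pi}\int_{-\infty}^\infty\big(\tilde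 h_k^{(\alpha)}(p)\big)^3dp,\qquad \tilde h_k^{(\alpha)}(p)=\int_{-\infty}^\infty h_k^{(\alpha)}(x)e^{-ipx}dx,\qquad h_k^{(\alpha)}(x)=\big(1+\alpha\psi^2(x)\big)^k e^{-\psi^2(x)}.$$
   Context: Let $N=2n+1$, $L_N=\{-n,\dots,n\}$, and let $c,R>0$ be parameters with $c\le N$. Let $a_{ij}=a_{ij}^{(N,c,R)}$, $-n\le i<j\le n$, be jointly independent random variables with values in $\{0,1\}$ and $P(a_{ij}=1)=\frac{c}{N}e^{-\psi^2((i-j)/R)}$. For $\alpha\in\{0,1\}$ let $A^{(\alpha)}_{N,c,R}$ be the real symmetric $N\times N$ matrix (indexed by $L_N$) with zero diagonal and entries $\big(1+\alpha\psi^2(\tfrac{i-j}{R})\big)a_{ij}$ for $i<j$. Define $X^{(\alpha,3)}_{N,c,R}=\mathrm{Tr}\,\big(A^{(\alpha)}_{N,c,R}\big)^3$. $\mathrm{Cum}_k(\xi)$ denotes the $k$-th cumulant of the random variable $\xi$. The notation $x\gg1$ ($x\ll1$) means $x\to\infty$ ($x\to0$) along the limiting transition. *)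

theory Defs
  imports "HOL-Probability.Probability" "HOL-Library.Landau_Symbols"
begin

definition idx :: "nat \<Rightarrow> int set" where
  "idx n = {- int n..int n}"

definition size_of :: "nat \<Rightarrow> real" where
  "size_of n = real (2 * n + 1)"

text \<open>Square matrices indexed by a finite set \<open>S\<close> are functions of two indices, of which only
  the values on \<open>S \<times> S\<close> matter. This keeps the index set \<open>{-n..n}\<close>, whose size varies
  inside the statement.\<close>

definition mat_mult_on :: "'i set \<Rightarrow> ('i \<Rightarrow> 'i \<Rightarrow> real) \<Rightarrow> ('i \<Rightarrow> 'i \<Rightarrow> real) \<Rightarrow> 'i \<Rightarrow> 'i \<Rightarrow> real" where
  "mat_mult_on S A B = (\<lambda>i j. \<Sum>l\<in>S. A i l * B l j)"

definition trace_on :: "'i set \<Rightarrow> ('i \<Rightarrow> 'i \<Rightarrow> real) \<Rightarrow> real" where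
  "trace_on S A = (\<Sum>i\<in>S. A i i)"

definition edge_prob :: "(real \<Rightarrow> real) \<Rightarrow> nat \<Rightarrow> real \<Rightarrow> real \<Rightarrow> int \<Rightarrow> int \<Rightarrow> real" where
  "edge_prob \<psi> n c R i j = c / size_of n * exp (- (\<psi> (real_of_int (i - j) / R))\<^sup>2)"

text \<open>Only the values \<open>a i j\<close> with \<open>-n \<le> i < j \<le> n\<close> are constrained.\<close>

definition edge_family ::
  "(real \<Rightarrow> real) \<Rightarrow> nat \<Rightarrow> real \<Rightarrow> real \<Rightarrow> 'w measure \<Rightarrow> (int \<Rightarrow> int \<Rightarrow> 'w \<Rightarrow> real) \<Rightarrow> bool" where
  "edge_family \<psi> n c R M a \<longleftrightarrow>
     prob_space M \<and>
     prob_space.indep_vars M (\<lambda>_. borel) (\<lambda>(i, j). a i j) {(i, j). i \<in> idx n \<and> j \<in> idx n \<and> i < j} \<and>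
     (\<forall>i\<in>idx n. \<forall>j\<in>idx n. i < j \<longrightarrow>
        (\<forall>\<omega>\<in>space M. a i j \<omega> \<in> {0, 1}) \<and>
        measure M {\<omega> \<in> space M. a i j \<omega> = 1} = edge_prob \<psi> n c R i j)"

definition wmatrix ::
  "(real \<Rightarrow> real) \<Rightarrow> real \<Rightarrow> real \<Rightarrow> (int \<Rightarrow> int \<Rightarrow> real) \<Rightarrow> int \<Rightarrow> int \<Rightarrow> real" where
  "wmatrix \<psi> \<alpha> R b i j =
     (if i < j then (1 + \<alpha> * (\<psi> (real_of_int (i - j) / R))\<^sup>2) * b i j
      else if j < i then (1 + \<alpha> * (\<psi> (real_of_int (j - i) / R))\<^sup>2) * b j i
      else 0)"

definition X3 ::
  "(real \<Rightarrow> real) \<Rightarrow> real \<Rightarrow> nat \<Rightarrow> real \<Rightarrow> (int \<Rightarrow> int \<Rightarrow> 'w \<Rightarrow> real) \<Rightarrow> 'w \<Rightarrow> real" where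
  "X3 \<psi> \<alpha> n R a \<omega> =
     (let A = wmatrix \<psi> \<alpha> R (\<lambda>i j. a i j \<omega>)
      in trace_on (idx n) (mat_mult_on (idx n) (mat_mult_on (idx n) A A) A))"

text \<open>The \<open>k\<close>-th Taylor coefficient (times \<open>k!\<close>) at \<open>0\<close> of the logarithm of the moment generating
  function. It is used only for bounded random variables, for which this function is smooth
  on the whole real line.\<close>

definition cumulant :: "nat \<Rightarrow> 'w measure \<Rightarrow> ('w \<Rightarrow> real) \<Rightarrow> real" where
  "cumulant k M X = (deriv ^^ k) (\<lambda>t. ln (integral\<^sup>L M (\<lambda>\<omega>. exp (t * X \<omega>)))) 0"

text \<open>The limiting transition along a sequence of parameter triples. Limits along it are
  taken over all such sequences, which is equivalent to the limit in the three parameters.\<close>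

definition limit_transition :: "(nat \<Rightarrow> nat) \<Rightarrow> (nat \<Rightarrow> real) \<Rightarrow> (nat \<Rightarrow> real) \<Rightarrow> bool" where
  "limit_transition n c R \<longleftrightarrow>
     (\<forall>m. 0 < c m \<and> c m \<le> size_of (n m) \<and> 0 < R m) \<and>
     filterlim n at_top sequentially \<and>
     filterlim c at_top sequentially \<and>
     filterlim R at_top sequentially \<and>
     R \<in> o(\<lambda>m. size_of (n m)) \<and>
     c \<in> o(\<lambda>m. size_of (n m))"

definition h_fun :: "(real \<Rightarrow> real) \<Rightarrow> real \<Rightarrow> nat \<Rightarrow> real \<Rightarrow> real" where
  "h_fun \<psi> \<alpha> k x = (1 + \<alpha> * (\<psi> x)\<^sup>2) ^ k * exp (- (\<psi> x)\<^sup>2)"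

definition h_tilde :: "(real \<Rightarrow> real) \<Rightarrow> real \<Rightarrow> nat \<Rightarrow> real \<Rightarrow> complex" where
  "h_tilde \<psi> \<alpha> k p =
     (LINT x|lborel. complex_of_real (h_fun \<psi> \<alpha> k x) * exp (- (\<i> * complex_of_real p * complex_of_real x)))"

definition H3_tilde :: "(real \<Rightarrow> real) \<Rightarrow> real \<Rightarrow> nat \<Rightarrow> complex" where
  "H3_tilde \<psi> \<alpha> k = complex_of_real (1 / (2 * pi)) * (LINT p|lborel. (h_tilde \<psi> \<alpha> k p) ^ 3)"

end

(*
Write X = Tr A^3 as 6 times the sum of the weighted indicators of the triangles, and expand
Cum_k(X) multilinearly into joint cumulants of k-tuples T of triangles. A joint cumulant vanishes
unless the triangles of T are linked through shared edges, and then it equals the corresponding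
joint moment up to a relative error O(c/N), because splitting a linked tuple into blocks repeats
some edge and costs a factor c/N. So Cum_k(X) is asymptotic to a sum of positive terms. Grouping
the tuples T by their pattern, with v vertices and e edges, each pattern contributes a Riemann sum
  (c/N)^e N R^(v-1) (I + o(1)) = c R rho^(v-2) (c/N)^(e+3-2v) (I + o(1)),   rho = c^2 R / N^2,
where I is the integral of the product of the weights over the configurations modulo translation.
A linked tuple satisfies 3 <= v <= k+2 and e+3 >= 2v, so in each regime only the patterns with
e+3 = 2v survive, with v = k+2 in case (i), all v in case (ii), and v = 3 in case (iii). For v = 3
all k triangles coincide and I is the value at 0 of the triple convolution of h_k, which Fourier
inversion identifies with the integral of the cubed transform.
*)
theory Submission
  imports Defs "HOL-Library.Ramsey"
begin

text \<open>Positivity drives the reduction: the error is relative to positive joint moments, with a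
  constant depending on k alone, so the limit of the sum of moments disposes of the error as well.
  The count e + 3 >= 2v holds because a linked tuple is assembled triangle by triangle along shared
  edges: each triangle brings at most one new vertex, and with it at least two new edges. The same
  assembly contains a spanning tree, which makes I finite: vertices are integrated out one at a time
  against a tree edge, the other edges being merely bounded. Each Riemann sum is the exact integral
  of a step function, so dominated convergence applies. The obstacle is domination, since (1 +
  psi^2)^k exp(-psi^2) need not decrease in |x|; it is replaced by a larger integrable function that
  does, so that shifting an argument by at most 1 is harmless. On the Fourier side the transform of
  h_k is not known to be integrable; its square is shown to be, and that suffices for the
  cube.\<close>

subsection \<open>Joint cumulants of set functions\<close>

text \<open>If \<open>m B\<close> is a joint moment over \<open>B\<close>, this is the joint cumulant over \<open>S\<close>: in the
  moment-cumulant formula, \<open>B\<close> runs through the possible blocks of the least element.\<close>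

function set_cumulant :: "(nat set \<Rightarrow> real) \<Rightarrow> nat set \<Rightarrow> real" where
  "set_cumulant m S =
     (if finite S \<and> S \<noteq> {}
      then m S - (\<Sum>B\<in>{B. B \<subset> S \<and> Min S \<in> B}. set_cumulant m B * m (S - B))
      else 0)"
  by pat_completeness auto
termination
  by (relation "Wellfounded.measure (\<lambda>(m, S). card S)") (simp_all add: psubset_card_mono)

declare set_cumulant.simps [simp del]

lemma set_cumulant_rec:
  assumes "finite S" "S \<noteq> {}"
  shows "set_cumulant m S =
    m S - (\<Sum>B\<in>{B. B \<subset> S \<and> Min S \<in> B}. set_cumulant m B * m (S - B))"
  using assms by (subst set_cumulant.simps) auto

lemma set_cumulant_cong:
  assumes "finite S" "\<And>B. B \<subseteq> S \<Longrightarrow> m B = m' B"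
  shows "set_cumulant m S = set_cumulant m' S"
  using assms
proof (induction "card S" arbitrary: S rule: less_induct)
  case less
  show ?case
  proof (cases "S = {}")
    case True
    then show ?thesis by (simp add: set_cumulant.simps)
  next
    case False
    have *: "set_cumulant m B * m (S - B) = set_cumulant m' B * m' (S - B)" if "B \<subset> S" for B
    proof -
      have "set_cumulant m B = set_cumulant m' B"
      proof (rule less.hyps)
        show "card B < card S" using that less.prems(1) by (rule psubset_card_mono[rotated])
        show "finite B" using that less.prems(1) finite_subset by blast
        show "m B' = m' B'" if "B' \<subseteq> B" for B'
          using \<open>B \<subset> S\<close> that by (intro less.prems(2)) auto
      qed
      moreover have "m (S - B) = m' (S - B)" by (rule less.prems(2)) auto
      ultimately show ?thesis by simp
    qed
    have "(\<Sum>B\<in>{B. B \<subset> S \<and> Min S \<in> B}. set_cumulant m B * m (S - B)) =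
      (\<Sum>B\<in>{B. B \<subset> S \<and> Min S \<in> B}. set_cumulant m' B * m' (S - B))"
      using * by (intro sum.cong) auto
    then show ?thesis
      using less.prems(2)[OF subset_refl] by (simp add: set_cumulant_rec[OF less.prems(1) False])
  qed
qed

lemma set_cumulant_expand:
  assumes "finite S" "S \<noteq> {}" "m {} = 1"
  shows "m S = (\<Sum>B\<in>{B. B \<subseteq> S \<and> Min S \<in> B}. set_cumulant m B * m (S - B))"
proof -
  have "{B. B \<subseteq> S \<and> Min S \<in> B} = insert S {B. B \<subset> S \<and> Min S \<in> B}"
    using Min_in[OF assms(1,2)] by auto
  moreover have "finite {B. B \<subset> S \<and> Min S \<in> B}"
    using assms(1) by (auto intro: finite_subset[of _ "Pow S"])
  ultimately show ?thesis
    using assms by (simp add: set_cumulant_rec)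
qed

text \<open>Induction on the size of S. The hypotheses are symmetric in A and its complement, so
  \<open>Min S\<close> may be taken in A; this is why the inner fact \<open>main\<close> is stated
  for arbitrary S and A. Blocks meeting both sides contribute 0 by induction. The remaining blocks
  lie inside A, and by \<open>set_cumulant_expand\<close> their sum rebuilds m (S Int A) * m (S - A)
  = m S, which cancels the leading term of the recursion.\<close>

lemma set_cumulant_disconnected:
  assumes "finite S" "m {} = 1"
    and "S \<inter> A \<noteq> {}" "S - A \<noteq> {}"
    and "\<And>B. B \<subseteq> S \<Longrightarrow> m B = m (B \<inter> A) * m (B - A)"
  shows "set_cumulant m S = 0"
proof -
  have main: "set_cumulant m S = 0"
    if "finite S" "S - A \<noteq> {}" "Min S \<in> A" "S \<noteq> {}"
      and split: "\<And>B. B \<subseteq> S \<Longrightarrow> m B = m (B \<inter> A) * m (B - A)"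
      and IH: "\<And>B. B \<subset> S \<Longrightarrow> B \<inter> A \<noteq> {} \<Longrightarrow> B - A \<noteq> {} \<Longrightarrow> set_cumulant m B = 0"
    for S A
  proof -
    have min: "Min S \<in> S" using that by simp
    have minA: "Min (S \<inter> A) = Min S"
      using that min by (intro Min_eqI) auto
    have fin: "finite {B. B \<subset> S \<and> Min S \<in> B}"
      using that(1) by (auto intro: finite_subset[of _ "Pow S"])
    have "(\<Sum>B\<in>{B. B \<subset> S \<and> Min S \<in> B}. set_cumulant m B * m (S - B)) =
      (\<Sum>B\<in>{B. B \<subseteq> S \<inter> A \<and> Min S \<in> B}. set_cumulant m B * m (S - B))"
    proof (rule sum.mono_neutral_right[OF fin])
      show "{B. B \<subseteq> S \<inter> A \<and> Min S \<in> B} \<subseteq> {B. B \<subset> S \<and> Min S \<in> B}"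
        using that(2) by auto
      show "\<forall>B\<in>{B. B \<subset> S \<and> Min S \<in> B} - {B. B \<subseteq> S \<inter> A \<and> Min S \<in> B}.
              set_cumulant m B * m (S - B) = 0"
      proof
        fix B assume B: "B \<in> {B. B \<subset> S \<and> Min S \<in> B} - {B. B \<subseteq> S \<inter> A \<and> Min S \<in> B}"
        then have "B \<subset> S" "B \<inter> A \<noteq> {}" "B - A \<noteq> {}" using that(3) by auto
        then show "set_cumulant m B * m (S - B) = 0" using IH by simp
      qed
    qed
    also have "\<dots> = (\<Sum>B\<in>{B. B \<subseteq> S \<inter> A \<and> Min S \<in> B}.
        (set_cumulant m B * m (S \<inter> A - B)) * m (S - A))"
    proof (rule sum.cong)
      fix B assume B: "B \<in> {B. B \<subseteq> S \<inter> A \<and> Min S \<in> B}"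
      then have eqs: "(S - B) \<inter> A = S \<inter> A - B" "S - B - A = S - A" by auto
      have "m (S - B) = m (S \<inter> A - B) * m (S - A)"
        using split[of "S - B", unfolded eqs] by blast
      then show "set_cumulant m B * m (S - B) = (set_cumulant m B * m (S \<inter> A - B)) * m (S - A)"
        by (simp only: mult.assoc)
    qed (rule refl)
    also have "\<dots> = m (S \<inter> A) * m (S - A)"
    proof -
      have "finite (S \<inter> A)" "S \<inter> A \<noteq> {}" using that(1,3) min by auto
      from set_cumulant_expand[where m = m, OF this assms(2)] show ?thesis
        by (simp add: sum_distrib_right minA)
    qed
    also have "\<dots> = m S" by (rule split[OF subset_refl, symmetric])
    finally show ?thesis by (simp add: set_cumulant_rec[OF that(1,4)])
  qed
  show ?thesis
    using assms
  proof (induction "card S" arbitrary: S rule: less_induct)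
    case less
    note fin = less.prems(1) and prems = less.prems(3,4) and split = less.prems(5)
    have ne: "S \<noteq> {}" using prems by blast
    have IH: "set_cumulant m B = 0" if B: "B \<subset> S" "B \<inter> A \<noteq> {}" "B - A \<noteq> {}" for B
    proof (rule less.hyps)
      show "card B < card S" using B(1) fin by (rule psubset_card_mono[rotated])
      show "finite B" using B(1) fin finite_subset by blast
      show "m B' = m (B' \<inter> A) * m (B' - A)" if "B' \<subseteq> B" for B'
        using split that B(1) by blast
    qed (use B assms(2) in auto)
    show ?case
    proof (cases "Min S \<in> A")
      case True
      show ?thesis by (rule main[OF fin prems(2) True ne split IH])
    next
      case False
      show ?thesis
      proof (rule main[of S "- A"])
        show "m B = m (B \<inter> - A) * m (B - - A)" if "B \<subseteq> S" for B
        proof -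
          have "B \<inter> - A = B - A" "B - - A = B \<inter> A" by auto
          then show ?thesis using split[OF that] by (metis mult.commute)
        qed
        show "S - - A \<noteq> {}" using prems by blast
        show "set_cumulant m B = 0" if "B \<subset> S" "B \<inter> - A \<noteq> {}" "B - - A \<noteq> {}" for B
          using that by (intro IH) blast+
      qed (use fin ne False in auto)
    qed
  qed
qed

text \<open>Supermultiplicativity turns each product \<open>set_cumulant m B * m (S - B)\<close> of
  the recursion into at most C * m S, and there are at most \<open>2 ^ Suc n\<close> blocks. The
  constant depends on the size alone, which later makes the estimate uniform in all parameters of
  the model. The inequality is demanded on every subset so that the induction can descend to
  blocks.\<close>

lemma set_cumulant_bound:
  "\<exists>C\<ge>0. \<forall>m S. finite S \<longrightarrow> card S \<le> n \<longrightarrow> (\<forall>B\<subseteq>S. 0 \<le> m B) \<longrightarrow>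
     (\<forall>A\<subseteq>S. \<forall>B\<subseteq>A. m B * m (A - B) \<le> m A) \<longrightarrow> \<bar>set_cumulant m S\<bar> \<le> C * m S"
proof (induction n)
  case 0
  show ?case by (rule exI[of _ 0]) (auto simp: set_cumulant.simps)
next
  case (Suc n)
  then obtain C where C: "C \<ge> 0" and IH: "\<And>m S. finite S \<Longrightarrow> card S \<le> n \<Longrightarrow> (\<forall>B\<subseteq>S. 0 \<le> m B) \<Longrightarrow>
     (\<forall>A\<subseteq>S. \<forall>B\<subseteq>A. m B * m (A - B) \<le> m A) \<Longrightarrow> \<bar>set_cumulant m S\<bar> \<le> C * m S"
    by blast
  show ?case
  proof (rule exI[of _ "1 + 2 ^ Suc n * C"], intro conjI allI impI)
    show "0 \<le> 1 + 2 ^ Suc n * C" using C by simp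
    fix m :: "nat set \<Rightarrow> real" and S :: "nat set"
    assume S: "finite S" "card S \<le> Suc n" and nn: "\<forall>B\<subseteq>S. 0 \<le> m B"
      and sm: "\<forall>A\<subseteq>S. \<forall>B\<subseteq>A. m B * m (A - B) \<le> m A"
    show "\<bar>set_cumulant m S\<bar> \<le> (1 + 2 ^ Suc n * C) * m S"
    proof (cases "S = {}")
      case True
      then show ?thesis using C nn by (simp add: set_cumulant.simps)
    next
      case False
      let ?P = "{B. B \<subset> S \<and> Min S \<in> B}"
      have "card ?P \<le> card (Pow S)" using S by (intro card_mono) auto
      also have "\<dots> \<le> 2 ^ Suc n" unfolding card_Pow[OF S(1)] using S(2) by (intro power_increasing) auto
      finally have "card ?P \<le> 2 ^ Suc n" .
      then have cP: "real (card ?P) \<le> 2 ^ Suc n"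
        using of_nat_mono by fastforce
      have "\<bar>\<Sum>B\<in>?P. set_cumulant m B * m (S - B)\<bar> \<le> (\<Sum>B\<in>?P. \<bar>set_cumulant m B * m (S - B)\<bar>)"
        by (rule sum_abs)
      also have "\<dots> \<le> (\<Sum>B\<in>?P. C * m S)"
      proof (rule sum_mono)
        fix B assume B: "B \<in> ?P"
        have "card B < card S" using B S(1) by (intro psubset_card_mono) auto
       then have "card B \<le> n" using S by linarith
       moreover have "finite B" using B S(1) finite_subset by blast
        ultimately have "\<bar>set_cumulant m B\<bar> \<le> C * m B"
          using B nn sm by (intro IH) (simp_all, blast+)
        then have "\<bar>set_cumulant m B\<bar> * m (S - B) \<le> (C * m B) * m (S - B)"
          using nn by (intro mult_right_mono) auto
        also have "\<dots> = C * (m B * m (S - B))" by simp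
        also have "\<dots> \<le> C * m S" using sm B C by (intro mult_left_mono) auto
        finally show "\<bar>set_cumulant m B * m (S - B)\<bar> \<le> C * m S"
          using nn by (simp add: abs_mult)
      qed
      also have "\<dots> = card ?P * (C * m S)" by simp
      also have "\<dots> \<le> 2 ^ Suc n * (C * m S)"
        using cP C nn by (intro mult_right_mono) simp_all
      finally have "\<bar>m S - (\<Sum>B\<in>?P. set_cumulant m B * m (S - B))\<bar> \<le> m S + 2 ^ Suc n * (C * m S)"
        using nn[rule_format, OF subset_refl] by linarith
      then show ?thesis using False S by (simp add: set_cumulant_rec algebra_simps)
    qed
  qed
qed

text \<open>Every block in the recursion is proper and contains \<open>Min S\<close>, so each
  subtracted term comes from a genuine splitting and carries the factor \<delta>; only m S is left
  as main term. The inner cumulants are controlled by \<open>set_cumulant_bound\<close>, and 2 ^ n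
  counts the blocks.\<close>

lemma set_cumulant_connected:
  "\<exists>C\<ge>0. \<forall>m S \<delta>. finite S \<longrightarrow> S \<noteq> {} \<longrightarrow> card S = n \<longrightarrow> (\<forall>B\<subseteq>S. 0 \<le> m B) \<longrightarrow>
     (\<forall>A\<subseteq>S. \<forall>B\<subseteq>A. m B * m (A - B) \<le> m A) \<longrightarrow>
     (\<forall>B\<subset>S. B \<noteq> {} \<longrightarrow> m B * m (S - B) \<le> \<delta> * m S) \<longrightarrow> 0 \<le> \<delta> \<longrightarrow>
     \<bar>set_cumulant m S - m S\<bar> \<le> C * \<delta> * m S"
proof -
  obtain C where C: "C \<ge> 0" and IH: "\<And>m S. finite S \<Longrightarrow> card S \<le> n \<Longrightarrow> (\<forall>B\<subseteq>S. 0 \<le> m B) \<Longrightarrow>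
     (\<forall>A\<subseteq>S. \<forall>B\<subseteq>A. m B * m (A - B) \<le> m A) \<Longrightarrow> \<bar>set_cumulant m S\<bar> \<le> C * m S"
    using set_cumulant_bound[of n] by blast
  show ?thesis
  proof (rule exI[of _ "2 ^ n * C"], intro conjI allI impI)
    show "0 \<le> 2 ^ n * C" using C by simp
    fix m :: "nat set \<Rightarrow> real" and S :: "nat set" and \<delta> :: real
    assume S: "finite S" "S \<noteq> {}" "card S = n" and nn: "\<forall>B\<subseteq>S. 0 \<le> m B"
      and sm: "\<forall>A\<subseteq>S. \<forall>B\<subseteq>A. m B * m (A - B) \<le> m A"
      and sm': "\<forall>B\<subset>S. B \<noteq> {} \<longrightarrow> m B * m (S - B) \<le> \<delta> * m S" and \<delta>: "0 \<le> \<delta>"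
    let ?P = "{B. B \<subset> S \<and> Min S \<in> B}"
    have "card ?P \<le> card (Pow S)" using S by (intro card_mono) auto
    also have "\<dots> \<le> 2 ^ n" using S by (simp only: card_Pow)
    finally have "card ?P \<le> 2 ^ n" .
    then have cP: "real (card ?P) \<le> 2 ^ n"
      using of_nat_mono by fastforce
    have "\<bar>\<Sum>B\<in>?P. set_cumulant m B * m (S - B)\<bar> \<le> (\<Sum>B\<in>?P. \<bar>set_cumulant m B * m (S - B)\<bar>)"
      by (rule sum_abs)
    also have "\<dots> \<le> (\<Sum>B\<in>?P. C * (\<delta> * m S))"
    proof (rule sum_mono)
      fix B assume B: "B \<in> ?P"
      have "card B < card S" using B S(1) by (intro psubset_card_mono) auto
       then have "card B \<le> n" using S by linarith
       moreover have "finite B" using B S(1) finite_subset by blast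
      ultimately have "\<bar>set_cumulant m B\<bar> \<le> C * m B"
        using B nn sm by (intro IH) (simp_all, blast+)
      then have "\<bar>set_cumulant m B\<bar> * m (S - B) \<le> (C * m B) * m (S - B)"
        using nn by (intro mult_right_mono) auto
      also have "\<dots> = C * (m B * m (S - B))" by simp
      also have "\<dots> \<le> C * (\<delta> * m S)" using sm' B C by (intro mult_left_mono) auto
      finally show "\<bar>set_cumulant m B * m (S - B)\<bar> \<le> C * (\<delta> * m S)"
        using nn by (simp add: abs_mult)
    qed
    also have "\<dots> = card ?P * (C * (\<delta> * m S))" by simp
    also have "\<dots> \<le> 2 ^ n * (C * (\<delta> * m S))"
      using cP C nn \<delta> by (intro mult_right_mono) simp_all
    finally show "\<bar>set_cumulant m S - m S\<bar> \<le> 2 ^ n * C * \<delta> * m S"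
      using S by (simp add: set_cumulant_rec algebra_simps)
  qed
qed

subsection \<open>Cumulants from moments\<close>

text \<open>The recursion expressing cumulants by moments; the index 0 is given the value of the
  logarithm itself, so that the sequence consists of the iterated derivatives of a logarithm.\<close>

function kappa :: "(nat \<Rightarrow> real) \<Rightarrow> nat \<Rightarrow> real" where
  "kappa m 0 = ln (m 0)"
| "kappa m (Suc n) =
     (m (Suc n) - (\<Sum>j<n. real (n choose j) * kappa m (Suc j) * m (n - j))) / m 0"
  by pat_completeness auto
termination
  by (relation "Wellfounded.measure (\<lambda>(m, n). n)") simp_all

declare kappa.simps(2) [simp del]

lemma moments_kappa:
  assumes "m 0 \<noteq> 0"
  shows "m (Suc n) = (\<Sum>j\<le>n. real (n choose j) * kappa m (Suc j) * m (n - j))"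
proof -
  have "kappa m (Suc n) * m 0 = m (Suc n) - (\<Sum>j<n. real (n choose j) * kappa m (Suc j) * m (n - j))"
    using assms by (simp add: kappa.simps(2)[of m n])
  then show ?thesis by (simp flip: lessThan_Suc_atMost)
qed

lemma kappa_unique:
  assumes "m 0 \<noteq> 0"
    and "\<And>n. m (Suc n) = (\<Sum>j\<le>n. real (n choose j) * K (Suc j) * m (n - j))"
  shows "K (Suc n) = kappa m (Suc n)"
proof (induction n rule: less_induct)
  case (less n)
  have "m (Suc n) = (\<Sum>j<n. real (n choose j) * kappa m (Suc j) * m (n - j)) + K (Suc n) * m 0"
    unfolding assms(2)[of n] lessThan_Suc_atMost[symmetric]
    using less by simp
  then show ?case using assms(1) by (simp add: kappa.simps(2)[of m n])
qed

lemma kappa_scale: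
  assumes "m 0 \<noteq> 0"
  shows "kappa (\<lambda>n. l ^ n * m n) (Suc n) = l ^ Suc n * kappa m (Suc n)"
proof (rule kappa_unique[symmetric, where K = "\<lambda>n. l ^ n * kappa m n"])
  fix n
  have "l ^ Suc n * m (Suc n) =
      (\<Sum>j\<le>n. l ^ Suc n * (real (n choose j) * kappa m (Suc j) * m (n - j)))"
    unfolding moments_kappa[of m, OF assms] by (simp add: sum_distrib_left)
  also have "\<dots> = (\<Sum>j\<le>n. real (n choose j) * (l ^ Suc j * kappa m (Suc j)) * (l ^ (n - j) * m (n - j)))"
  proof (rule sum.cong)
    fix j assume "j \<in> {..n}"
    then have "l ^ Suc n = l ^ Suc j * l ^ (n - j)" unfolding power_add[symmetric] by simp
    then show "l ^ Suc n * (real (n choose j) * kappa m (Suc j) * m (n - j)) =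
      real (n choose j) * (l ^ Suc j * kappa m (Suc j)) * (l ^ (n - j) * m (n - j))"
      by (simp only: mult_ac)
  qed simp
  finally show "l ^ Suc n * m (Suc n) =
      (\<Sum>j\<le>n. real (n choose j) * (l ^ Suc j * kappa m (Suc j)) * (l ^ (n - j) * m (n - j)))" .
qed (use assms in simp)

text \<open>Pascal's rule in the shape of one Leibniz step: differentiating a product of derivatives
  of orders j and p - j raises one of the two orders.\<close>

lemma sum_binomial_Suc:
  fixes f :: "nat \<Rightarrow> nat \<Rightarrow> real"
  shows "(\<Sum>j\<le>Suc p. real (Suc p choose j) * f j (Suc p - j)) =
    (\<Sum>j\<le>p. real (p choose j) * (f j (Suc (p - j)) + f (Suc j) (p - j)))"
proof -
  have "(\<Sum>j\<le>Suc p. real (Suc p choose j) * f j (Suc p - j)) =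
      (f 0 (Suc p) + (\<Sum>j\<le>p. real (p choose Suc j) * f (Suc j) (p - j)))
      + (\<Sum>j\<le>p. real (p choose j) * f (Suc j) (p - j))"
    by (subst sum.atMost_Suc_shift) (simp add: sum.distrib distrib_right)
  also have "f 0 (Suc p) + (\<Sum>j\<le>p. real (p choose Suc j) * f (Suc j) (p - j)) =
      (\<Sum>j\<le>Suc p. real (p choose j) * f j (Suc p - j))"
    by (subst sum.atMost_Suc_shift) simp
  also have "\<dots> = (\<Sum>j\<le>p. real (p choose j) * f j (Suc (p - j)))"
    by (simp add: Suc_diff_le)
  finally show ?thesis by (simp add: sum.distrib distrib_left)
qed

text \<open>If \<open>mu n\<close> is the n-th derivative of \<open>mu 0\<close>, the recursion of
  \<open>kappa\<close> is the Leibniz rule for the derivatives of the product mu 0 * (ln mu 0)' = mu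
  1. Differentiating the recursion of order p and comparing with that of order p + 1 identifies the
  derivative of one \<open>kappa\<close> with the next.\<close>

lemma kappa_has_derivative:
  assumes mu: "\<And>n t. (mu n has_real_derivative mu (Suc n) t) (at t)"
    and pos: "\<And>t. mu 0 t > 0"
  shows "((\<lambda>t. kappa (\<lambda>n. mu n t) n) has_real_derivative kappa (\<lambda>n. mu n t) (Suc n)) (at t)"
proof (induction n arbitrary: t rule: less_induct)
  case (less n)
  let ?k = "\<lambda>n t. kappa (\<lambda>n. mu n t) n"
  have nz: "mu 0 t \<noteq> 0" for t using pos[of t] by simp
  show ?case
  proof (cases n)
    case 0
    show ?thesis unfolding 0
      using pos[of t] by (auto intro!: derivative_eq_intros mu simp: kappa.simps(2)[of _ 0])
  next
    case (Suc p)
    let ?f = "\<lambda>t. (mu (Suc p) t - (\<Sum>j<p. real (p choose j) * ?k (Suc j) t * mu (p - j) t)) / mu 0 t"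
    define a where "a j = ?k (Suc j) t" for j
    define b where "b j = mu j t" for j
    define D where "D = ((b (Suc (Suc p)) -
        (\<Sum>j<p. real (p choose j) * (a j * b (Suc (p - j)) + a (Suc j) * b (p - j))))
          * b 0 - (b (Suc p) - (\<Sum>j<p. real (p choose j) * a j * b (p - j))) * b (Suc 0))
          / (b 0 * b 0)"
    have IH: "(?k (Suc j) has_real_derivative ?k (Suc (Suc j)) t) (at t)" if "j < p" for j
      using that Suc by (intro less) auto
    have eq: "?k n = ?f" by (simp add: Suc kappa.simps(2)[of _ p] fun_eq_iff)
    have S: "((\<lambda>t. \<Sum>j<p. real (p choose j) * ?k (Suc j) t * mu (p - j) t) has_real_derivative
        (\<Sum>j<p. real (p choose j) * (?k (Suc j) t * mu (Suc (p - j)) t + ?k (Suc (Suc j)) t * mu (p - j) t))) (at t)"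
    proof (rule DERIV_sum)
      fix j assume "j \<in> {..<p}"
      then show "((\<lambda>t. real (p choose j) * ?k (Suc j) t * mu (p - j) t) has_real_derivative
          real (p choose j) * (?k (Suc j) t * mu (Suc (p - j)) t + ?k (Suc (Suc j)) t * mu (p - j) t)) (at t)"
        unfolding mult.assoc by (intro DERIV_cmult DERIV_mult' IH mu) auto
    qed
    have "(?f has_real_derivative D) (at t)"
      unfolding D_def a_def b_def by (rule DERIV_divide[OF DERIV_diff[OF mu S] mu nz])
    then have Dk: "(?k n has_real_derivative D) (at t)" by (simp add: eq)
    have rec: "b (Suc (Suc p)) = (\<Sum>j\<le>Suc p. real (Suc p choose j) * a j * b (Suc p - j))"
      unfolding a_def b_def by (rule moments_kappa) (rule nz)
    \<comment> \<open>By the recursion of order p the undifferentiated numerator equals a p * b 0,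
      so one factor b 0 of the quotient rule cancels.\<close>
    have "D = (b (Suc (Suc p)) - (\<Sum>j<p. real (p choose j) * (a j * b (Suc (p - j)) + a (Suc j) * b (p - j)))
        - a p * b (Suc 0)) / b 0"
    proof -
      have "b (Suc p) - (\<Sum>j<p. real (p choose j) * a j * b (p - j)) = a p * b 0"
        using moments_kappa[of "\<lambda>n. mu n t" p] nz[of t]
        by (simp add: a_def b_def flip: lessThan_Suc_atMost)
      moreover have "b 0 \<noteq> 0" by (simp add: b_def nz)
      ultimately show ?thesis
        unfolding D_def by (simp only: mult.assoc) (simp add: field_simps)
    qed
    also have "\<dots> = a (Suc p)"
    proof -
      have "b (Suc (Suc p)) = (\<Sum>j\<le>p. real (p choose j) * (a j * b (Suc (p - j)) + a (Suc j) * b (p - j)))"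
        using rec sum_binomial_Suc[of p "\<lambda>i j. a i * b j"] by (simp only: mult.assoc)
      then show ?thesis using nz[of t]
        by (simp add: b_def[of 0] field_simps flip: lessThan_Suc_atMost)
    qed
    finally show ?thesis using Dk by (simp add: a_def Suc)
  qed
qed


section \<open>Cumulants of random variables with finite range\<close>

lemma deriv_funpow_eqI:
  assumes "\<And>n t. (f n has_real_derivative f (Suc n) t) (at t)"
  shows "(deriv ^^ k) (f 0) = f k"
  by (induction k) (auto intro!: DERIV_imp_deriv assms)

lemma (in prob_space) expectation_finite_range:
  fixes X :: "'a \<Rightarrow> real" and g :: "real \<Rightarrow> real"
  assumes [measurable]: "X \<in> borel_measurable M" and fin: "finite (X ` space M)"
  shows "expectation (\<lambda>\<omega>. g (X \<omega>)) = (\<Sum>x\<in>X ` space M. g x * prob {\<omega> \<in> space M. X \<omega> = x})"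
proof -
  have "expectation (\<lambda>\<omega>. g (X \<omega>)) =
      expectation (\<lambda>\<omega>. \<Sum>x\<in>X ` space M. g x * indicator {\<omega> \<in> space M. X \<omega> = x} \<omega>)"
  proof (rule Bochner_Integration.integral_cong)
    fix \<omega> assume \<omega>: "\<omega> \<in> space M"
    have "(\<Sum>x\<in>X ` space M. g x * indicator {\<omega> \<in> space M. X \<omega> = x} \<omega>) =
        (\<Sum>x\<in>{X \<omega>}. g x * indicator {\<omega> \<in> space M. X \<omega> = x} \<omega>)"
      using fin \<omega> by (intro sum.mono_neutral_right) (auto simp: indicator_def)
    also have "\<dots> = g (X \<omega>)" using \<omega> by simp
    finally show "g (X \<omega>) = (\<Sum>x\<in>X ` space M. g x * indicator {\<omega> \<in> space M. X \<omega> = x} \<omega>)" ..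
  qed simp
  also have "\<dots> = (\<Sum>x\<in>X ` space M. g x * prob {\<omega> \<in> space M. X \<omega> = x})"
    by (subst Bochner_Integration.integral_sum) (auto intro!: integrable_mult_right integrable_real_indicator simp: emeasure_eq_measure)
  finally show ?thesis .
qed

text \<open>Finite range makes the moment generating function a finite sum of exponentials, so it is
  differentiated term by term and no interchange of derivative and integral is needed. Here
  \<open>mu n t\<close> is the expectation of X^n exp (t X), whose value at t = 0 is the n-th
  moment.\<close>

lemma (in prob_space) cumulant_eq_kappa:
  fixes X :: "'a \<Rightarrow> real"
  assumes X[measurable]: "X \<in> borel_measurable M" and fin: "finite (X ` space M)"
  shows "cumulant k M X = kappa (\<lambda>n. expectation (\<lambda>\<omega>. X \<omega> ^ n)) k"
proof -
  define mu where "mu n t = (\<Sum>x\<in>X ` space M. (x ^ n * exp (t * x)) * prob {\<omega> \<in> space M. X \<omega> = x})"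
    for n t
  have mgf: "expectation (\<lambda>\<omega>. exp (t * X \<omega>)) = mu 0 t" for t
    using expectation_finite_range[OF X fin, of "\<lambda>x. exp (t * x)"] by (simp add: mu_def)
  have mom: "expectation (\<lambda>\<omega>. X \<omega> ^ n) = mu n 0" for n
    using expectation_finite_range[OF X fin, of "\<lambda>x. x ^ n"] by (simp add: mu_def)
  have der: "(mu n has_real_derivative mu (Suc n) t) (at t)" for n t
    unfolding mu_def
    by (auto intro!: derivative_eq_intros sum.cong simp: mult_ac)
  have int: "integrable M (\<lambda>\<omega>. exp (t * X \<omega>))" for t
  proof (rule integrable_const_bound)
    show "AE \<omega> in M. norm (exp (t * X \<omega>)) \<le> Max ((\<lambda>x. exp (t * x)) ` X ` space M)"
      using fin by (intro AE_I2) (auto intro!: Max_ge)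
  qed measurable
  have pos: "mu 0 t > 0" for t
  proof -
    have "0 < Min ((\<lambda>x. exp (t * x)) ` X ` space M)"
      using fin not_empty by (subst Min_gr_iff) auto
    also have "\<dots> \<le> mu 0 t"
      unfolding mgf[symmetric] using fin by (intro integral_ge_const int AE_I2 Min_le) auto
    finally show ?thesis .
  qed
  have "(deriv ^^ k) (\<lambda>t. kappa (\<lambda>n. mu n t) 0) = (\<lambda>t. kappa (\<lambda>n. mu n t) k)"
    by (rule deriv_funpow_eqI) (rule kappa_has_derivative[OF der pos])
  then show ?thesis by (simp add: cumulant_def mgf mom fun_eq_iff)
qed

section \<open>Multilinear expansion of the cumulants of a sum\<close>

lemma sum_PiE_Un:
  fixes f g :: "(nat \<Rightarrow> 't) \<Rightarrow> real"
  assumes "B \<inter> C = {}"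
    and f: "\<And>T. f (restrict T B) = f T" and g: "\<And>T. g (restrict T C) = g T"
  shows "(\<Sum>T\<in>(B \<union> C) \<rightarrow>\<^sub>E A. f T * g T) = (\<Sum>T\<in>B \<rightarrow>\<^sub>E A. f T) * (\<Sum>T\<in>C \<rightarrow>\<^sub>E A. g T)"
proof -
  have "(\<Sum>T\<in>B \<rightarrow>\<^sub>E A. f T) * (\<Sum>T\<in>C \<rightarrow>\<^sub>E A. g T) = (\<Sum>(T, U)\<in>(B \<rightarrow>\<^sub>E A) \<times> (C \<rightarrow>\<^sub>E A). f T * g U)"
    by (simp add: sum_product sum.cartesian_product)
  also have "\<dots> = (\<Sum>T\<in>(B \<union> C) \<rightarrow>\<^sub>E A. f T * g T)"
  proof (rule sum.reindex_bij_witness[where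
        i = "\<lambda>T. (restrict T B, restrict T C)" and j = "\<lambda>(T, U). merge B C (T, U)"])
    fix TU assume TU: "TU \<in> (B \<rightarrow>\<^sub>E A) \<times> (C \<rightarrow>\<^sub>E A)"
    obtain T U where [simp]: "TU = (T, U)" by (cases TU)
    have T: "T \<in> B \<rightarrow>\<^sub>E A" and U: "U \<in> C \<rightarrow>\<^sub>E A" using TU by auto
    have r1: "restrict (merge B C (T, U)) B = T" using T assms(1) by (auto simp: PiE_restrict)
    have r2: "restrict (merge B C (T, U)) C = U" using U assms(1) by (auto simp: PiE_restrict)
    show "(restrict ((\<lambda>(T, U). merge B C (T, U)) TU) B, restrict ((\<lambda>(T, U). merge B C (T, U)) TU) C) = TU"
      using r1 r2 by simp
    show "(\<lambda>(T, U). merge B C (T, U)) TU \<in> B \<union> C \<rightarrow>\<^sub>E A"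
      using T U by (auto simp: merge_def PiE_iff extensional_def)
    show "f ((\<lambda>(T, U). merge B C (T, U)) TU) * g ((\<lambda>(T, U). merge B C (T, U)) TU) = (\<lambda>(T, U). f T * g U) TU"
      using f[of "merge B C (T, U)"] g[of "merge B C (T, U)"] r1 r2 by simp
  next
    fix T assume T: "T \<in> B \<union> C \<rightarrow>\<^sub>E A"
    show "(\<lambda>(T, U). merge B C (T, U)) (restrict T B, restrict T C) = T"
      using T by (auto simp: merge_def fun_eq_iff PiE_iff extensional_def)
    show "(restrict T B, restrict T C) \<in> (B \<rightarrow>\<^sub>E A) \<times> (C \<rightarrow>\<^sub>E A)" using T by auto
  qed
  finally show ?thesis by simp
qed

lemma sum_subsets_card:
  fixes f :: "nat \<Rightarrow> real"
  assumes "finite A"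
  shows "(\<Sum>B\<in>Pow A. f (card B)) = (\<Sum>j\<le>card A. real (card A choose j) * f j)"
proof -
  have "(\<Sum>B\<in>Pow A. f (card B)) = (\<Sum>j\<in>{..card A}. \<Sum>B\<in>{B\<in>Pow A. card B = j}. f (card B))"
    using assms by (intro sum.group[symmetric]) (auto intro: card_mono)
  also have "\<dots> = (\<Sum>j\<le>card A. real (card A choose j) * f j)"
  proof (rule sum.cong)
    fix j
    have "(\<Sum>B\<in>{B\<in>Pow A. card B = j}. f (card B)) = real (card {B. B \<subseteq> A \<and> card B = j}) * f j"
      by simp
    then show "(\<Sum>B\<in>{B\<in>Pow A. card B = j}. f (card B)) = real (card A choose j) * f j"
      using n_subsets[OF assms, of j] by simp
  qed simp
  finally show ?thesis .
qed

text \<open>Both sides obey the same recursion. Expanding m T S over the block of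
  \<open>Min S\<close> and exchanging sums, the choice of T splits into independent choices on B and
  on S - B; counting blocks by size then produces the binomial coefficients of \<open>kappa\<close>.
  The index set is arbitrary rather than an initial segment because the induction is applied to
  blocks.\<close>

lemma (in prob_space) kappa_sum_eq:
  fixes Y :: "'t \<Rightarrow> 'a \<Rightarrow> real"
  assumes A: "finite A"
    and int: "\<And>(S::nat set) T. finite S \<Longrightarrow> T \<in> S \<rightarrow> A \<Longrightarrow> integrable M (\<lambda>\<omega>. \<Prod>i\<in>S. Y (T i) \<omega>)"
    and S: "finite S" "S \<noteq> {}"
  shows "kappa (\<lambda>n. expectation (\<lambda>\<omega>. (\<Sum>t\<in>A. Y t \<omega>) ^ n)) (card S) =
    (\<Sum>T\<in>S \<rightarrow>\<^sub>E A. set_cumulant (\<lambda>B. expectation (\<lambda>\<omega>. \<Prod>i\<in>B. Y (T i) \<omega>)) S)"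
proof -
  define mu where "mu n = expectation (\<lambda>\<omega>. (\<Sum>t\<in>A. Y t \<omega>) ^ n)" for n
  define m where "m T B = expectation (\<lambda>\<omega>. \<Prod>i\<in>B. Y (T i) \<omega>)" for T and B :: "nat set"
  have mu0: "mu 0 = 1" by (simp add: mu_def prob_space)
  have m0: "m T {} = 1" for T by (simp add: m_def prob_space)
  have m_restrict: "m (restrict T C) B = m T B" if "B \<subseteq> C" for T B C
    unfolding m_def using that by (intro Bochner_Integration.integral_cong prod.cong) auto
  have mu_m: "mu (card S) = (\<Sum>T\<in>S \<rightarrow>\<^sub>E A. m T S)" if S: "finite S" for S :: "nat set"
  proof -
    have "mu (card S) = expectation (\<lambda>\<omega>. \<Prod>i\<in>S. \<Sum>t\<in>A. Y t \<omega>)"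
      by (simp add: mu_def)
    also have "\<dots> = expectation (\<lambda>\<omega>. \<Sum>T\<in>S \<rightarrow>\<^sub>E A. \<Prod>i\<in>S. Y (T i) \<omega>)"
      using S A by (subst prod_sum_PiE) auto
    also have "\<dots> = (\<Sum>T\<in>S \<rightarrow>\<^sub>E A. m T S)"
      unfolding m_def using S by (intro Bochner_Integration.integral_sum int) (auto simp: PiE_def)
    finally show ?thesis .
  qed
  define Q where "Q S = (\<Sum>T\<in>S \<rightarrow>\<^sub>E A. set_cumulant (m T) S)" for S
  have "Q S = kappa mu (card S)" using S
  proof (induction "card S" arbitrary: S rule: less_induct)
    case less
    note S = less.prems
    let ?a = "Min S"
    let ?S = "S - {?a}"
    have a: "?a \<in> S" using S by simp
    have K_restrict: "set_cumulant (m (restrict T B)) B = set_cumulant (m T) B" if "B \<subseteq> S" for T B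
      using that S by (intro set_cumulant_cong m_restrict) (auto intro: finite_subset)
    obtain n where n: "card S = Suc n" using S by (metis card_gt_0_iff gr0_implies_Suc)
    have cn: "card ?S = n" using n a S by simp
    have "mu (Suc n) = (\<Sum>T\<in>S \<rightarrow>\<^sub>E A. \<Sum>B\<in>{B. B \<subseteq> S \<and> ?a \<in> B}. set_cumulant (m T) B * m T (S - B))"
      unfolding n[symmetric] mu_m[OF S(1)] by (intro sum.cong refl set_cumulant_expand S m0)
    also have "\<dots> = (\<Sum>B\<in>{B. B \<subseteq> S \<and> ?a \<in> B}. \<Sum>T\<in>S \<rightarrow>\<^sub>E A. set_cumulant (m T) B * m T (S - B))"
      by (rule sum.swap)
    also have "\<dots> = (\<Sum>B\<in>{B. B \<subseteq> S \<and> ?a \<in> B}. Q B * mu (card (S - B)))"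
    proof (rule sum.cong)
      fix B assume B: "B \<in> {B. B \<subseteq> S \<and> ?a \<in> B}"
      have "(\<Sum>T\<in>(B \<union> (S - B)) \<rightarrow>\<^sub>E A. set_cumulant (m T) B * m T (S - B)) =
          Q B * (\<Sum>T\<in>(S - B) \<rightarrow>\<^sub>E A. m T (S - B))"
        unfolding Q_def using B by (intro sum_PiE_Un K_restrict m_restrict) auto
      moreover have "B \<union> (S - B) = S" using B by auto
      ultimately show "(\<Sum>T\<in>S \<rightarrow>\<^sub>E A. set_cumulant (m T) B * m T (S - B)) = Q B * mu (card (S - B))"
        using mu_m[of "S - B"] S by simp
    qed simp
    also have "\<dots> = (\<Sum>B\<in>Pow ?S. Q (insert ?a B) * mu (n - card B))"
    proof (rule sum.reindex_bij_witness[where i = "insert ?a" and j = "\<lambda>B. B - {?a}"])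
      fix B assume B: "B \<in> {B. B \<subseteq> S \<and> ?a \<in> B}"
      then have "insert ?a (B - {?a}) = B" "S - B = ?S - (B - {?a})" by auto
      moreover have "card (?S - (B - {?a})) = n - card (B - {?a})"
        using B S cn by (subst card_Diff_subset) (auto intro: finite_subset)
      ultimately show "Q (insert ?a (B - {?a})) * mu (n - card (B - {?a})) = Q B * mu (card (S - B))"
        by simp
    qed (use a in auto)
    \<comment> \<open>Only B = ?S yields the full set S, which the induction hypothesis does not
      cover; \<open>Q S\<close> stays there as the unknown that the recursion is finally solved
      for.\<close>
    also have "\<dots> = (\<Sum>B\<in>Pow ?S. (if card B = n then Q S else kappa mu (Suc (card B))) * mu (n - card B))"
    proof (rule sum.cong)
      fix B assume B: "B \<in> Pow ?S"
      then have fB: "finite B" using S by (auto intro: finite_subset)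
      have cB: "card (insert ?a B) = Suc (card B)" using B fB by (subst card_insert_disjoint) auto
      show "Q (insert ?a B) * mu (n - card B) =
          (if card B = n then Q S else kappa mu (Suc (card B))) * mu (n - card B)"
      proof (cases "card B = n")
        case True
        then have "B = ?S" using B cn S by (intro card_subset_eq) auto
        then show ?thesis using True a by (simp add: insert_absorb)
      next
        case False
        have "card B \<le> n" using B cn S by (metis PowD card_mono finite_Diff)
        then have "card (insert ?a B) < card S" using False cB n by simp
        then have "Q (insert ?a B) = kappa mu (card (insert ?a B))"
          using fB by (intro less.hyps) auto
        then show ?thesis using False cB by simp
      qed
    qed simp
    also have "\<dots> = (\<Sum>j\<le>n. real (n choose j) * ((if j = n then Q S else kappa mu (Suc j)) * mu (n - j)))"
      using sum_subsets_card[of ?S "\<lambda>j. (if j = n then Q S else kappa mu (Suc j)) * mu (n - j)"] S cn by simp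
    also have "\<dots> = (\<Sum>j<n. real (n choose j) * kappa mu (Suc j) * mu (n - j)) + Q S"
      by (simp add: mu0 mult.assoc flip: lessThan_Suc_atMost)
    finally have "Q S = kappa mu (Suc n)" by (simp add: kappa.simps(2)[of mu n] mu0)
    then show ?case by (simp add: n)
  qed
  then show ?thesis by (simp add: Q_def mu_def[abs_def] m_def[abs_def])
qed

subsection \<open>Triangle counts\<close>

lemma prod_nsets_3_2:
  fixes f :: "'v set \<Rightarrow> real"
  assumes "x \<noteq> y" "y \<noteq> z" "x \<noteq> z"
  shows "(\<Prod>e\<in>nsets {x, y, z} 2. f e) = f {x, y} * f {y, z} * f {x, z}"
proof -
  have "nsets {x, y, z} 2 = {{x, y}, {y, z}, {x, z}}"
    using assms by (auto simp: nsets_2_eq insert_commute)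
  then show ?thesis
    using assms by (simp add: doubleton_eq_iff)
qed

text \<open>The zero diagonal leaves only closed walks through three distinct vertices, and every
  triangle carries 6 of them, one for each ordering of its vertices.\<close>

lemma trace_cube_eq:
  fixes A :: "'v \<Rightarrow> 'v \<Rightarrow> real" and F :: "'v set \<Rightarrow> real"
  assumes S: "finite S" and A: "\<And>i j. i \<in> S \<Longrightarrow> j \<in> S \<Longrightarrow> A i j = (if i = j then 0 else F {i, j})"
  shows "trace_on S (mat_mult_on S (mat_mult_on S A A) A) = 6 * (\<Sum>t\<in>nsets S 3. \<Prod>e\<in>nsets t 2. F e)"
proof -
  define D where "D = {(i, j, l). i \<in> S \<and> j \<in> S \<and> l \<in> S \<and> i \<noteq> j \<and> j \<noteq> l \<and> i \<noteq> l}"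
  let ?g = "\<lambda>(i, j, l). {i, j, l} :: 'v set"
  let ?f = "\<lambda>(i, j, l). \<Prod>e\<in>nsets {i, j, l} 2. F e"
  have "trace_on S (mat_mult_on S (mat_mult_on S A A) A) = (\<Sum>i\<in>S. \<Sum>l\<in>S. \<Sum>j\<in>S. A i j * A j l * A l i)"
    by (simp add: trace_on_def mat_mult_on_def sum_distrib_right)
  also have "\<dots> = (\<Sum>(i, l, j)\<in>S \<times> S \<times> S. A i j * A j l * A l i)"
    by (simp add: sum.cartesian_product)
  also have "\<dots> = (\<Sum>(i, l, j)\<in>D. A i j * A j l * A l i)"
    by (intro sum.mono_neutral_right) (auto simp: S D_def A)
  also have "\<dots> = (\<Sum>ijl\<in>D. ?f ijl)"
  proof (rule sum.cong)
    fix ijl assume "ijl \<in> D"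
    then show "(\<lambda>(i, l, j). A i j * A j l * A l i) ijl = ?f ijl"
      by (auto simp: D_def A prod_nsets_3_2 insert_commute)
  qed simp
  also have "\<dots> = (\<Sum>t\<in>nsets S 3. \<Sum>ijl\<in>{ijl\<in>D. ?g ijl = t}. ?f ijl)"
  proof (rule sum.group[symmetric])
    show "finite D" by (rule finite_subset[of _ "S \<times> S \<times> S"]) (use S in \<open>auto simp: D_def\<close>)
    show "finite (nsets S 3)" using S by (rule finite_imp_finite_nsets)
    show "?g ` D \<subseteq> nsets S 3" by (auto simp: D_def nsets_def)
  qed
  also have "\<dots> = (\<Sum>t\<in>nsets S 3. 6 * (\<Prod>e\<in>nsets t 2. F e))"
  proof (rule sum.cong)
    fix t assume "t \<in> nsets S 3"
    then obtain x y z where t: "t = {x, y, z}" and d: "x \<noteq> y" "y \<noteq> z" "x \<noteq> z" and xyz: "x \<in> S" "y \<in> S" "z \<in> S"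
      by (auto simp: nsets_def card_3_iff)
    have "{ijl\<in>D. ?g ijl = t} = {(x,y,z),(x,z,y),(y,x,z),(y,z,x),(z,x,y),(z,y,x)}" (is "_ = ?six")
    proof
      show "?six \<subseteq> {ijl\<in>D. ?g ijl = t}" using d xyz by (auto simp: D_def t)
      show "{ijl\<in>D. ?g ijl = t} \<subseteq> ?six"
      proof
        fix u assume "u \<in> {ijl\<in>D. ?g ijl = t}"
        then obtain i j l where u: "u = (i, j, l)" and e: "{i, j, l} = {x, y, z}"
          and ne: "i \<noteq> j" "j \<noteq> l" "i \<noteq> l" by (auto simp: D_def t)
        have "i \<in> {x, y, z}" "j \<in> {x, y, z}" "l \<in> {x, y, z}" using e by blast+
        then show "u \<in> ?six" unfolding u using ne by auto
      qed
    qed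
    moreover have "card ?six = 6" using d by (auto simp: card_insert_if)
    moreover have "(\<Sum>ijl\<in>{ijl\<in>D. ?g ijl = t}. ?f ijl) = (\<Sum>ijl\<in>{ijl\<in>D. ?g ijl = t}. \<Prod>e\<in>nsets t 2. F e)"
      by (intro sum.cong) auto
    ultimately show "(\<Sum>ijl\<in>{ijl\<in>D. ?g ijl = t}. ?f ijl) = 6 * (\<Prod>e\<in>nsets t 2. F e)"
      by simp
  qed simp
  finally show ?thesis by (simp add: sum_distrib_left)
qed

section \<open>Edge weights, edge probabilities and joint moments of triangles\<close>

definition wt :: "(real \<Rightarrow> real) \<Rightarrow> real \<Rightarrow> real \<Rightarrow> real" where
  "wt \<psi> \<alpha> x = 1 + \<alpha> * (\<psi> x)\<^sup>2"

text \<open>The distance |g a - g b| of the two endpoints, written so that it depends on the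
  unordered edge {a, b}. The codomain is generic because positions are integers in the lattice sums
  and reals in the limiting integrals.\<close>

definition gap :: "('v \<Rightarrow> 'b::linordered_idom) \<Rightarrow> 'v set \<Rightarrow> 'b" where
  "gap g e = Max (g ` e) - Min (g ` e)"

lemma gap_doubleton [simp]: "gap g {a, b} = \<bar>g a - g b\<bar>"
  by (auto simp: gap_def max_def min_def)

lemma X3_eq:
  assumes even: "\<And>x. \<psi> (- x) = \<psi> x"
  shows "X3 \<psi> \<alpha> n R a \<omega> = (\<Sum>t\<in>nsets (idx n) 3. 6 * (\<Prod>e\<in>nsets t 2.
    wt \<psi> \<alpha> (real_of_int (gap id e) / R) * a (Min e) (Max e) \<omega>))"
proof -
  have sw: "\<psi> (real_of_int (i - j) / R) = \<psi> (real_of_int (j - i) / R)" for i j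
    using even[of "real_of_int (j - i) / R"] by (simp add: diff_divide_distrib)
  have "wmatrix \<psi> \<alpha> R (\<lambda>i j. a i j \<omega>) i j = (if i = j then 0 else
     wt \<psi> \<alpha> (real_of_int (gap id {i, j}) / R) * a (Min {i, j}) (Max {i, j}) \<omega>)" for i j
    using sw[of i j] by (auto simp: wmatrix_def wt_def min_def max_def)
  then have "X3 \<psi> \<alpha> n R a \<omega> = 6 * (\<Sum>t\<in>nsets (idx n) 3. \<Prod>e\<in>nsets t 2.
    wt \<psi> \<alpha> (real_of_int (gap id e) / R) * a (Min e) (Max e) \<omega>)"
    unfolding X3_def Let_def by (intro trace_cube_eq) (auto simp: idx_def)
  then show ?thesis by (simp only: sum_distrib_left)
qed


lemma Min_Max_doubleton:
  assumes "e \<in> nsets V 2"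
  obtains i j :: int where "i < j" "i \<in> V" "j \<in> V" "e = {i, j}" "Min e = i" "Max e = j"
proof -
  from assms obtain x y where "e = {x, y}" "x \<noteq> y" "x \<in> V" "y \<in> V" by (rule nsets2_E)
  then show thesis
    using that[of x y] that[of y x] by (cases "x < y") (auto simp: insert_commute)
qed

lemma gap_id: "gap id e = Max e - Min e"
  by (simp add: gap_def)

definition eprob :: "(real \<Rightarrow> real) \<Rightarrow> nat \<Rightarrow> real \<Rightarrow> real \<Rightarrow> int set \<Rightarrow> real" where
  "eprob \<psi> n c R e = c / size_of n * exp (- (\<psi> (real_of_int (gap id e) / R))\<^sup>2)"

text \<open>The expectation of the product of the weighted triangle indicators over B. Weights count
  with multiplicity, once per triangle, while probabilities count once per distinct edge, since 0/1
  variables are idempotent.\<close>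

definition joint_moment ::
  "(real \<Rightarrow> real) \<Rightarrow> real \<Rightarrow> nat \<Rightarrow> real \<Rightarrow> real \<Rightarrow> (nat \<Rightarrow> int set) \<Rightarrow> nat set \<Rightarrow> real" where
  "joint_moment \<psi> \<alpha> n c R T B =
     (\<Prod>i\<in>B. 6 * (\<Prod>e\<in>nsets (T i) 2. wt \<psi> \<alpha> (real_of_int (gap id e) / R))) *
     (\<Prod>e\<in>(\<Union>i\<in>B. nsets (T i) 2). eprob \<psi> n c R e)"

context
  fixes \<psi> :: "real \<Rightarrow> real" and \<alpha> :: real and n :: nat and c R :: real
    and M :: "'w measure" and a :: "int \<Rightarrow> int \<Rightarrow> 'w \<Rightarrow> real"
  assumes even: "\<And>x. \<psi> (- x) = \<psi> x"
    and fam: "edge_family \<psi> n c R M a"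
begin

interpretation prob_space M
  using fam by (simp add: edge_family_def)

private definition edge :: "int set \<Rightarrow> 'w \<Rightarrow> real" where
  "edge e = a (Min e) (Max e)"

private lemma edge_facts:
  assumes "e \<in> nsets (idx n) 2"
  shows edge_measurable: "edge e \<in> borel_measurable M"
    and edge_values: "\<omega> \<in> space M \<Longrightarrow> edge e \<omega> \<in> {0, 1}"
    and expectation_edge: "expectation (edge e) = eprob \<psi> n c R e"
proof -
  obtain i j where ij: "i < j" "i \<in> idx n" "j \<in> idx n" "e = {i, j}" "Min e = i" "Max e = j"
    using assms by (rule Min_Max_doubleton)
  have "indep_vars (\<lambda>_. borel) (\<lambda>(i, j). a i j) {(i, j). i \<in> idx n \<and> j \<in> idx n \<and> i < j}"
    using fam by (simp add: edge_family_def)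
  then have "(\<lambda>(i, j). a i j) (i, j) \<in> borel_measurable M"
    unfolding indep_vars_def using ij by blast
  then show meas: "edge e \<in> borel_measurable M" using ij by (simp add: edge_def)
  have vals: "\<forall>\<omega>\<in>space M. a i j \<omega> \<in> {0, 1}"
    and pr: "measure M {\<omega> \<in> space M. a i j \<omega> = 1} = edge_prob \<psi> n c R i j"
    using fam ij unfolding edge_family_def by blast+
  show "\<omega> \<in> space M \<Longrightarrow> edge e \<omega> \<in> {0, 1}" using vals ij by (simp add: edge_def)
  have "expectation (edge e) = expectation (indicator {\<omega> \<in> space M. a i j \<omega> = 1})"
    using vals ij by (intro Bochner_Integration.integral_cong) (auto simp: edge_def indicator_def)
  also have "\<dots> = edge_prob \<psi> n c R i j"
    using pr by (simp add: Int_absorb2 subset_iff)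
  also have "\<dots> = eprob \<psi> n c R e"
    using even[of "real_of_int (j - i) / R"] ij
    by (simp add: edge_prob_def eprob_def gap_id diff_divide_distrib)
  finally show "expectation (edge e) = eprob \<psi> n c R e" .
qed

private lemma expectation_prod_edges:
  assumes "finite G" "G \<subseteq> nsets (idx n) 2"
  shows "expectation (\<lambda>\<omega>. \<Prod>e\<in>G. edge e \<omega>) = (\<Prod>e\<in>G. eprob \<psi> n c R e)"
    and "integrable M (\<lambda>\<omega>. \<Prod>e\<in>G. edge e \<omega>)"
proof -
  let ?f = "\<lambda>e :: int set. (Min e, Max e)"
  have e_eq: "e = {Min e, Max e}" if "e \<in> nsets (idx n) 2" for e
    using that by (rule Min_Max_doubleton) auto
  have inj: "inj_on ?f G"
    using assms(2) e_eq by (intro inj_onI) (metis Pair_inject subsetD)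
  have pr: "(\<Prod>ij\<in>?f ` G. (\<lambda>(i, j). a i j) ij \<omega>) = (\<Prod>e\<in>G. edge e \<omega>)" for \<omega>
    by (simp add: prod.reindex[OF inj] edge_def)
  have "indep_vars (\<lambda>_. borel) (\<lambda>(i, j). a i j) {(i, j). i \<in> idx n \<and> j \<in> idx n \<and> i < j}"
    using fam by (simp add: edge_family_def)
  moreover have "?f ` G \<subseteq> {(i, j). i \<in> idx n \<and> j \<in> idx n \<and> i < j}"
  proof
    fix z assume "z \<in> ?f ` G"
    then obtain e where e: "e \<in> nsets (idx n) 2" "z = ?f e" using assms(2) by blast
    from e(1) show "z \<in> {(i, j). i \<in> idx n \<and> j \<in> idx n \<and> i < j}"
      by (rule Min_Max_doubleton) (simp add: e(2))
  qed
  ultimately have ind: "indep_vars (\<lambda>_. borel) (\<lambda>(i, j). a i j) (?f ` G)"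
    by (rule indep_vars_subset)
  have int: "integrable M ((\<lambda>(i, j). a i j) ij)" if ij: "ij \<in> ?f ` G" for ij
  proof -
    obtain e where e: "e \<in> nsets (idx n) 2" "ij = ?f e" using ij assms(2) by blast
    have "integrable M (edge e)"
    proof (intro integrable_const_bound[of _ 1] AE_I2 edge_measurable[OF e(1)])
      fix \<omega> assume "\<omega> \<in> space M"
      then show "norm (edge e \<omega>) \<le> 1" using edge_values[OF e(1), of \<omega>] by auto
    qed
    then show ?thesis using e(2) by (simp add: edge_def)
  qed
  have fin: "finite (?f ` G)" using assms(1) by simp
  show "integrable M (\<lambda>\<omega>. \<Prod>e\<in>G. edge e \<omega>)"
    using indep_vars_integrable[OF fin ind int] by (simp only: pr)
  have "expectation (\<lambda>\<omega>. \<Prod>e\<in>G. edge e \<omega>) = (\<Prod>ij\<in>?f ` G. expectation ((\<lambda>(i, j). a i j) ij))"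
    using indep_vars_lebesgue_integral[OF fin ind int] by (simp only: pr)
  also have "\<dots> = (\<Prod>e\<in>G. expectation (edge e))"
    by (simp add: prod.reindex[OF inj] edge_def)
  also have "\<dots> = (\<Prod>e\<in>G. eprob \<psi> n c R e)"
    using assms(2) expectation_edge by (intro prod.cong) auto
  finally show "expectation (\<lambda>\<omega>. \<Prod>e\<in>G. edge e \<omega>) = (\<Prod>e\<in>G. eprob \<psi> n c R e)" .
qed

text \<open>Idempotence of 0/1 values: either all edges involved take the value 1, or one of them
  makes both sides vanish, whatever its multiplicity.\<close>

private lemma prod_prod_edges:
  assumes "finite B" "\<And>i. i \<in> B \<Longrightarrow> finite (U i)" "\<And>i. i \<in> B \<Longrightarrow> U i \<subseteq> nsets (idx n) 2" "\<omega> \<in> space M"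
  shows "(\<Prod>i\<in>B. \<Prod>e\<in>U i. edge e \<omega>) = (\<Prod>e\<in>(\<Union>i\<in>B. U i). edge e \<omega>)"
proof (cases "\<forall>e\<in>(\<Union>i\<in>B. U i). edge e \<omega> = 1")
  case True
  then have "(\<Prod>i\<in>B. \<Prod>e\<in>U i. edge e \<omega>) = 1" by (intro prod.neutral ballI) auto
  moreover have "(\<Prod>e\<in>(\<Union>i\<in>B. U i). edge e \<omega>) = 1" using True by (intro prod.neutral) auto
  ultimately show ?thesis by simp
next
  case False
  then obtain i e where ie: "i \<in> B" "e \<in> U i" "edge e \<omega> \<noteq> 1" by auto
  then have z: "edge e \<omega> = 0" using edge_values[of e \<omega>] assms(3,4) by blast
  have "(\<Prod>e\<in>U i. edge e \<omega>) = 0" using ie z assms(2) by (intro prod_zero) auto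
  then have "(\<Prod>i\<in>B. \<Prod>e\<in>U i. edge e \<omega>) = 0" using ie assms(1) by (intro prod_zero) auto
  moreover have "(\<Prod>e\<in>(\<Union>i\<in>B. U i). edge e \<omega>) = 0"
    using ie z assms(1,2) by (intro prod_zero) auto
  ultimately show ?thesis by simp
qed

lemma cumulant_X3:
  assumes "k \<ge> 1"
  shows "cumulant k M (X3 \<psi> \<alpha> n R a) =
    (\<Sum>T\<in>{..<k} \<rightarrow>\<^sub>E nsets (idx n) 3. set_cumulant (joint_moment \<psi> \<alpha> n c R T) {..<k})"
    and "cumulant k M (\<lambda>\<omega>. l * X3 \<psi> \<alpha> n R a \<omega>) = l ^ k * cumulant k M (X3 \<psi> \<alpha> n R a)"
proof -
  let ?w = "\<lambda>e. wt \<psi> \<alpha> (real_of_int (gap id e) / R)"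
  define Y where "Y t \<omega> = 6 * (\<Prod>e\<in>nsets t 2. ?w e * edge e \<omega>)" for t \<omega>
  have X: "X3 \<psi> \<alpha> n R a = (\<lambda>\<omega>. \<Sum>t\<in>nsets (idx n) 3. Y t \<omega>)"
    by (rule ext, subst X3_eq[where \<psi> = \<psi>, OF even]) (simp add: Y_def edge_def)
  have fi: "finite (idx n)" by (simp add: idx_def)
  have sub: "nsets t 2 \<subseteq> nsets (idx n) 2" "finite (nsets t 2)" if "t \<in> nsets (idx n) 3" for t
    using that by (auto simp: nsets_def intro: finite_imp_finite_nsets)
  have prodY: "(\<Prod>i\<in>B. Y (T i) \<omega>) = (\<Prod>i\<in>B. 6 * (\<Prod>e\<in>nsets (T i) 2. ?w e)) *
      (\<Prod>e\<in>(\<Union>i\<in>B. nsets (T i) 2). edge e \<omega>)"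
    if "finite B" "T \<in> B \<rightarrow> nsets (idx n) 3" "\<omega> \<in> space M" for B :: "nat set" and T \<omega>
  proof -
    have "(\<Prod>i\<in>B. Y (T i) \<omega>) =
        (\<Prod>i\<in>B. 6 * (\<Prod>e\<in>nsets (T i) 2. ?w e)) * (\<Prod>i\<in>B. \<Prod>e\<in>nsets (T i) 2. edge e \<omega>)"
      by (simp add: Y_def prod.distrib mult.assoc)
    also have "(\<Prod>i\<in>B. \<Prod>e\<in>nsets (T i) 2. edge e \<omega>) = (\<Prod>e\<in>(\<Union>i\<in>B. nsets (T i) 2). edge e \<omega>)"
      using that sub by (intro prod_prod_edges) auto
    finally show ?thesis .
  qed
  have G: "finite (\<Union>i\<in>B. nsets (T i) 2)" "(\<Union>i\<in>B. nsets (T i) 2) \<subseteq> nsets (idx n) 2"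
    if "finite B" "T \<in> B \<rightarrow> nsets (idx n) 3" for B :: "nat set" and T
    using that sub by blast+
  have int: "integrable M (\<lambda>\<omega>. \<Prod>i\<in>B. Y (T i) \<omega>)"
    and E: "expectation (\<lambda>\<omega>. \<Prod>i\<in>B. Y (T i) \<omega>) = joint_moment \<psi> \<alpha> n c R T B"
    if "finite B" "T \<in> B \<rightarrow> nsets (idx n) 3" for B :: "nat set" and T
  proof -
    have "integrable M (\<lambda>\<omega>. (\<Prod>i\<in>B. 6 * (\<Prod>e\<in>nsets (T i) 2. ?w e)) *
      (\<Prod>e\<in>(\<Union>i\<in>B. nsets (T i) 2). edge e \<omega>))"
      by (intro integrable_mult_right expectation_prod_edges G that)
    then show "integrable M (\<lambda>\<omega>. \<Prod>i\<in>B. Y (T i) \<omega>)"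
      by (rule Bochner_Integration.integrable_cong[THEN iffD1, rotated -1])
        (simp_all add: prodY that)
    have "expectation (\<lambda>\<omega>. \<Prod>i\<in>B. Y (T i) \<omega>) = expectation (\<lambda>\<omega>. (\<Prod>i\<in>B. 6 * (\<Prod>e\<in>nsets (T i) 2. ?w e)) *
      (\<Prod>e\<in>(\<Union>i\<in>B. nsets (T i) 2). edge e \<omega>))"
      by (intro Bochner_Integration.integral_cong) (simp_all add: prodY that)
    also have "\<dots> = joint_moment \<psi> \<alpha> n c R T B"
      unfolding joint_moment_def expectation_prod_edges(1)[OF G[OF that], symmetric] by simp
    finally show "expectation (\<lambda>\<omega>. \<Prod>i\<in>B. Y (T i) \<omega>) = joint_moment \<psi> \<alpha> n c R T B" .
  qed
  have Ymeas: "Y t \<in> borel_measurable M" if "t \<in> nsets (idx n) 3" for t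
    unfolding Y_def using sub[OF that] edge_measurable
    by (intro borel_measurable_times borel_measurable_prod borel_measurable_const) auto
  have Xmeas: "X3 \<psi> \<alpha> n R a \<in> borel_measurable M"
    unfolding X by (intro borel_measurable_sum Ymeas)
  \<comment> \<open>\<open>X3\<close> factors through the 0/1 configuration of the finitely many
    edges, hence takes finitely many values.\<close>
  have Xfin: "finite (X3 \<psi> \<alpha> n R a ` space M)"
  proof (rule finite_subset)
    let ?E = "nsets (idx n) 2"
    let ?X = "\<lambda>b. \<Sum>t\<in>nsets (idx n) 3. 6 * (\<Prod>e\<in>nsets t 2. ?w e * b e)"
    show "X3 \<psi> \<alpha> n R a ` space M \<subseteq> ?X ` (?E \<rightarrow>\<^sub>E {0, 1})"
    proof
      fix x assume "x \<in> X3 \<psi> \<alpha> n R a ` space M"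
      then obtain \<omega> where \<omega>: "\<omega> \<in> space M" and x: "x = (\<Sum>t\<in>nsets (idx n) 3. Y t \<omega>)" by (auto simp: X)
      have "x = ?X (restrict (\<lambda>e. edge e \<omega>) ?E)"
        unfolding x Y_def using sub
        by (intro sum.cong arg_cong[where f = "(*) 6"] prod.cong) (auto simp: subset_iff)
      moreover have "restrict (\<lambda>e. edge e \<omega>) ?E \<in> ?E \<rightarrow>\<^sub>E {0, 1}"
        using edge_values \<omega> by (auto simp: PiE_iff)
      ultimately show "x \<in> ?X ` (?E \<rightarrow>\<^sub>E {0, 1})" by blast
    qed
    show "finite (?X ` (?E \<rightarrow>\<^sub>E {0, 1}))"
      by (intro finite_imageI finite_PiE finite_imp_finite_nsets fi) auto
  qed
  have cum: "cumulant k M (X3 \<psi> \<alpha> n R a) = kappa (\<lambda>j. expectation (\<lambda>\<omega>. X3 \<psi> \<alpha> n R a \<omega> ^ j)) k"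
    by (rule cumulant_eq_kappa[OF Xmeas Xfin])
  have "kappa (\<lambda>j. expectation (\<lambda>\<omega>. X3 \<psi> \<alpha> n R a \<omega> ^ j)) k =
     (\<Sum>T\<in>{..<k} \<rightarrow>\<^sub>E nsets (idx n) 3. set_cumulant (\<lambda>B. expectation (\<lambda>\<omega>. \<Prod>i\<in>B. Y (T i) \<omega>)) {..<k})"
    using kappa_sum_eq[where A = "nsets (idx n) 3" and Y = Y and S = "{..<k}"] int assms fi
    by (simp add: X finite_imp_finite_nsets lessThan_empty_iff)
  also have "\<dots> = (\<Sum>T\<in>{..<k} \<rightarrow>\<^sub>E nsets (idx n) 3. set_cumulant (joint_moment \<psi> \<alpha> n c R T) {..<k})"
    by (intro sum.cong refl set_cumulant_cong E) (auto intro: finite_subset)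
  finally show "cumulant k M (X3 \<psi> \<alpha> n R a) =
    (\<Sum>T\<in>{..<k} \<rightarrow>\<^sub>E nsets (idx n) 3. set_cumulant (joint_moment \<psi> \<alpha> n c R T) {..<k})"
    by (simp add: cum)
  obtain k' where k: "k = Suc k'" using assms by (cases k) auto
  have "cumulant k M (\<lambda>\<omega>. l * X3 \<psi> \<alpha> n R a \<omega>) = kappa (\<lambda>j. expectation (\<lambda>\<omega>. (l * X3 \<psi> \<alpha> n R a \<omega>) ^ j)) k"
  proof (rule cumulant_eq_kappa)
    show "(\<lambda>\<omega>. l * X3 \<psi> \<alpha> n R a \<omega>) \<in> borel_measurable M" using Xmeas by simp
    show "finite ((\<lambda>\<omega>. l * X3 \<psi> \<alpha> n R a \<omega>) ` space M)"
      using finite_imageI[OF Xfin, of "(*) l"] by (simp add: image_image)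
  qed
  also have "\<dots> = kappa (\<lambda>j. l ^ j * expectation (\<lambda>\<omega>. X3 \<psi> \<alpha> n R a \<omega> ^ j)) k"
    by (simp add: power_mult_distrib)
  also have "\<dots> = l ^ k * kappa (\<lambda>j. expectation (\<lambda>\<omega>. X3 \<psi> \<alpha> n R a \<omega> ^ j)) k"
    unfolding k by (rule kappa_scale) (simp add: prob_space)
  finally show "cumulant k M (\<lambda>\<omega>. l * X3 \<psi> \<alpha> n R a \<omega>) = l ^ k * cumulant k M (X3 \<psi> \<alpha> n R a)"
    by (simp add: cum)
qed

end

subsection \<open>Linked families of triangles\<close>

definition edges :: "(nat \<Rightarrow> 'v set) \<Rightarrow> nat set \<Rightarrow> 'v set set" where
  "edges T B = (\<Union>i\<in>B. nsets (T i) 2)"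

text \<open>Connectedness of S when two indices are joined if their triangles share an edge. The
  formulation by cuts fits both uses: its failure supplies the separating set for
  \<open>set_cumulant_disconnected\<close>, and its truth supplies a shared edge for every
  splitting.\<close>

definition linked :: "(nat \<Rightarrow> 'v set) \<Rightarrow> nat set \<Rightarrow> bool" where
  "linked T S \<longleftrightarrow> (\<forall>B. B \<subseteq> S \<and> B \<noteq> {} \<and> B \<noteq> S \<longrightarrow> edges T B \<inter> edges T (S - B) \<noteq> {})"

lemma edges_Un: "edges T (A \<union> B) = edges T A \<union> edges T B"
  by (auto simp: edges_def)

lemma finite_edges:
  assumes "finite B" "\<And>i. i \<in> B \<Longrightarrow> finite (T i)"
  shows "finite (edges T B)"
  using assms by (auto simp: edges_def intro: finite_imp_finite_nsets)

text \<open>All hypotheses on joint moments come from the identity \<open>split\<close>: m B * m (A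
  - B) equals m A times the probabilities of the edges shared by B and A - B, which the left side
  counts twice. No shared edge means factorisation, probabilities at most 1 give
  supermultiplicativity, and one shared edge gains the factor c / N. The constant is fixed before
  all model parameters, so it is uniform along any limiting sequence.\<close>

lemma cumulant_bound_linked:
  assumes "k \<ge> 1"
  obtains C where "C \<ge> 0" and "\<And>\<psi> \<alpha> n c R. 0 \<le> \<alpha> \<Longrightarrow> 0 < c \<Longrightarrow> c \<le> size_of n \<Longrightarrow>
     \<bar>(\<Sum>T\<in>{..<k} \<rightarrow>\<^sub>E nsets (idx n) 3. set_cumulant (joint_moment \<psi> \<alpha> n c R T) {..<k})
       - (\<Sum>T\<in>{T\<in>{..<k} \<rightarrow>\<^sub>E nsets (idx n) 3. linked T {..<k}}. joint_moment \<psi> \<alpha> n c R T {..<k})\<bar>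
     \<le> C * (c / size_of n) *
       (\<Sum>T\<in>{T\<in>{..<k} \<rightarrow>\<^sub>E nsets (idx n) 3. linked T {..<k}}. joint_moment \<psi> \<alpha> n c R T {..<k})"
proof -
  have ne: "{..<k} \<noteq> {}" using assms by (auto simp: lessThan_empty_iff)
  obtain C where C: "C \<ge> 0" and
    bound: "\<And>m (S::nat set) \<delta>. finite S \<Longrightarrow> S \<noteq> {} \<Longrightarrow> card S = k \<Longrightarrow> (\<forall>B\<subseteq>S. 0 \<le> m B) \<Longrightarrow>
     (\<forall>A\<subseteq>S. \<forall>B\<subseteq>A. m B * m (A - B) \<le> m A) \<Longrightarrow>
     (\<forall>B\<subset>S. B \<noteq> {} \<longrightarrow> m B * m (S - B) \<le> \<delta> * m S) \<Longrightarrow> 0 \<le> \<delta> \<Longrightarrow>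
     \<bar>set_cumulant m S - m S\<bar> \<le> C * \<delta> * m S"
    using set_cumulant_connected[of k] by metis
  show thesis
  proof (rule that[OF C])
    fix \<psi> :: "real \<Rightarrow> real" and \<alpha> :: real and n :: nat and c R :: real
    assume \<alpha>: "0 \<le> \<alpha>" and c: "0 < c" "c \<le> size_of n"
    let ?\<T> = "{..<k} \<rightarrow>\<^sub>E nsets (idx n) 3"
    let ?L = "{T\<in>?\<T>. linked T {..<k}}"
    let ?m = "joint_moment \<psi> \<alpha> n c R"
    let ?p = "eprob \<psi> n c R"
    let ?\<delta> = "c / size_of n"
    have \<delta>: "0 \<le> ?\<delta>" "?\<delta> \<le> 1" using c by auto
    have p: "0 \<le> ?p e" "?p e \<le> ?\<delta>" for e
    proof -
      have "exp (- (\<psi> (real_of_int (gap id e) / R))\<^sup>2) \<le> 1" by simp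
      then show "0 \<le> ?p e" "?p e \<le> ?\<delta>"
        unfolding eprob_def using \<delta> by (auto intro!: mult_nonneg_nonneg mult_left_le simp del: times_divide_eq_left)
    qed
    have p1: "?p e \<le> 1" for e using p(2) \<delta>(2) by (rule order_trans)
    define W where "W T B = (\<Prod>i\<in>B. 6 * (\<Prod>e\<in>nsets (T i) 2. wt \<psi> \<alpha> (real_of_int (gap id e) / R)))"
      for T :: "nat \<Rightarrow> int set" and B
    have W0: "0 \<le> W T B" for T B
      using \<alpha> by (auto simp: W_def wt_def intro!: prod_nonneg mult_nonneg_nonneg)
    have m_eq: "?m T B = W T B * prod ?p (edges T B)" for T B
      by (simp add: joint_moment_def W_def edges_def)
    have m0: "0 \<le> ?m T B" for T B
      unfolding m_eq using p by (intro mult_nonneg_nonneg W0 prod_nonneg) auto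
    have fe: "finite (edges T B)" if "T \<in> ?\<T>" "B \<subseteq> {..<k}" for T B
    proof (rule finite_edges)
      show "finite B" using finite_subset[OF that(2)] by simp
      show "finite (T i)" if "i \<in> B" for i
        using \<open>T \<in> ?\<T>\<close> \<open>B \<subseteq> {..<k}\<close> that by (auto simp: nsets_def)
    qed
    have split: "?m T B * ?m T (A - B) = ?m T A * prod ?p (edges T B \<inter> edges T (A - B))"
      if "T \<in> ?\<T>" "A \<subseteq> {..<k}" "B \<subseteq> A" for T A B
    proof -
      have un: "edges T B \<union> edges T (A - B) = edges T A"
        using that(3) by (simp add: edges_Un[symmetric] Un_absorb1)
      have "W T B * W T (A - B) = W T A"
        using prod.subset_diff[OF that(3), of "\<lambda>i. 6 * (\<Prod>e\<in>nsets (T i) 2. wt \<psi> \<alpha> (real_of_int (gap id e) / R))"]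
          that finite_subset[OF that(2)] by (simp add: W_def mult.commute)
      moreover have "prod ?p (edges T B) * prod ?p (edges T (A - B)) =
          prod ?p (edges T A) * prod ?p (edges T B \<inter> edges T (A - B))"
      proof -
        have "finite (edges T B)" by (rule fe) (use that in auto)
        moreover have "finite (edges T (A - B))" by (rule fe) (use that in auto)
        ultimately show ?thesis
          using prod.union_inter[of "edges T B" "edges T (A - B)" ?p] by (simp only: un)
      qed
      moreover have "W T B * prod ?p (edges T B) * (W T (A - B) * prod ?p (edges T (A - B))) =
          (W T B * W T (A - B)) * (prod ?p (edges T B) * prod ?p (edges T (A - B)))"
        by (simp only: mult_ac)
      ultimately show ?thesis unfolding m_eq by (simp only: mult.assoc)
    qed
    have not_linked: "set_cumulant (?m T) {..<k} = 0" if T: "T \<in> ?\<T>" "\<not> linked T {..<k}" for T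
    proof -
      from T(2) obtain B where B: "B \<subseteq> {..<k}" "B \<noteq> {}" "B \<noteq> {..<k}"
        and disj: "edges T B \<inter> edges T ({..<k} - B) = {}"
        by (auto simp: linked_def)
      show ?thesis
      proof (rule set_cumulant_disconnected[where A = B and m = "?m T"])
        show "?m T {} = 1" by (simp add: joint_moment_def)
        show "?m T B' = ?m T (B' \<inter> B) * ?m T (B' - B)" if B': "B' \<subseteq> {..<k}" for B'
        proof -
          have "edges T (B' \<inter> B) \<inter> edges T (B' - B) = {}"
            using disj B' by (auto simp: edges_def)
          then show ?thesis
            using split[OF T(1) B', of "B' \<inter> B"] by (simp add: Diff_Int)
        qed
      qed (use B in auto)
    qed
    have linked: "\<bar>set_cumulant (?m T) {..<k} - ?m T {..<k}\<bar> \<le> C * ?\<delta> * ?m T {..<k}" if "T \<in> ?L" for T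
    proof (rule bound[where m = "?m T"])
      have T: "T \<in> ?\<T>" "linked T {..<k}" using that by auto
      show "\<forall>A\<subseteq>{..<k}. \<forall>B\<subseteq>A. ?m T B * ?m T (A - B) \<le> ?m T A"
      proof (intro allI impI)
        fix A B assume AB: "A \<subseteq> {..<k}" "B \<subseteq> A"
        have "prod ?p (edges T B \<inter> edges T (A - B)) \<le> 1"
          using p p1 by (intro prod_le_1) auto
        then show "?m T B * ?m T (A - B) \<le> ?m T A"
          unfolding split[OF T(1) AB] using m0 by (intro mult_left_le) auto
      qed
      show "\<forall>B\<subset>{..<k}. B \<noteq> {} \<longrightarrow> ?m T B * ?m T ({..<k} - B) \<le> ?\<delta> * ?m T {..<k}"
      proof (intro allI impI)
        fix B assume B: "B \<subset> {..<k}" "B \<noteq> {}"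
        let ?I = "edges T B \<inter> edges T ({..<k} - B)"
        obtain e where e: "e \<in> ?I" using T(2) B by (auto simp: linked_def)
        have "finite ?I" using fe[OF T(1), of B] B by auto
        then have "prod ?p ?I = ?p e * prod ?p (?I - {e})" using e by (rule prod.remove)
        also have "\<dots> \<le> ?\<delta> * 1"
          using p p1 \<delta> by (intro mult_mono prod_le_1 prod_nonneg) auto
        finally have "prod ?p ?I \<le> ?\<delta>" by simp
        then have "?m T {..<k} * prod ?p ?I \<le> ?m T {..<k} * ?\<delta>"
          using m0 by (intro mult_left_mono) auto
        then show "?m T B * ?m T ({..<k} - B) \<le> ?\<delta> * ?m T {..<k}"
          using split[OF T(1), of "{..<k}" B] B by (simp add: mult.commute)
      qed
    qed (use m0 \<delta> ne in auto)
    have fin: "finite ?\<T>"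
      by (intro finite_PiE finite_imp_finite_nsets) (auto simp: idx_def)
    have "(\<Sum>T\<in>?\<T>. set_cumulant (?m T) {..<k}) = (\<Sum>T\<in>?L. set_cumulant (?m T) {..<k})"
      using not_linked fin by (intro sum.mono_neutral_right) auto
    then have "\<bar>(\<Sum>T\<in>?\<T>. set_cumulant (?m T) {..<k}) - (\<Sum>T\<in>?L. ?m T {..<k})\<bar>
        = \<bar>\<Sum>T\<in>?L. set_cumulant (?m T) {..<k} - ?m T {..<k}\<bar>"
      by (simp add: sum_subtractf)
    also have "\<dots> \<le> (\<Sum>T\<in>?L. C * ?\<delta> * ?m T {..<k})"
      by (rule order_trans[OF sum_abs sum_mono[OF linked]])
    finally show "\<bar>(\<Sum>T\<in>?\<T>. set_cumulant (?m T) {..<k}) - (\<Sum>T\<in>?L. ?m T {..<k})\<bar>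
        \<le> C * ?\<delta> * (\<Sum>T\<in>?L. ?m T {..<k})"
      by (simp add: sum_distrib_left)
  qed
qed

text \<open>A proper nonempty part B of a linked set shares an edge with some triangle outside it,
  so S can be exhausted from any starting index by adding one triangle at a time.\<close>

lemma linked_induct:
  assumes S: "finite S" "linked T S" "i0 \<in> S"
    and base: "P {i0}"
    and step: "\<And>B i. B \<subseteq> S \<Longrightarrow> i0 \<in> B \<Longrightarrow> i \<in> S - B \<Longrightarrow> edges T B \<inter> nsets (T i) 2 \<noteq> {} \<Longrightarrow> P B \<Longrightarrow> P (insert i B)"
  shows "P S"
proof -
  have "\<exists>B\<subseteq>S. card B = Suc j \<and> i0 \<in> B \<and> P B" if "Suc j \<le> card S" for j
    using that
  proof (induction j)
    case 0
    show ?case using base S(3) by (intro exI[of _ "{i0}"]) auto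
  next
    case (Suc j)
    then obtain B where B: "B \<subseteq> S" "card B = Suc j" "i0 \<in> B" "P B" by auto
    then have "B \<noteq> S" "B \<noteq> {}" using Suc.prems by auto
    then have "edges T B \<inter> edges T (S - B) \<noteq> {}" using S(2) B(1) by (auto simp: linked_def)
    then obtain i where i: "i \<in> S - B" "edges T B \<inter> nsets (T i) 2 \<noteq> {}"
      by (auto simp: edges_def)
    have "card (insert i B) = Suc (Suc j)"
      using B i S(1) finite_subset by (subst card_insert_disjoint) auto
    then show ?case using step[OF B(1,3) i B(4)] B i by (intro exI[of _ "insert i B"]) auto
  qed
  from this[of "card S - 1"] obtain B where "B \<subseteq> S" "card B = card S" "P B"
    using S card_gt_0_iff[of S] by auto
  then show ?thesis using card_subset_eq[OF S(1)] by auto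
qed

lemma edge_subset_verts: "e \<in> edges T B \<Longrightarrow> e \<subseteq> (\<Union>i\<in>B. T i)"
  by (auto simp: edges_def nsets_def)

text \<open>Here {x, y} is the shared edge, so z is the only vertex that the triangle can add to
  those already present.\<close>

lemma shared_edge_cases:
  assumes "edges T B \<inter> nsets (T i) 2 \<noteq> {}" "card (T i) = 3"
  obtains x y z where "T i = {x, y, z}" "x \<noteq> y" "y \<noteq> z" "x \<noteq> z"
    "x \<in> (\<Union>i\<in>B. T i)" "y \<in> (\<Union>i\<in>B. T i)"
proof -
  obtain e where e: "e \<in> edges T B" "e \<in> nsets (T i) 2" using assms(1) by blast
  from e(2) obtain x y where xy: "e = {x, y}" "x \<noteq> y" "x \<in> T i" "y \<in> T i" by (rule nsets2_E)
  have "card (T i - e) = 1" using assms(2) xy by (simp add: card_Diff_subset)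
  then obtain z where z: "T i - e = {z}" by (auto simp: card_1_singleton_iff)
  then have "T i = {x, y, z}" "z \<noteq> x" "z \<noteq> y" using xy by auto
  then show thesis using that[of x y z] edge_subset_verts[OF e(1)] xy by auto
qed

text \<open>A single triangle has v = e = 3 and gives equality in both bounds. Adding a linked
  triangle either creates no vertex, or creates just z; in that case {x, z} and {y, z} are both new
  edges, so 2v grows by 2 and e by at least 2.\<close>

lemma linked_card:
  assumes S: "finite S" "linked T S" "S \<noteq> {}" and T: "\<And>i. i \<in> S \<Longrightarrow> card (T i) = 3"
  shows "2 * card (\<Union>i\<in>S. T i) \<le> card (edges T S) + 3 \<and> card (\<Union>i\<in>S. T i) \<le> card S + 2"
proof -
  have fT: "finite (T i)" if "i \<in> S" for i using T[OF that] card.infinite by fastforce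
  obtain i0 where i0: "i0 \<in> S" using S by auto
  show ?thesis
  proof (rule linked_induct[where P = "\<lambda>B. 2 * card (\<Union>i\<in>B. T i) \<le> card (edges T B) + 3 \<and>
      card (\<Union>i\<in>B. T i) \<le> card B + 2", OF S(1,2) i0])
    show "2 * card (\<Union>i\<in>{i0}. T i) \<le> card (edges T {i0}) + 3 \<and> card (\<Union>i\<in>{i0}. T i) \<le> card {i0} + 2"
    proof -
      have "card (nsets (T i0) 2) = 3"
        using T[OF i0] by (simp add: choose_two)
      then show ?thesis using T[OF i0] by (simp add: edges_def)
    qed
  next
    fix B i
    assume B: "B \<subseteq> S" "i0 \<in> B" "i \<in> S - B" "edges T B \<inter> nsets (T i) 2 \<noteq> {}"
      and IH: "2 * card (\<Union>i\<in>B. T i) \<le> card (edges T B) + 3 \<and> card (\<Union>i\<in>B. T i) \<le> card B + 2"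
    have fB: "finite B" using B S finite_subset by auto
    have fV: "finite (\<Union>i\<in>B. T i)" using fB fT B by auto
    have fE: "finite (edges T (insert i B))" using fB fT B by (intro finite_edges) auto
    obtain x y z where xyz: "T i = {x, y, z}" "x \<noteq> y" "y \<noteq> z" "x \<noteq> z"
      "x \<in> (\<Union>i\<in>B. T i)" "y \<in> (\<Union>i\<in>B. T i)"
      using B T by (elim shared_edge_cases[where i = i]) auto
    have V: "(\<Union>i\<in>insert i B. T i) = insert z (\<Union>i\<in>B. T i)" using xyz by auto
    have E: "edges T B \<subseteq> edges T (insert i B)" by (auto simp: edges_def)
    have cB: "card (insert i B) = Suc (card B)" using fB B by auto
    show "2 * card (\<Union>i\<in>insert i B. T i) \<le> card (edges T (insert i B)) + 3 \<and>
      card (\<Union>i\<in>insert i B. T i) \<le> card (insert i B) + 2"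
    proof (cases "z \<in> (\<Union>i\<in>B. T i)")
      case True
      then have "(\<Union>i\<in>insert i B. T i) = (\<Union>i\<in>B. T i)" using V by auto
      then show ?thesis using IH cB card_mono[OF fE E] by simp
    next
      case False
      have "{x, z} \<notin> edges T B" "{y, z} \<notin> edges T B"
        using False edge_subset_verts[of _ T B] by auto
      then have "card (insert {x, z} (insert {y, z} (edges T B))) = card (edges T B) + 2"
        using xyz finite_subset[OF E fE] by (auto simp: doubleton_eq_iff)
      moreover have "insert {x, z} (insert {y, z} (edges T B)) \<subseteq> edges T (insert i B)"
        using E xyz by (auto simp: edges_def)
      ultimately have "card (edges T B) + 2 \<le> card (edges T (insert i B))"
        using card_mono[OF fE] by metis
      then show ?thesis using IH cB V False fV by simp
    qed
  qed
qed

text \<open>A derivation encodes a rooted spanning tree: each new vertex x is attached by an edge of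
  E to an earlier vertex a. Reading it backwards allows the vertices to be integrated out one by
  one.\<close>

inductive grown :: "'v set set \<Rightarrow> 'v \<Rightarrow> 'v set \<Rightarrow> bool" for E r where
  base: "grown E r {r}"
| step: "grown E r W \<Longrightarrow> a \<in> W \<Longrightarrow> x \<notin> W \<Longrightarrow> {a, x} \<in> E \<Longrightarrow> grown E r (insert x W)"

text \<open>The root is free because \<open>linked_induct\<close> may start from a triangle that
  contains it; later it is the vertex 0.\<close>

lemma linked_grown:
  assumes S: "finite S" "linked T S" and T: "\<And>i. i \<in> S \<Longrightarrow> card (T i) = 3"
    and r: "r \<in> (\<Union>i\<in>S. T i)"
  shows "grown (edges T S) r (\<Union>i\<in>S. T i)"
proof -
  obtain i0 where i0: "i0 \<in> S" "r \<in> T i0" using r by auto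
  show ?thesis
  proof (rule linked_induct[where P = "\<lambda>B. grown (edges T S) r (\<Union>i\<in>B. T i)", OF S(1,2) i0(1)])
    obtain y z where yz: "T i0 = {r, y, z}" "r \<noteq> y" "y \<noteq> z" "r \<noteq> z"
    proof -
      obtain a b c where abc: "T i0 = {a, b, c}" "a \<noteq> b" "b \<noteq> c" "a \<noteq> c"
        using T[OF i0(1)] by (auto simp: card_3_iff)
      then consider "r = a" | "r = b" | "r = c" using i0(2) by auto
      then show thesis using that[of b c] that[of a c] that[of a b] abc by cases auto
    qed
    then have e: "{r, y} \<in> edges T S" "{r, z} \<in> edges T S" using i0(1) by (auto simp: edges_def intro!: bexI[of _ i0])
    have "grown (edges T S) r (insert y {r})"
      by (rule grown.step[OF grown.base _ _ e(1)]) (use yz in auto)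
    then have "grown (edges T S) r (insert z (insert y {r}))"
      by (rule grown.step[OF _ _ _ e(2)]) (use yz in auto)
    moreover have "insert z (insert y {r}) = (\<Union>i\<in>{i0}. T i)" using yz by auto
    ultimately show "grown (edges T S) r (\<Union>i\<in>{i0}. T i)" by simp
  next
    fix B i
    assume B: "B \<subseteq> S" "i0 \<in> B" "i \<in> S - B" "edges T B \<inter> nsets (T i) 2 \<noteq> {}"
      and IH: "grown (edges T S) r (\<Union>i\<in>B. T i)"
    obtain x y z where xyz: "T i = {x, y, z}" "x \<noteq> y" "y \<noteq> z" "x \<noteq> z"
      "x \<in> (\<Union>i\<in>B. T i)" "y \<in> (\<Union>i\<in>B. T i)"
      using B T by (elim shared_edge_cases[where i = i]) auto
    have V: "(\<Union>i\<in>insert i B. T i) = insert z (\<Union>i\<in>B. T i)" using xyz by auto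
    have e: "{x, z} \<in> edges T S" using xyz B by (auto simp: edges_def intro!: bexI[of _ i])
    then show "grown (edges T S) r (\<Union>i\<in>insert i B. T i)"
    proof (cases "z \<in> (\<Union>i\<in>B. T i)")
      case True
      then show ?thesis unfolding V using IH by (simp only: insert_absorb)
    next
      case False
      show ?thesis unfolding V by (rule grown.step[OF IH xyz(5) False e])
    qed
  qed
qed

subsection \<open>Patterns\<close>

lemma nsets_image:
  assumes "inj_on g t"
  shows "nsets (g ` t) m = (`) g ` nsets t m"
proof -
  have "bij_betw g t (g ` t)" using assms by (simp add: bij_betw_def)
  from bij_betw_nsets[OF this, of m] show ?thesis by (simp add: bij_betw_def)
qed

lemma edges_image:
  assumes "inj_on g V" "\<And>i. i \<in> B \<Longrightarrow> \<tau> i \<subseteq> V" "B \<subseteq> S"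
  shows "edges (\<lambda>i\<in>S. g ` \<tau> i) B = (`) g ` edges \<tau> B"
proof -
  have "nsets (g ` \<tau> i) 2 = (`) g ` nsets (\<tau> i) 2" if "i \<in> B" for i
    using assms that by (intro nsets_image) (metis inj_on_subset)
  then show ?thesis using assms(3) by (auto simp: edges_def image_UN subset_iff)
qed

lemma linked_image:
  assumes "inj_on g V" "\<And>i. i \<in> S \<Longrightarrow> \<tau> i \<subseteq> V"
  shows "linked (\<lambda>i\<in>S. g ` \<tau> i) S \<longleftrightarrow> linked \<tau> S"
proof -
  have inj: "inj_on ((`) g) (Pow V)"
    using assms(1) by (auto simp: inj_on_def inj_on_image_eq_iff[OF assms(1)])
  have sub: "edges \<tau> B \<subseteq> Pow V" if "B \<subseteq> S" for B
    using assms(2) that by (auto simp: edges_def nsets_def subset_iff)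
  have "edges (\<lambda>i\<in>S. g ` \<tau> i) B \<inter> edges (\<lambda>i\<in>S. g ` \<tau> i) (S - B) =
      (`) g ` (edges \<tau> B \<inter> edges \<tau> (S - B))" if "B \<subseteq> S" for B
    using that assms
    by (subst (1 2) edges_image[OF assms(1)]) (auto simp: inj_on_image_Int[OF inj sub sub])
  then show ?thesis by (auto simp: linked_def)
qed

text \<open>Patterns are labelled: the vertex labels are 0, ..., v - 1, all of them occur, and
  relabelled copies are not identified. The overcounting is a uniform factor v!, removed where the
  sum over tuples is rearranged.\<close>

definition patterns :: "nat \<Rightarrow> nat \<Rightarrow> (nat \<Rightarrow> nat set) set" where
  "patterns k v = {\<tau> \<in> {..<k} \<rightarrow>\<^sub>E nsets {..<v} 3. linked \<tau> {..<k} \<and> (\<Union>i<k. \<tau> i) = {..<v}}"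

definition inj_maps :: "nat \<Rightarrow> 'v set \<Rightarrow> (nat \<Rightarrow> 'v) set" where
  "inj_maps v A = {g \<in> {..<v} \<rightarrow>\<^sub>E A. inj_on g {..<v}}"

lemma finite_patterns: "finite (patterns k v)"
proof -
  have "finite ({..<k} \<rightarrow>\<^sub>E nsets {..<v} 3)"
    by (intro finite_PiE finite_imp_finite_nsets) auto
  then show ?thesis by (simp add: patterns_def)
qed

lemma finite_inj_maps: "finite A \<Longrightarrow> finite (inj_maps v A)"
  by (auto simp: inj_maps_def intro!: finite_PiE)

lemma card_inj_maps:
  assumes "finite W" "card W = v"
  shows "card (inj_maps v W) = fact v"
proof -
  have "card (inj_maps v W) = prod ((-) v) {0..<v}"
    using card_inj_on_subset_funcset[of "{..<v}" W "{..<v}"] assms by (simp add: inj_maps_def)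
  also have "\<dots> = fact v" by (simp add: fact_prod_rev)
  finally show ?thesis .
qed

text \<open>Each T with v vertices arises from exactly v! pairs of a pattern and an injection: the
  injection must enumerate the vertex set of T, and it then determines the pattern. The range of v
  is bounded by \<open>linked_card\<close>.\<close>

lemma sum_linked_patterns:
  fixes F :: "(nat \<Rightarrow> 'v set) \<Rightarrow> real"
  assumes A: "finite A" and k: "k \<ge> 1"
  shows "(\<Sum>T\<in>{T\<in>{..<k} \<rightarrow>\<^sub>E nsets A 3. linked T {..<k}}. F T) =
    (\<Sum>v\<le>k+2. 1 / fact v * (\<Sum>\<tau>\<in>patterns k v. \<Sum>g\<in>inj_maps v A. F (\<lambda>i\<in>{..<k}. g ` \<tau> i)))"
proof -
  let ?L = "{T\<in>{..<k} \<rightarrow>\<^sub>E nsets A 3. linked T {..<k}}"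
  let ?\<Phi> = "\<lambda>(\<tau>, g). \<lambda>i\<in>{..<k}. g ` \<tau> i :: 'v set"
  have finL: "finite ?L"
    using A by (intro finite_Collect_conjI disjI1) (auto intro!: finite_PiE finite_imp_finite_nsets)
  have "(\<Sum>T\<in>?L. F T) = (\<Sum>v\<le>k+2. \<Sum>T\<in>{T\<in>?L. card (\<Union>i<k. T i) = v}. F T)"
  proof (rule sum.group[symmetric, OF finL])
    have "card (\<Union>i<k. T i) \<le> k + 2" if "T \<in> ?L" for T
      using linked_card[of "{..<k}" T] that k by (auto simp: PiE_iff nsets_def lessThan_empty_iff)
    then show "(\<lambda>T. card (\<Union>i<k. T i)) ` ?L \<subseteq> {..k+2}" by auto
  qed auto
  also have "\<dots> = (\<Sum>v\<le>k+2. 1 / fact v * (\<Sum>\<tau>\<in>patterns k v. \<Sum>g\<in>inj_maps v A. F (\<lambda>i\<in>{..<k}. g ` \<tau> i)))"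
  proof (rule sum.cong)
    fix v
    let ?Lv = "{T\<in>?L. card (\<Union>i<k. T i) = v}"
    let ?P = "patterns k v \<times> inj_maps v A"
    have \<Phi>_union: "(\<Union>i<k. ?\<Phi> (\<tau>, g) i) = g ` {..<v}" if "\<tau> \<in> patterns k v" for \<tau> g
    proof -
      have "(\<Union>i<k. ?\<Phi> (\<tau>, g) i) = g ` (\<Union>i<k. \<tau> i)" by auto
      then show ?thesis using that by (simp add: patterns_def)
    qed
    have \<tau>_sub: "\<tau> i \<subseteq> {..<v}" if "\<tau> \<in> patterns k v" "i \<in> {..<k}" for \<tau> i
      using that by (auto simp: patterns_def)
    have range: "?\<Phi> ` ?P \<subseteq> ?Lv"
    proof (rule image_subsetI)
      fix z assume "z \<in> ?P"
      then obtain \<tau> g where z: "z = (\<tau>, g)" and \<tau>: "\<tau> \<in> patterns k v" and g: "g \<in> inj_maps v A" by auto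
      have inj: "inj_on g {..<v}" and gA: "g ` {..<v} \<subseteq> A" using g by (auto simp: inj_maps_def)
      have "?\<Phi> (\<tau>, g) \<in> {..<k} \<rightarrow>\<^sub>E nsets A 3"
      proof (clarsimp simp: PiE_iff)
        fix i assume i: "i < k"
        have "\<tau> i \<in> nsets {..<v} 3" using \<tau> i by (auto simp: patterns_def)
        moreover have "card (g ` \<tau> i) = card (\<tau> i)"
          using \<tau>_sub[OF \<tau>, of i] i inj by (intro card_image) (auto intro: inj_on_subset)
        ultimately show "g ` \<tau> i \<in> nsets A 3" using gA by (auto simp: nsets_def)
      qed
      moreover have "linked (?\<Phi> (\<tau>, g)) {..<k}"
        using linked_image[where S = "{..<k}" and \<tau> = \<tau>, OF inj \<tau>_sub[OF \<tau>]] \<tau> by (simp add: patterns_def)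
      moreover have "card (\<Union>i<k. ?\<Phi> (\<tau>, g) i) = v"
        unfolding \<Phi>_union[OF \<tau>] using card_image[OF inj] by simp
      ultimately show "?\<Phi> z \<in> ?Lv" unfolding z by blast
    qed
    have fiber: "card {z\<in>?P. ?\<Phi> z = T} = fact v" if T: "T \<in> ?Lv" for T
    proof -
      let ?W = "\<Union>i<k. T i"
      have TA: "T i \<in> nsets A 3" if "i < k" for i using T that by auto
      have finW: "finite ?W" using TA by (auto simp: nsets_def)
      have WA: "?W \<subseteq> A" using TA by (auto simp: nsets_def)
      have cW: "card ?W = v" using T by auto
      have "bij_betw snd {z\<in>?P. ?\<Phi> z = T} (inj_maps v ?W)"
      \<comment> \<open>Given g, the pattern is recovered by taking preimages of the triangles of
        T.\<close>
      proof (rule bij_betw_byWitness[where f' = "\<lambda>g. (\<lambda>i\<in>{..<k}. {a\<in>{..<v}. g a \<in> T i}, g)"])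
        show "\<forall>z\<in>{z\<in>?P. ?\<Phi> z = T}. (\<lambda>i\<in>{..<k}. {a\<in>{..<v}. snd z a \<in> T i}, snd z) = z"
        proof
          fix z assume "z \<in> {z\<in>?P. ?\<Phi> z = T}"
          then obtain \<tau> g where z: "z = (\<tau>, g)" and \<tau>: "\<tau> \<in> patterns k v" and g: "g \<in> inj_maps v A"
            and eq: "?\<Phi> (\<tau>, g) = T" by auto
          have inj: "inj_on g {..<v}" using g by (auto simp: inj_maps_def)
          have "(\<lambda>i\<in>{..<k}. {a\<in>{..<v}. g a \<in> T i}) = \<tau>"
          proof
            fix i
            show "(\<lambda>i\<in>{..<k}. {a\<in>{..<v}. g a \<in> T i}) i = \<tau> i"
            proof (cases "i < k")
              case True
              have Ti: "T i = g ` \<tau> i" using eq True by auto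
              have "{a\<in>{..<v}. g a \<in> T i} = \<tau> i"
                unfolding Ti using True \<tau>_sub[OF \<tau>, of i] inj by (auto simp: inj_on_def)
              then show ?thesis using True by simp
            next
              case False
              then show ?thesis using \<tau> by (auto simp: patterns_def PiE_iff extensional_def)
            qed
          qed
          then show "(\<lambda>i\<in>{..<k}. {a\<in>{..<v}. snd z a \<in> T i}, snd z) = z" by (simp add: z)
        qed
        show "\<forall>g\<in>inj_maps v ?W. snd ((\<lambda>i\<in>{..<k}. {a\<in>{..<v}. g a \<in> T i}), g) = g" by simp
        show "snd ` {z\<in>?P. ?\<Phi> z = T} \<subseteq> inj_maps v ?W"
        proof (rule image_subsetI)
          fix z assume "z \<in> {z\<in>?P. ?\<Phi> z = T}"
          then obtain \<tau> g where z: "z = (\<tau>, g)" and \<tau>: "\<tau> \<in> patterns k v" and g: "g \<in> inj_maps v A"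
            and eq: "?\<Phi> (\<tau>, g) = T" by auto
          have "g ` {..<v} = ?W" using \<Phi>_union[OF \<tau>, of g, unfolded eq] by (rule sym)
          then show "snd z \<in> inj_maps v ?W" using g by (auto simp: inj_maps_def z PiE_iff)
        qed
        show "(\<lambda>g. (\<lambda>i\<in>{..<k}. {a\<in>{..<v}. g a \<in> T i}, g)) ` inj_maps v ?W \<subseteq> {z\<in>?P. ?\<Phi> z = T}"
        proof (rule image_subsetI)
          fix g assume g: "g \<in> inj_maps v ?W"
          let ?\<tau> = "\<lambda>i\<in>{..<k}. {a\<in>{..<v}. g a \<in> T i}"
          have inj: "inj_on g {..<v}" and gW: "g ` {..<v} \<subseteq> ?W" using g by (auto simp: inj_maps_def)
          have surj: "g ` {..<v} = ?W"
            using gW finW cW card_image[OF inj] by (intro card_subset_eq) auto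
          have im: "g ` ?\<tau> i = T i" if "i < k" for i
          proof -
            have "T i \<subseteq> g ` {..<v}" unfolding surj using that by auto
            then show ?thesis using that by auto
          qed
          have \<Phi>: "?\<Phi> (?\<tau>, g) = T"
          proof
            fix i
            show "?\<Phi> (?\<tau>, g) i = T i"
              using im[of i] T by (cases "i < k") (auto simp: PiE_iff extensional_def)
          qed
          have sub: "?\<tau> i \<subseteq> {..<v}" if "i \<in> {..<k}" for i using that by auto
          have "?\<tau> \<in> patterns k v"
            unfolding patterns_def
          proof (intro CollectI conjI)
            show "?\<tau> \<in> {..<k} \<rightarrow>\<^sub>E nsets {..<v} 3"
            proof (clarsimp simp: PiE_iff)
              fix i assume i: "i < k"
              have "card (g ` ?\<tau> i) = card (?\<tau> i)"
                using sub[of i] i inj by (intro card_image) (auto intro: inj_on_subset)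
              then have "card (?\<tau> i) = 3" using im[OF i] TA[OF i] by (simp add: nsets_def)
              then show "{a. a < v \<and> g a \<in> T i} \<in> nsets {..<v} 3" using i by (auto simp: nsets_def)
            qed
            show "linked ?\<tau> {..<k}"
            proof -
              have "linked (?\<Phi> (?\<tau>, g)) {..<k}" unfolding \<Phi> using T by auto
              then show ?thesis using linked_image[where S = "{..<k}" and \<tau> = ?\<tau>, OF inj sub] by simp
            qed
            show "(\<Union>i<k. ?\<tau> i) = {..<v}"
            proof
              show "{..<v} \<subseteq> (\<Union>i<k. ?\<tau> i)" using gW by (auto 4 4)
            qed auto
          qed
          moreover have "g \<in> inj_maps v A" using g WA by (auto simp: inj_maps_def PiE_iff)
          ultimately show "(?\<tau>, g) \<in> {z\<in>?P. ?\<Phi> z = T}" using \<Phi> by blast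
        qed
      qed
      then show ?thesis using card_inj_maps[OF finW cW] bij_betw_same_card by fastforce
    qed
    have "(\<Sum>\<tau>\<in>patterns k v. \<Sum>g\<in>inj_maps v A. F (\<lambda>i\<in>{..<k}. g ` \<tau> i)) = (\<Sum>z\<in>?P. F (?\<Phi> z))"
      by (simp add: sum.cartesian_product case_prod_unfold)
    also have "\<dots> = (\<Sum>T\<in>?Lv. \<Sum>z\<in>{z\<in>?P. ?\<Phi> z = T}. F (?\<Phi> z))"
    proof (rule sum.group[symmetric, OF _ _ range])
      show "finite ?P" using finite_patterns finite_inj_maps[OF A] by (rule finite_cartesian_product)
      show "finite ?Lv" using finL by (rule finite_subset[rotated]) blast
    qed
    also have "\<dots> = (\<Sum>T\<in>?Lv. fact v * F T)"
    proof (rule sum.cong)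
      fix T assume T: "T \<in> ?Lv"
      have "(\<Sum>z\<in>{z\<in>?P. ?\<Phi> z = T}. F (?\<Phi> z)) = (\<Sum>z\<in>{z\<in>?P. ?\<Phi> z = T}. F T)"
        by (intro sum.cong) auto
      then show "(\<Sum>z\<in>{z\<in>?P. ?\<Phi> z = T}. F (?\<Phi> z)) = fact v * F T"
        using fiber[OF T] by simp
    qed simp
    finally show "(\<Sum>T\<in>?Lv. F T) =
      1 / fact v * (\<Sum>\<tau>\<in>patterns k v. \<Sum>g\<in>inj_maps v A. F (\<lambda>i\<in>{..<k}. g ` \<tau> i))"
      by (simp flip: sum_distrib_left)
  qed simp
  finally show ?thesis .
qed

definition mult_edge :: "(nat \<Rightarrow> 'v set) \<Rightarrow> nat \<Rightarrow> 'v set \<Rightarrow> nat" where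
  "mult_edge \<tau> k e = card {i\<in>{..<k}. e \<in> nsets (\<tau> i) 2}"

lemma gap_image: "gap id (g ` e) = gap g e"
  by (simp add: gap_def)

text \<open>Exchanging the product over triangles with the product over edges collects the weight of
  an edge to the power \<open>mult_edge\<close>. The exponential of that edge occurs once, and the
  two together form \<open>h_fun\<close> of index \<open>mult_edge\<close>.\<close>

lemma joint_moment_pattern:
  assumes \<tau>: "\<tau> \<in> patterns k v" and g: "g \<in> inj_maps v (idx n)"
  shows "joint_moment \<psi> \<alpha> n c R (\<lambda>i\<in>{..<k}. g ` \<tau> i) {..<k} =
    6 ^ k * (c / size_of n) ^ card (edges \<tau> {..<k}) *
    (\<Prod>e\<in>edges \<tau> {..<k}. h_fun \<psi> \<alpha> (mult_edge \<tau> k e) (real_of_int (gap g e) / R))"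
proof -
  let ?E = "edges \<tau> {..<k}"
  have inj: "inj_on g {..<v}" using g by (simp add: inj_maps_def)
  have sub: "\<tau> i \<subseteq> {..<v}" if "i \<in> {..<k}" for i using \<tau> that by (auto simp: patterns_def)
  have inj': "inj_on ((`) g) (Pow {..<v})"
    by (auto simp: inj_on_def inj_on_image_eq_iff[OF inj])
  have finE: "finite ?E"
    by (intro finite_edges) (auto intro!: finite_subset[OF sub])
  have inj_E: "inj_on ((`) g) ?E"
    by (rule inj_on_subset[OF inj']) (use sub in \<open>auto simp: edges_def nsets_def\<close>)
  let ?w = "\<lambda>e. wt \<psi> \<alpha> (real_of_int (gap g e) / R)"
  have "(\<Prod>i\<in>{..<k}. 6 * (\<Prod>e\<in>nsets ((\<lambda>i\<in>{..<k}. g ` \<tau> i) i) 2. wt \<psi> \<alpha> (real_of_int (gap id e) / R)))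
      = (\<Prod>i\<in>{..<k}. 6 * (\<Prod>e\<in>nsets (\<tau> i) 2. ?w e))"
  proof (rule prod.cong)
    fix i assume i: "i \<in> {..<k}"
    have ii: "inj_on g (\<tau> i)" using inj sub[OF i] by (rule inj_on_subset)
    have "inj_on ((`) g) (nsets (\<tau> i) 2)"
      by (rule inj_on_subset[OF inj']) (use sub[OF i] in \<open>auto simp: nsets_def\<close>)
    then show "6 * (\<Prod>e\<in>nsets ((\<lambda>i\<in>{..<k}. g ` \<tau> i) i) 2. wt \<psi> \<alpha> (real_of_int (gap id e) / R))
      = 6 * (\<Prod>e\<in>nsets (\<tau> i) 2. ?w e)"
      using i by (simp add: nsets_image[OF ii] prod.reindex gap_image)
  qed simp
  also have "\<dots> = 6 ^ k * (\<Prod>i\<in>{..<k}. \<Prod>e\<in>?E. if e \<in> nsets (\<tau> i) 2 then ?w e else 1)"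
  proof -
    have "(\<Prod>e\<in>nsets (\<tau> i) 2. ?w e) = (\<Prod>e\<in>?E. if e \<in> nsets (\<tau> i) 2 then ?w e else 1)" if "i \<in> {..<k}" for i
    proof -
      have "nsets (\<tau> i) 2 = {e\<in>?E. e \<in> nsets (\<tau> i) 2}" using that by (auto simp: edges_def)
      then show ?thesis using finE by (simp add: prod.inter_filter[symmetric])
    qed
    then show ?thesis by (simp add: prod.distrib)
  qed
  also have "(\<Prod>i\<in>{..<k}. \<Prod>e\<in>?E. if e \<in> nsets (\<tau> i) 2 then ?w e else 1) =
      (\<Prod>e\<in>?E. \<Prod>i\<in>{..<k}. if e \<in> nsets (\<tau> i) 2 then ?w e else 1)"
    by (rule prod.swap)
  also have "\<dots> = (\<Prod>e\<in>?E. ?w e ^ mult_edge \<tau> k e)"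
    by (intro prod.cong refl) (simp add: prod.inter_filter[symmetric] mult_edge_def)
  finally have W: "(\<Prod>i\<in>{..<k}. 6 * (\<Prod>e\<in>nsets ((\<lambda>i\<in>{..<k}. g ` \<tau> i) i) 2. wt \<psi> \<alpha> (real_of_int (gap id e) / R)))
      = 6 ^ k * (\<Prod>e\<in>?E. ?w e ^ mult_edge \<tau> k e)" .
  have "(\<Prod>e\<in>edges (\<lambda>i\<in>{..<k}. g ` \<tau> i) {..<k}. eprob \<psi> n c R e) = (\<Prod>e\<in>?E. eprob \<psi> n c R (g ` e))"
    by (subst edges_image[OF inj sub]) (simp_all add: prod.reindex[OF inj_E])
  also have "\<dots> = (\<Prod>e\<in>?E. c / size_of n * exp (- (\<psi> (real_of_int (gap g e) / R))\<^sup>2))"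
    by (simp add: eprob_def gap_image)
  also have "\<dots> = (c / size_of n) ^ card ?E * (\<Prod>e\<in>?E. exp (- (\<psi> (real_of_int (gap g e) / R))\<^sup>2))"
    by (simp only: prod.distrib prod_constant)
  finally have P: "(\<Prod>e\<in>edges (\<lambda>i\<in>{..<k}. g ` \<tau> i) {..<k}. eprob \<psi> n c R e) =
    (c / size_of n) ^ card ?E * (\<Prod>e\<in>?E. exp (- (\<psi> (real_of_int (gap g e) / R))\<^sup>2))" .
  show ?thesis
    unfolding joint_moment_def W P[unfolded edges_def]
    by (simp add: h_fun_def wt_def prod.distrib edges_def)
qed

subsection \<open>Fourier inversion at the origin\<close>

definition fourier :: "(real \<Rightarrow> real) \<Rightarrow> real \<Rightarrow> complex" where
  "fourier f p = (LINT x|lborel. complex_of_real (f x) * exp (- (\<i> * complex_of_real p * complex_of_real x)))"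

definition convol :: "(real \<Rightarrow> real) \<Rightarrow> (real \<Rightarrow> real) \<Rightarrow> real \<Rightarrow> real" where
  "convol f g x = (LINT y|lborel. f y * g (x - y))"

lemma norm_iexp [simp]: "norm (exp (- (\<i> * complex_of_real p * complex_of_real x))) = 1"
  by (simp add: norm_exp_eq_Re)

lemma integrable_fourier_kernel:
  assumes "integrable lborel f"
  shows "integrable lborel (\<lambda>x. complex_of_real (f x) * exp (- (\<i> * complex_of_real p * complex_of_real x)))"
proof (rule Bochner_Integration.integrable_bound[OF assms])
  have [measurable]: "f \<in> borel_measurable borel" using assms by auto
  show "(\<lambda>x. complex_of_real (f x) * exp (- (\<i> * complex_of_real p * complex_of_real x))) \<in> borel_measurable lborel"
    by measurable
qed (simp add: norm_mult)

lemma norm_fourier_le: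
  assumes "integrable lborel f" "\<And>x. 0 \<le> f x"
  shows "norm (fourier f p) \<le> integral\<^sup>L lborel f"
proof -
  have "norm (fourier f p) \<le> (LINT x|lborel. norm (complex_of_real (f x) * exp (- (\<i> * complex_of_real p * complex_of_real x))))"
    unfolding fourier_def by (rule integral_norm_bound)
  also have "\<dots> = integral\<^sup>L lborel f" using assms(2) by (simp add: norm_mult)
  finally show ?thesis .
qed

lemma fourier_measurable [measurable]:
  assumes [measurable]: "f \<in> borel_measurable borel"
  shows "fourier f \<in> borel_measurable borel"
  unfolding fourier_def by measurable

lemma fourier_real:
  assumes f: "integrable lborel f" and even: "\<And>x. f (- x) = f x"
  shows "fourier f p = complex_of_real (Re (fourier f p))"
proof -
  have "cnj (fourier f p) = (LINT x|lborel. cnj (complex_of_real (f x) * exp (- (\<i> * complex_of_real p * complex_of_real x))))"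
    unfolding fourier_def by (rule Bochner_Integration.integral_cnj[symmetric])
  also have "\<dots> = (LINT x|lborel. complex_of_real (f (- x)) * exp (- (\<i> * complex_of_real p * complex_of_real (- x))))"
    by (simp add: even exp_cnj)
  also have "\<dots> = fourier f p"
    unfolding fourier_def
    using lborel_integral_real_affine[of "-1" "\<lambda>x. complex_of_real (f x) * exp (- (\<i> * complex_of_real p * complex_of_real x))" 0]
    by simp
  finally have "Im (cnj (fourier f p)) = Im (fourier f p)" by simp
  then show ?thesis by (simp add: complex_eq_iff)
qed

lemma convol_integrable_pair:
  fixes f g :: "real \<Rightarrow> real"
  assumes f: "integrable lborel f" and g: "integrable lborel g"
  shows "integrable (lborel \<Otimes>\<^sub>M lborel) (\<lambda>(x, y). f y * g (x - y) :: real)"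
proof -
  have [measurable]: "f \<in> borel_measurable borel" "g \<in> borel_measurable borel" using f g by auto
  have "integrable (lborel \<Otimes>\<^sub>M lborel) (\<lambda>(y, x). f y * g (x - y))"
  proof (rule lborel_pair.Fubini_integrable)
    show "(\<lambda>(y, x). f y * g (x - y)) \<in> borel_measurable (lborel \<Otimes>\<^sub>M lborel)" by measurable
    have "(LINT x|lborel. norm (f y * g (x - y))) = norm (f y) * (LINT x|lborel. norm (g x))" for y
    proof -
      have "(LINT x|lborel. norm (f y * g (x - y))) = norm (f y) * (LINT x|lborel. norm (g (x - y)))"
        by (simp add: abs_mult)
      also have "(LINT x|lborel. norm (g (x - y))) = (LINT x|lborel. norm (g x))"
        using lborel_integral_real_affine[of 1 "\<lambda>x. norm (g x)" "- y"] by simp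
      finally show ?thesis .
    qed
    then show "integrable lborel (\<lambda>y. LINT x|lborel. norm (case (y, x) of (y, x) \<Rightarrow> f y * g (x - y)))"
      using f by simp
    have "integrable lborel (\<lambda>x. g (x - y))" for y
      using lborel_integrable_real_affine[OF g, of 1 "- y"] by simp
    then show "AE y in lborel. integrable lborel (\<lambda>x. case (y, x) of (y, x) \<Rightarrow> f y * g (x - y))"
      by simp
  qed
  then show ?thesis
    using lborel_pair.integrable_product_swap[of "\<lambda>(y, x). f y * g (x - y)"] by (simp add: case_prod_unfold)
qed

lemma convol_integrable:
  assumes f: "integrable lborel f" and g: "integrable lborel g"
  shows "integrable lborel (convol f g)"
  using lborel_pair.integrable_fst'[OF convol_integrable_pair[OF f g]]
  by (simp add: convol_def[abs_def])

lemma fourier_convol: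
  assumes f: "integrable lborel f" and g: "integrable lborel g"
  shows "fourier (convol f g) p = fourier f p * fourier g p"
proof -
  define e where "e x = exp (- (\<i> * complex_of_real p * complex_of_real x))" for x
  have [measurable]: "f \<in> borel_measurable borel" "g \<in> borel_measurable borel"
    using f g by auto
  have [measurable]: "e \<in> borel_measurable borel" unfolding e_def by measurable
  have e_norm: "norm (e x) = 1" for x by (simp add: e_def)
  have e_add: "e x = e y * e (x - y)" for x y
    by (simp add: e_def algebra_simps flip: exp_add)
  have int: "integrable (lborel \<Otimes>\<^sub>M lborel) (\<lambda>(x, y). complex_of_real (f y * g (x - y)) * e x)"
    by (rule Bochner_Integration.integrable_bound[OF convol_integrable_pair[OF f g]])
      (auto simp: norm_mult e_norm case_prod_unfold)
  have "fourier (convol f g) p = (LINT x|lborel. LINT y|lborel. complex_of_real (f y * g (x - y)) * e x)"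
    unfolding fourier_def convol_def e_def[symmetric]
    by (simp flip: integral_complex_of_real)
  also have "\<dots> = (LINT y|lborel. LINT x|lborel. complex_of_real (f y * g (x - y)) * e x)"
    using lborel_pair.Fubini_integral[OF int] by simp
  also have "\<dots> = (LINT y|lborel. (complex_of_real (f y) * e y) * fourier g p)"
  proof (rule Bochner_Integration.integral_cong)
    fix y
    have "(LINT x|lborel. complex_of_real (f y * g (x - y)) * e x) =
        (LINT x|lborel. (complex_of_real (f y) * e y) * (complex_of_real (g (x - y)) * e (x - y)))"
      by (intro Bochner_Integration.integral_cong refl) (subst e_add[of _ y], simp)
    also have "\<dots> = (complex_of_real (f y) * e y) * (LINT x|lborel. complex_of_real (g (x - y)) * e (x - y))"
      by simp
    also have "(LINT x|lborel. complex_of_real (g (x - y)) * e (x - y)) = fourier g p"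
      using lborel_integral_real_affine[of 1 "\<lambda>x. complex_of_real (g x) * e x" "- y"]
      by (simp add: fourier_def e_def)
    finally show "(LINT x|lborel. complex_of_real (f y * g (x - y)) * e x) =
      (complex_of_real (f y) * e y) * fourier g p" .
  qed simp
  also have "\<dots> = fourier f p * fourier g p"
    by (simp add: fourier_def e_def)
  finally show ?thesis .
qed

text \<open>Inversion at a point needs a continuous function. Convolution with a bounded continuous
  function supplies one and preserves boundedness, so the argument can be repeated for the triple
  convolution.\<close>

lemma convol_bounded_continuous:
  assumes f: "integrable lborel f" and g: "continuous_on UNIV g" "\<And>x. \<bar>g x\<bar> \<le> B"
  shows "continuous_on UNIV (convol f g)" "\<bar>convol f g x\<bar> \<le> B * (LINT y|lborel. \<bar>f y\<bar>)"
proof -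
  have [measurable]: "f \<in> borel_measurable borel" "g \<in> borel_measurable borel"
    using f g by (auto intro: borel_measurable_continuous_onI)
  have B: "0 \<le> B" using g(2)[of 0] by linarith
  have int: "integrable lborel (\<lambda>y. f y * g (x - y))" for x
    by (rule Bochner_Integration.integrable_bound[OF integrable_mult_right[OF integrable_abs[OF f], of B]])
      (auto simp: abs_mult B g(2) mult.commute[of B] intro!: mult_left_mono)
  show "continuous_on UNIV (convol f g)"
  proof (rule continuous_at_imp_continuous_on, intro ballI)
    fix x
    show "isCont (convol f g) x"
      unfolding continuous_at_sequentially comp_def convol_def
    proof (intro allI impI)
      fix s assume s: "s \<longlonglongrightarrow> x"
      show "(\<lambda>n. LINT y|lborel. f y * g (s n - y)) \<longlonglongrightarrow> (LINT y|lborel. f y * g (x - y))"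
      proof (rule integral_dominated_convergence[where w = "\<lambda>y. B * \<bar>f y\<bar>"])
        show "AE y in lborel. (\<lambda>n. f y * g (s n - y)) \<longlonglongrightarrow> f y * g (x - y)"
        proof (intro AE_I2 tendsto_mult tendsto_const)
          fix y
          have "isCont g (x - y)" using g(1) by (simp add: continuous_on_eq_continuous_at)
          then show "(\<lambda>n. g (s n - y)) \<longlonglongrightarrow> g (x - y)"
            by (rule isCont_tendsto_compose) (intro tendsto_intros s)
        qed
        show "AE y in lborel. norm (f y * g (s n - y)) \<le> B * \<bar>f y\<bar>" for n
          using g(2) by (auto simp: abs_mult mult.commute[of B] intro!: mult_left_mono)
      qed (use f in auto)
    qed
  qed
  have "\<bar>convol f g x\<bar> \<le> (LINT y|lborel. norm (f y * g (x - y)))"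
    unfolding convol_def real_norm_def[symmetric] by (rule integral_norm_bound)
  also have "\<dots> \<le> (LINT y|lborel. B * \<bar>f y\<bar>)"
    using integrable_abs[OF int] f g(2) by (intro integral_mono) (auto simp: abs_mult mult.commute[of B] intro!: mult_left_mono)
  finally show "\<bar>convol f g x\<bar> \<le> B * (LINT y|lborel. \<bar>f y\<bar>)" by simp
qed


section \<open>Gaussian regularisation and inversion\<close>

lemma gaussian_fourier:
  fixes x \<sigma> :: real
  assumes \<sigma>: "0 < \<sigma>"
  shows "(LINT p|lborel. complex_of_real (exp (- (\<sigma> * p)\<^sup>2 / 2)) * exp (- (\<i> * complex_of_real p * complex_of_real x)))
    = complex_of_real (2 * pi * normal_density 0 \<sigma> x)"
proof -
  let ?F = "\<lambda>p. complex_of_real (std_normal_density p) * exp (\<i> * complex_of_real (- x / \<sigma> * p))"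
  \<comment> \<open>The formula is read off from the characteristic function of the standard normal
    law at -x / \<sigma>, after the substitution of \<sigma> * p for p.\<close>
  have "complex_of_real (exp (- (- x / \<sigma>)\<^sup>2 / 2)) = char std_normal_distribution (- x / \<sigma>)"
    by (simp add: char_std_normal_distribution)
  also have "\<dots> = (LINT p|lborel. ?F p)"
    unfolding char_def by (subst integral_density) (simp_all add: scaleR_conv_of_real)
  also have "\<dots> = \<sigma> *\<^sub>R (LINT p|lborel. ?F (0 + \<sigma> * p))"
    using \<sigma> by (subst lborel_integral_real_affine[of \<sigma> _ 0]) auto
  also have "(LINT p|lborel. ?F (0 + \<sigma> * p)) = (LINT p|lborel. complex_of_real (1 / sqrt (2 * pi)) *
      (complex_of_real (exp (- (\<sigma> * p)\<^sup>2 / 2)) * exp (- (\<i> * complex_of_real p * complex_of_real x))))"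
  proof (intro Bochner_Integration.integral_cong refl)
    fix p
    have "\<i> * complex_of_real (- x / \<sigma> * (0 + \<sigma> * p)) = - (\<i> * complex_of_real p * complex_of_real x)"
      using \<sigma> by simp
    then show "?F (0 + \<sigma> * p) = complex_of_real (1 / sqrt (2 * pi)) *
      (complex_of_real (exp (- (\<sigma> * p)\<^sup>2 / 2)) * exp (- (\<i> * complex_of_real p * complex_of_real x)))"
      by (simp only: std_normal_density_def of_real_mult mult.assoc add_0)
  qed
  also have "\<dots> = complex_of_real (1 / sqrt (2 * pi)) *
     (LINT p|lborel. complex_of_real (exp (- (\<sigma> * p)\<^sup>2 / 2)) * exp (- (\<i> * complex_of_real p * complex_of_real x)))"
    by (rule integral_mult_right_zero)
  finally have "(LINT p|lborel. complex_of_real (exp (- (\<sigma> * p)\<^sup>2 / 2)) * exp (- (\<i> * complex_of_real p * complex_of_real x)))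
    = complex_of_real (sqrt (2 * pi) / \<sigma> * exp (- (- x / \<sigma>)\<^sup>2 / 2))"
    using \<sigma> by (simp add: scaleR_conv_of_real field_simps)
  also have "sqrt (2 * pi) / \<sigma> * exp (- (- x / \<sigma>)\<^sup>2 / 2) = 2 * pi * normal_density 0 \<sigma> x"
  proof -
    have "2 * pi = sqrt (2 * pi) * sqrt (2 * pi)" by simp
    then have "sqrt (2 * pi) / \<sigma> = 2 * pi * (1 / sqrt (2 * pi * \<sigma>\<^sup>2))"
      using \<sigma> by (simp add: real_sqrt_mult field_simps)
    moreover have "(- x / \<sigma>)\<^sup>2 / 2 = (x - 0)\<^sup>2 / (2 * \<sigma>\<^sup>2)" by (simp add: power_divide)
    ultimately show ?thesis by (simp add: normal_density_def)
  qed
  finally show ?thesis .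
qed

lemma integrable_gauss_factor:
  fixes \<sigma> :: real
  assumes "\<sigma> > 0"
  shows "integrable lborel (\<lambda>p. exp (- (\<sigma> * p)\<^sup>2 / 2))"
proof -
  have "integrable lborel (\<lambda>p. sqrt (2 * pi) * std_normal_density (0 + \<sigma> * p))"
    using assms by (intro integrable_mult_right lborel_integrable_real_affine) auto
  then show ?thesis by (simp add: std_normal_density_def)
qed

text \<open>The Gaussian damping makes the double integral absolutely convergent for any integrable
  f, so Fubini applies; the inner integral in p is then 2 pi times a normal density concentrating at
  0 as \<sigma> tends to 0.\<close>

lemma fourier_gauss_regularised:
  assumes f: "integrable lborel f" and \<sigma>: "0 < \<sigma>"
  shows "(LINT p|lborel. fourier f p * complex_of_real (exp (- (\<sigma> * p)\<^sup>2 / 2)))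
    = complex_of_real (2 * pi * (LINT x|lborel. f x * normal_density 0 \<sigma> x))"
proof -
  have [measurable]: "f \<in> borel_measurable borel" using f by auto
  let ?e = "\<lambda>p x. exp (- (\<i> * complex_of_real p * complex_of_real x))"
  let ?G = "\<lambda>p. exp (- (\<sigma> * p)\<^sup>2 / 2)"
  let ?K = "\<lambda>p x. complex_of_real (?G p) * (complex_of_real (f x) * ?e p x)"
  have int: "integrable (lborel \<Otimes>\<^sub>M lborel) (case_prod ?K)"
  proof (rule lborel_pair.Fubini_integrable)
    show "case_prod ?K \<in> borel_measurable (lborel \<Otimes>\<^sub>M lborel)" by measurable
    show "integrable lborel (\<lambda>p. LINT x|lborel. norm (case (p, x) of (p, x) \<Rightarrow> ?K p x))"
      using integrable_gauss_factor[OF \<sigma>] by (simp add: norm_mult)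
    show "AE p in lborel. integrable lborel (\<lambda>x. case (p, x) of (p, x) \<Rightarrow> ?K p x)"
      using integrable_fourier_kernel[OF f] by simp
  qed
  have "(LINT p|lborel. fourier f p * complex_of_real (?G p)) = (LINT p|lborel. LINT x|lborel. ?K p x)"
    unfolding fourier_def by (simp add: mult.commute)
  also have "\<dots> = (LINT x|lborel. LINT p|lborel. ?K p x)"
    using lborel_pair.Fubini_integral[OF int] by simp
  also have "\<dots> = (LINT x|lborel. complex_of_real (2 * pi * (f x * normal_density 0 \<sigma> x)))"
  proof (intro Bochner_Integration.integral_cong refl)
    fix x
    have "(LINT p|lborel. ?K p x) = (LINT p|lborel. complex_of_real (f x) * (complex_of_real (?G p) * ?e p x))"
      by (simp only: mult_ac)
    also have "\<dots> = complex_of_real (f x) * (LINT p|lborel. complex_of_real (?G p) * ?e p x)"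
      by (rule integral_mult_right_zero)
    finally show "(LINT p|lborel. ?K p x) = complex_of_real (2 * pi * (f x * normal_density 0 \<sigma> x))"
      unfolding gaussian_fourier[OF \<sigma>] by simp
  qed
  also have "\<dots> = complex_of_real (2 * pi * (LINT x|lborel. f x * normal_density 0 \<sigma> x))"
    by (subst integral_complex_of_real) (simp only: integral_mult_right_zero)
  finally show ?thesis .
qed

lemma fourier_gauss_tendsto:
  assumes f: "integrable lborel f" and cont: "continuous_on UNIV f" and bd: "\<And>x. \<bar>f x\<bar> \<le> B"
  shows "(\<lambda>m. LINT p|lborel. fourier f p * complex_of_real (exp (- (inverse (real (Suc m)) * p)\<^sup>2 / 2)))
    \<longlonglongrightarrow> complex_of_real (2 * pi * f 0)"
proof -
  have [measurable]: "f \<in> borel_measurable borel" using f by auto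
  let ?\<sigma> = "\<lambda>m. inverse (real (Suc m))"
  have eq: "(LINT x|lborel. f x * normal_density 0 \<sigma> x) = (LINT y|lborel. f (\<sigma> * y) * std_normal_density y)"
    if "\<sigma> > 0" for \<sigma>
  proof -
    have "(LINT x|lborel. f x * normal_density 0 \<sigma> x) =
      \<sigma> * (LINT y|lborel. f (\<sigma> * y) * normal_density 0 \<sigma> (\<sigma> * y))"
      using that by (subst lborel_integral_real_affine[of \<sigma> _ 0]) auto
    also have "\<dots> = (LINT y|lborel. \<sigma> * (f (\<sigma> * y) * normal_density 0 \<sigma> (\<sigma> * y)))"
      by simp
    also have "\<dots> = (LINT y|lborel. f (\<sigma> * y) * std_normal_density y)"
    proof (intro Bochner_Integration.integral_cong refl)
      fix y
      have "\<sigma> * normal_density 0 \<sigma> (\<sigma> * y) = std_normal_density y"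
        using that by (simp add: normal_density_def real_sqrt_mult power_mult_distrib field_simps)
      then show "\<sigma> * (f (\<sigma> * y) * normal_density 0 \<sigma> (\<sigma> * y)) = f (\<sigma> * y) * std_normal_density y"
        by (metis mult.left_commute)
    qed
    finally show ?thesis .
  qed
  have "(\<lambda>m. LINT y|lborel. f (?\<sigma> m * y) * std_normal_density y) \<longlonglongrightarrow> (LINT y|lborel. f 0 * std_normal_density y)"
  proof (rule integral_dominated_convergence[where w = "\<lambda>y. B * std_normal_density y"])
    show "AE y in lborel. (\<lambda>m. f (?\<sigma> m * y) * std_normal_density y) \<longlonglongrightarrow> f 0 * std_normal_density y"
    proof (intro AE_I2 tendsto_mult tendsto_const)
      fix y :: real
      have "isCont f 0" using cont by (simp add: continuous_on_eq_continuous_at)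
      moreover have "(\<lambda>m. ?\<sigma> m * y) \<longlonglongrightarrow> 0"
        using tendsto_mult_left_zero[OF LIMSEQ_inverse_real_of_nat] .
      ultimately show "(\<lambda>m. f (?\<sigma> m * y)) \<longlonglongrightarrow> f 0" by (rule isCont_tendsto_compose)
    qed
    show "AE y in lborel. norm (f (?\<sigma> m * y) * std_normal_density y) \<le> B * std_normal_density y" for m
      using bd by (auto simp: abs_mult intro!: mult_right_mono)
  qed auto
  then have "(\<lambda>m. LINT x|lborel. f x * normal_density 0 (?\<sigma> m) x) \<longlonglongrightarrow> f 0"
    by (simp add: eq)
  then show ?thesis
    by (subst fourier_gauss_regularised[OF f]) (auto intro!: tendsto_intros)
qed

lemma gauss_factor_tendsto: "(\<lambda>m. exp (- (inverse (real (Suc m)) * p)\<^sup>2 / 2)) \<longlonglongrightarrow> 1"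
proof -
  have "(\<lambda>m. exp (- (inverse (real (Suc m)) * p)\<^sup>2 / 2)) \<longlonglongrightarrow> exp (- (0 * p)\<^sup>2 / 2)"
    by (intro tendsto_intros LIMSEQ_inverse_real_of_nat) simp
  then show ?thesis by simp
qed

lemma fourier_inversion_0:
  assumes f: "integrable lborel f" and cont: "continuous_on UNIV f" and bd: "\<And>x. \<bar>f x\<bar> \<le> B"
    and int: "integrable lborel (\<lambda>p. norm (fourier f p))"
  shows "(LINT p|lborel. fourier f p) = complex_of_real (2 * pi * f 0)"
proof -
  have [measurable]: "f \<in> borel_measurable borel" using f by auto
  have "(\<lambda>m. LINT p|lborel. fourier f p * complex_of_real (exp (- (inverse (real (Suc m)) * p)\<^sup>2 / 2)))
    \<longlonglongrightarrow> (LINT p|lborel. fourier f p)"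
  proof (rule integral_dominated_convergence[OF _ _ int])
    show "AE p in lborel. (\<lambda>m. fourier f p * complex_of_real (exp (- (inverse (real (Suc m)) * p)\<^sup>2 / 2))) \<longlonglongrightarrow> fourier f p"
    proof (intro AE_I2)
      fix p
      have "(\<lambda>m. fourier f p * complex_of_real (exp (- (inverse (real (Suc m)) * p)\<^sup>2 / 2))) \<longlonglongrightarrow> fourier f p * complex_of_real 1"
        by (intro tendsto_intros gauss_factor_tendsto)
      then show "(\<lambda>m. fourier f p * complex_of_real (exp (- (inverse (real (Suc m)) * p)\<^sup>2 / 2))) \<longlonglongrightarrow> fourier f p"
        by simp
    qed
  qed (auto simp: norm_mult intro!: mult_left_le)
  then show ?thesis using fourier_gauss_tendsto[OF f cont bd] LIMSEQ_unique by blast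
qed

text \<open>A nonnegative transform is automatically integrable: the regularised integrals increase to it.\<close>

lemma fourier_nonneg_integrable:
  assumes f: "integrable lborel f" and cont: "continuous_on UNIV f" and bd: "\<And>x. \<bar>f x\<bar> \<le> B"
    and q: "\<And>p. fourier f p = complex_of_real (q p)" "\<And>p. 0 \<le> q p" "\<And>p. q p \<le> B'"
  shows "integrable lborel q"
proof (rule integrable_monotone_convergence)
  let ?f = "\<lambda>m p. q p * exp (- (inverse (real (Suc m)) * p)\<^sup>2 / 2)"
  have [measurable]: "f \<in> borel_measurable borel" using f by auto
  have "(\<lambda>p. Re (fourier f p)) \<in> borel_measurable borel" by measurable
  then show q_meas[measurable]: "q \<in> borel_measurable lborel" by (simp add: q(1))
  show "AE p in lborel. mono (\<lambda>m. ?f m p)"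
  proof (intro AE_I2 monoI mult_left_mono q(2))
    fix p and m m' :: nat assume "m \<le> m'"
    then have "(inverse (real (Suc m')) * p)\<^sup>2 \<le> (inverse (real (Suc m)) * p)\<^sup>2"
      unfolding power_mult_distrib by (intro mult_right_mono power_mono) (auto intro!: le_imp_inverse_le)
    then show "exp (- (inverse (real (Suc m)) * p)\<^sup>2 / 2) \<le> exp (- (inverse (real (Suc m')) * p)\<^sup>2 / 2)"
      by simp
  qed
  show "AE p in lborel. (\<lambda>m. ?f m p) \<longlonglongrightarrow> q p"
    using tendsto_mult[OF tendsto_const gauss_factor_tendsto, of "q _"] by simp
  show "integrable lborel (?f m)" for m
  proof (rule Bochner_Integration.integrable_bound)
    show "integrable lborel (\<lambda>p. B' * exp (- (inverse (real (Suc m)) * p)\<^sup>2 / 2))"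
      by (intro integrable_mult_right integrable_gauss_factor) simp
    show "AE p in lborel. norm (?f m p) \<le> norm (B' * exp (- (inverse (real (Suc m)) * p)\<^sup>2 / 2))"
      using q(2,3) by (intro AE_I2) (auto simp: abs_mult intro!: mult_right_mono order_trans[OF q(3)])
  qed measurable
  have "(\<lambda>m. LINT p|lborel. complex_of_real (?f m p)) \<longlonglongrightarrow> complex_of_real (2 * pi * f 0)"
    using fourier_gauss_tendsto[OF f cont bd] by (simp add: q(1))
  then have "(\<lambda>m. complex_of_real (LINT p|lborel. ?f m p)) \<longlonglongrightarrow> complex_of_real (2 * pi * f 0)"
    by (simp only: integral_complex_of_real)
  then show "(\<lambda>m. LINT p|lborel. ?f m p) \<longlonglongrightarrow> 2 * pi * f 0"
    by (simp only: tendsto_of_real_iff)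
qed

text \<open>Evenness makes the transform q of h real, so q^2, the transform of the convolution of h
  with itself, is nonnegative and therefore integrable. Since |q| is at most the integral of h,
  |q|^3 is dominated by a multiple of q^2, and inversion at 0 applies to the triple
  convolution.\<close>

lemma fourier_cube_integral:
  assumes h: "integrable lborel h" and cont: "continuous_on UNIV h" and bd: "\<And>x. \<bar>h x\<bar> \<le> B"
    and nonneg: "\<And>x. 0 \<le> h x" and even: "\<And>x. h (- x) = h x"
  shows "(LINT p|lborel. fourier h p ^ 3) = complex_of_real (2 * pi * convol h (convol h h) 0)"
proof -
  define q where "q p = Re (fourier h p)" for p
  let ?I = "integral\<^sup>L lborel h"
  have fq: "fourier h p = complex_of_real (q p)" for p
    unfolding q_def by (rule fourier_real[OF h even])
  have q_le: "\<bar>q p\<bar> \<le> ?I" for p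
    using norm_fourier_le[OF h nonneg, of p] by (simp add: fq)
  have I0: "0 \<le> ?I" using q_le[of 0] by linarith
  let ?h2 = "convol h h"
  have h2: "integrable lborel ?h2" "continuous_on UNIV ?h2" "\<bar>?h2 x\<bar> \<le> B * (LINT y|lborel. \<bar>h y\<bar>)" for x
    by (rule convol_integrable convol_bounded_continuous h cont bd)+
  have f2: "fourier ?h2 p = complex_of_real ((q p)\<^sup>2)" for p
    using fourier_convol[OF h h] by (simp add: fq power2_eq_square)
  have q2: "integrable lborel (\<lambda>p. (q p)\<^sup>2)"
  proof (rule fourier_nonneg_integrable[OF h2 f2])
    show "(q p)\<^sup>2 \<le> ?I\<^sup>2" for p using q_le[of p] I0 by (metis abs_le_square_iff abs_of_nonneg)
  qed simp
  let ?h3 = "convol h ?h2"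
  have h3: "integrable lborel ?h3" "continuous_on UNIV ?h3"
    "\<bar>?h3 x\<bar> \<le> B * (LINT y|lborel. \<bar>h y\<bar>) * (LINT y|lborel. \<bar>h y\<bar>)" for x
    by (rule convol_integrable convol_bounded_continuous h h2)+
  have f3: "fourier ?h3 p = fourier h p ^ 3" for p
    using fourier_convol[OF h h2(1)] fourier_convol[OF h h] by (simp add: power3_eq_cube)
  have [measurable]: "h \<in> borel_measurable borel" using h by auto
  have "integrable lborel (\<lambda>p. norm (fourier ?h3 p))"
  proof (rule Bochner_Integration.integrable_bound[OF integrable_mult_right[OF q2, of ?I]])
    show "(\<lambda>p. norm (fourier ?h3 p)) \<in> borel_measurable lborel" unfolding f3 by measurable
    show "AE p in lborel. norm (norm (fourier ?h3 p)) \<le> norm (?I * (q p)\<^sup>2)"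
    proof (intro AE_I2)
      fix p
      have "norm (norm (fourier ?h3 p)) = \<bar>q p\<bar> * (q p)\<^sup>2"
        by (simp add: f3 fq norm_power power3_eq_cube power2_eq_square norm_mult)
      also have "\<dots> \<le> ?I * (q p)\<^sup>2" by (intro mult_right_mono q_le) simp
      finally show "norm (norm (fourier ?h3 p)) \<le> norm (?I * (q p)\<^sup>2)" using I0 by simp
    qed
  qed
  from fourier_inversion_0[OF h3 this] show ?thesis by (simp add: f3)
qed

lemma H3_tilde_eq:
  assumes "integrable lborel (h_fun \<psi> \<alpha> k)" "continuous_on UNIV (h_fun \<psi> \<alpha> k)"
    "\<And>x. \<bar>h_fun \<psi> \<alpha> k x\<bar> \<le> B" "\<And>x. 0 \<le> h_fun \<psi> \<alpha> k x" "\<And>x. h_fun \<psi> \<alpha> k (- x) = h_fun \<psi> \<alpha> k x"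
  shows "H3_tilde \<psi> \<alpha> k =
    complex_of_real (convol (h_fun \<psi> \<alpha> k) (convol (h_fun \<psi> \<alpha> k) (h_fun \<psi> \<alpha> k)) 0)"
proof -
  have "h_tilde \<psi> \<alpha> k p = fourier (h_fun \<psi> \<alpha> k) p" for p
    by (simp add: h_tilde_def fourier_def)
  then show ?thesis
    using fourier_cube_integral[OF assms] by (simp add: H3_tilde_def)
qed

subsection \<open>Riemann sums over graphs\<close>

text \<open>The index set used below omits the root vertex 0, which \<open>u(0 := 0)\<close> pins at
  the origin: this is integration over configurations modulo translation.\<close>

abbreviation lebPi :: "nat set \<Rightarrow> (nat \<Rightarrow> real) measure" where
  "lebPi I \<equiv> Pi\<^sub>M I (\<lambda>_. lborel)"

interpretation lebPi: product_sigma_finite "\<lambda>_::nat. lborel :: real measure"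
  by standard

lemma upd_component_measurable [measurable]:
  assumes "a \<in> insert 0 I"
  shows "(\<lambda>u. (u(0 := 0 :: real)) a) \<in> borel_measurable (lebPi I)"
proof (cases "a = 0")
  case False
  then have "a \<in> I" using assms by simp
  then have "(\<lambda>u. u a) \<in> measurable (lebPi I) lborel" by (rule measurable_component_singleton)
  then show ?thesis using False by simp
qed simp

lemma gap_measurable:
  assumes "e \<in> nsets (insert 0 I) 2"
  shows "(\<lambda>u. gap (u(0 := 0 :: real)) e) \<in> borel_measurable (lebPi I)"
proof -
  obtain a b where e: "e = {a, b}" "a \<in> insert 0 I" "b \<in> insert 0 I" using assms by (rule nsets2_E)
  note [measurable] = upd_component_measurable[OF e(2)] upd_component_measurable[OF e(3)]
  have "(\<lambda>u. \<bar>(u(0 := 0 :: real)) a - (u(0 := 0)) b\<bar>) \<in> borel_measurable (lebPi I)" by measurable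
  then show ?thesis unfolding e(1) gap_doubleton .
qed

lemma grown_root: "grown E r W \<Longrightarrow> r \<in> W"
  by (induction rule: grown.induct) auto

lemma grown_finite: "grown E r W \<Longrightarrow> finite W"
  by (induction rule: grown.induct) auto

lemma gap_cong: "(\<And>a. a \<in> e \<Longrightarrow> g a = g' a) \<Longrightarrow> gap g e = gap g' e"
  by (metis (no_types, lifting) gap_def image_cong)

text \<open>Induction along the spanning tree. Integrating over the newest vertex x, the tree edge
  {a, x} yields the integral of D by translation invariance, independently of the other vertices.
  The remaining edges at x are bounded by B, in total by \<open>B ^ card E\<close>, which is where B
  >= 1 enters.\<close>

lemma grown_dominating_finite:
  fixes D :: "real \<Rightarrow> real"
  assumes "grown E 0 W" and fin: "finite E"
    and [measurable]: "D \<in> borel_measurable borel"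
    and int: "(\<integral>\<^sup>+x. ennreal (D x) \<partial>lborel) < \<infinity>" and bd: "\<And>x. D x \<le> B" and even: "\<And>x. D (- x) = D x"
    and B: "1 \<le> B"
  shows "(\<integral>\<^sup>+u. (\<Prod>e\<in>E \<inter> nsets W 2. ennreal (D (gap (u(0 := 0)) e))) \<partial>lebPi (W - {0})) < \<infinity>"
  using assms(1)
proof (induction rule: grown.induct)
  case base
  have "nsets {0} 2 = ({} :: nat set set)" by (auto simp: nsets_2_eq)
  then show ?case by (simp add: PiM_empty)
next
  case (step W a x)
  let ?I = "W - {0}"
  let ?d = "\<lambda>u e. ennreal (D (gap (u(0 := 0)) e))"
  let ?Q = "\<lambda>W u. \<Prod>e\<in>E \<inter> nsets W 2. ?d u e"
  let ?C = "ennreal B ^ card E"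
  have x0: "x \<noteq> 0" using grown_root[OF step(1)] step(3) by metis
  have finI: "finite ?I" using grown_finite[OF step(1)] by simp
  have I': "insert x W - {0} = insert x ?I" using x0 by auto
  have "0 \<in> W" using grown_root[OF step(1)] .
  then have W_eq: "W = insert 0 ?I" "insert x W = insert 0 (insert x ?I)" by auto
  have [measurable]: "?Q W \<in> borel_measurable (lebPi ?I)"
    by (intro borel_measurable_prod_ennreal measurable_compose[OF gap_measurable])
      (auto simp: insert_absorb \<open>0 \<in> W\<close>)
  have Qmeas: "?Q (insert x W) \<in> borel_measurable (lebPi (insert x ?I))"
    by (intro borel_measurable_prod_ennreal measurable_compose[OF gap_measurable])
      (auto simp: insert_absorb insert_commute[of 0] \<open>0 \<in> W\<close>)
  have bound: "?Q (insert x W) (u(x := y)) \<le> ?C * ?Q W u * ennreal (D (y - (u(0 := 0)) a))" for u y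
  proof -
    let ?u = "u(x := y)"
    \<comment> \<open>\<open>E'\<close> collects the edges from x to vertices of W other than the
      tree edge {a, x}.\<close>
    define E' where "E' = (E \<inter> nsets (insert x W) 2) - nsets W 2 - {{a, x}}"
    have split: "E \<inter> nsets (insert x W) 2 = insert {a, x} ((E \<inter> nsets W 2) \<union> E')"
      using step(2,4,3) nsets_mono[of W "insert x W" 2] by (auto simp: E'_def)
    have "{a, x} \<notin> nsets W 2" using step(3) by simp
    moreover have E': "(E \<inter> nsets W 2) \<inter> E' = {}" "{a, x} \<notin> E'" "finite E'" "card E' \<le> card E"
      using fin by (auto simp: E'_def intro!: card_mono)
    ultimately have "?Q (insert x W) ?u = ?d ?u {a, x} * (?Q W ?u * (\<Prod>e\<in>E'. ?d ?u e))"
      unfolding split using fin by (simp add: prod.union_disjoint)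
    also have "?Q W ?u = ?Q W u"
    proof (rule prod.cong)
      fix e assume "e \<in> E \<inter> nsets W 2"
      then have "x \<notin> e" using step(3) by (auto simp: nsets_def)
      then show "?d ?u e = ?d u e" by (subst gap_cong[of e _ "u(0 := 0)"]) auto
    qed simp
    also have "?d ?u {a, x} = ennreal (D (y - (u(0 := 0)) a))"
    proof -
      have "a \<noteq> x" using step(2,3) by auto
      have "D \<bar>z\<bar> = D (- z)" for z using even[of z] by (auto simp: abs_if)
      then have "D (gap (?u(0 := 0)) {a, x}) = D (- ((?u(0 := 0)) a - (?u(0 := 0)) x))"
        unfolding gap_doubleton .
      then show ?thesis using \<open>a \<noteq> x\<close> x0 by simp
    qed
    finally have eq: "?Q (insert x W) ?u =
      ennreal (D (y - (u(0 := 0)) a)) * (?Q W u * (\<Prod>e\<in>E'. ?d ?u e))" .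
    have "(\<Prod>e\<in>E'. ?d ?u e) \<le> (\<Prod>e\<in>E'. ennreal B)"
      by (intro prod_mono_ennreal) (simp add: ennreal_leI bd)
    also have "\<dots> \<le> ?C"
      using E'(4) B by (simp, intro power_increasing) (auto simp flip: ennreal_1 intro: ennreal_leI)
    finally have "ennreal (D (y - (u(0 := 0)) a)) * (?Q W u * (\<Prod>e\<in>E'. ?d ?u e)) \<le>
      ennreal (D (y - (u(0 := 0)) a)) * (?Q W u * ?C)"
      by (intro mult_left_mono) auto
    then show ?thesis unfolding eq by (simp only: mult_ac)
  qed
  have inner: "(\<integral>\<^sup>+y. ennreal (D (y - c)) \<partial>lborel) = (\<integral>\<^sup>+y. ennreal (D y) \<partial>lborel)" for c
    using nn_integral_real_affine[of "\<lambda>y. ennreal (D y)" 1 "- c"] by simp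
  have "(\<integral>\<^sup>+u. ?Q (insert x W) u \<partial>lebPi (insert x W - {0})) =
      (\<integral>\<^sup>+u. \<integral>\<^sup>+y. ?Q (insert x W) (u(x := y)) \<partial>lborel \<partial>lebPi ?I)"
    unfolding I' using finI step(3) Qmeas by (intro lebPi.product_nn_integral_insert) auto
  also have "\<dots> \<le> (\<integral>\<^sup>+u. \<integral>\<^sup>+y. ?C * ?Q W u * ennreal (D (y - (u(0 := 0)) a)) \<partial>lborel \<partial>lebPi ?I)"
    by (intro nn_integral_mono bound)
  also have "\<dots> = (\<integral>\<^sup>+u. ?C * ?Q W u * (\<integral>\<^sup>+y. ennreal (D y) \<partial>lborel) \<partial>lebPi ?I)"
    by (subst nn_integral_cmult) (auto simp: inner)
  also have "\<dots> = ?C * (\<integral>\<^sup>+u. ?Q W u \<partial>lebPi ?I) * (\<integral>\<^sup>+y. ennreal (D y) \<partial>lborel)"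
    by (simp add: nn_integral_multc nn_integral_cmult)
  also have "\<dots> < \<infinity>"
  proof -
    have "?C < \<top>" using B by (simp add: ennreal_power)
    then show ?thesis
      using step.IH int unfolding infinity_ennreal_def ennreal_mult_less_top by blast
  qed
  finally show ?case .
qed

text \<open>Injectivity of the vertex maps costs nothing in the limit: two coordinates agree only on
  a hyperplane, whose measure vanishes when one of the two is integrated first.\<close>

lemma AE_lebPi_inj:
  assumes I: "finite I" "0 \<notin> I"
  shows "AE u in lebPi I. inj_on (u(0 := 0)) (insert 0 I)"
proof -
  have single: "AE u in lebPi I. (u(0 := 0)) a \<noteq> (u(0 := 0)) b" if ab: "a \<in> I" "b \<in> insert 0 I" "a \<noteq> b" for a b
  proof -
    let ?J = "I - {a}"
    let ?N = "\<lambda>u. indicator {(0 :: real)} ((u(0 := 0)) a - (u(0 := 0)) b) :: ennreal"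
    have I_eq: "insert a ?J = I" using ab by auto
    have a0: "a \<noteq> 0" using ab(1) I(2) by metis
    note [measurable] = upd_component_measurable[of a I] upd_component_measurable[of b I]
    have "(\<lambda>u. (u(0 := 0)) a - (u(0 := 0)) b) \<in> borel_measurable (lebPi I)"
      using ab by (intro borel_measurable_diff upd_component_measurable) auto
    then have meas: "?N \<in> borel_measurable (lebPi I)" by measurable
    have "(\<integral>\<^sup>+u. ?N u \<partial>lebPi (insert a ?J)) = (\<integral>\<^sup>+u. \<integral>\<^sup>+y. ?N (u(a := y)) \<partial>lborel \<partial>lebPi ?J)"
    proof (rule lebPi.product_nn_integral_insert)
      show "?N \<in> borel_measurable (lebPi (insert a ?J))" unfolding I_eq by (rule meas)
    qed (use I in auto)
    also have "\<dots> = (\<integral>\<^sup>+u. \<integral>\<^sup>+y. indicator {(u(0 := 0)) b} y \<partial>lborel \<partial>lebPi ?J)"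
      using a0 ab(3) by (intro nn_integral_cong) (auto simp: indicator_def)
    also have "\<dots> = 0" by simp
    finally have "(\<integral>\<^sup>+u. ?N u \<partial>lebPi I) = 0" by (simp only: I_eq)
    then have "AE u in lebPi I. ?N u = 0" using nn_integral_0_iff_AE[OF meas] by simp
    then show ?thesis by (rule AE_mp) (auto simp: indicator_def)
  qed
  have "AE u in lebPi I. \<forall>a\<in>I. \<forall>b\<in>insert 0 I. a \<noteq> b \<longrightarrow> (u(0 := 0)) a \<noteq> (u(0 := 0)) b"
    using I single by (intro AE_finite_allI) (auto intro!: AE_impI)
  then show ?thesis
    by (rule AE_mp) (intro AE_I2 impI inj_onI, metis insert_iff)
qed

section \<open>Lattice sums as integrals of step functions\<close>

lemma floor_set_eq:
  assumes "0 < R"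
  shows "{u. \<lfloor>R * u\<rfloor> = y} = {real_of_int y / R ..< (real_of_int y + 1) / R}"
  using assms by (auto simp: floor_eq_iff field_simps)

text \<open>The integrand is constant on cubes of side 1 / R, each of volume R ^ (- card I). The
  representation is exact, so convergence of Riemann sums becomes a question of dominated
  convergence. The support condition makes the step function a finite combination of cube
  indicators.\<close>

lemma sum_as_integral:
  fixes F :: "(nat \<Rightarrow> int) \<Rightarrow> real"
  assumes I: "finite I" and Z: "finite Z" and R: "0 < R"
    and supp: "\<And>y. y \<in> extensional I \<Longrightarrow> F y \<noteq> 0 \<Longrightarrow> y \<in> I \<rightarrow>\<^sub>E Z"
  shows "(\<lambda>u. F (\<lambda>i\<in>I. \<lfloor>R * u i\<rfloor>)) \<in> borel_measurable (lebPi I)"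
    and "(LINT u|lebPi I. F (\<lambda>i\<in>I. \<lfloor>R * u i\<rfloor>)) = (\<Sum>y\<in>I \<rightarrow>\<^sub>E Z. F y) / R ^ card I"
proof -
  let ?A = "\<lambda>y. {u. \<lfloor>R * u\<rfloor> = y}"
  let ?f = "\<lambda>y i x. indicator (?A (y i)) x :: real"
  have finP: "finite (I \<rightarrow>\<^sub>E Z)" using I Z by (intro finite_PiE) auto
  have F_eq: "F (\<lambda>i\<in>I. \<lfloor>R * u i\<rfloor>) = (\<Sum>y\<in>I \<rightarrow>\<^sub>E Z. F y * (\<Prod>i\<in>I. ?f y i (u i)))" for u
  proof -
    let ?y = "\<lambda>i\<in>I. \<lfloor>R * u i\<rfloor>"
    have pr: "(\<Prod>i\<in>I. ?f y i (u i)) = (if y = ?y then 1 else 0)" if "y \<in> I \<rightarrow>\<^sub>E Z" for y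
    proof (cases "y = ?y")
      case False
      then obtain i where i: "y i \<noteq> ?y i" by blast
      then have "i \<in> I" using PiE_arb[OF that, of i] by (cases "i \<in> I") auto
      then have "i \<in> I" "y i \<noteq> \<lfloor>R * u i\<rfloor>" using i by auto
      then show ?thesis using I False by (auto intro!: prod_zero bexI[of _ i] simp: indicator_def)
    qed (auto intro!: prod.neutral simp: indicator_def)
    have "(\<Sum>y\<in>I \<rightarrow>\<^sub>E Z. F y * (\<Prod>i\<in>I. ?f y i (u i))) = (\<Sum>y\<in>I \<rightarrow>\<^sub>E Z. if y = ?y then F y else 0)"
      by (intro sum.cong) (auto simp: pr)
    also have "\<dots> = (if ?y \<in> I \<rightarrow>\<^sub>E Z then F ?y else 0)"
      using finP by (simp add: sum.delta)
    also have "\<dots> = F ?y" using supp[of ?y] by auto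
    finally show ?thesis ..
  qed
  have int1: "integrable lborel (?f y i)" and val1: "integral\<^sup>L lborel (?f y i) = 1 / R" for y i
  proof -
    show "integrable lborel (?f y i)" unfolding floor_set_eq[OF R]
      using R by (intro integrable_real_indicator) (auto simp: divide_right_mono)
    show "integral\<^sup>L lborel (?f y i) = 1 / R" unfolding floor_set_eq[OF R]
      using R by (simp add: divide_right_mono diff_divide_distrib[symmetric])
  qed
  have intP: "integrable (lebPi I) (\<lambda>u. \<Prod>i\<in>I. ?f y i (u i))" for y
    by (rule lebPi.product_integrable_prod[OF I int1])
  show "(\<lambda>u. F (\<lambda>i\<in>I. \<lfloor>R * u i\<rfloor>)) \<in> borel_measurable (lebPi I)"
    unfolding F_eq using intP by (intro borel_measurable_sum borel_measurable_times) auto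
  have "(LINT u|lebPi I. F (\<lambda>i\<in>I. \<lfloor>R * u i\<rfloor>)) = (\<Sum>y\<in>I \<rightarrow>\<^sub>E Z. F y * (LINT u|lebPi I. (\<Prod>i\<in>I. ?f y i (u i))))"
    unfolding F_eq by (subst Bochner_Integration.integral_sum) (auto intro: integrable_mult_right intP)
  also have "\<dots> = (\<Sum>y\<in>I \<rightarrow>\<^sub>E Z. F y * (1 / R) ^ card I)"
    by (subst lebPi.product_integral_prod[OF I int1]) (simp only: val1 prod_constant)
  finally show "(LINT u|lebPi I. F (\<lambda>i\<in>I. \<lfloor>R * u i\<rfloor>)) = (\<Sum>y\<in>I \<rightarrow>\<^sub>E Z. F y) / R ^ card I"
    by (simp add: sum_divide_distrib power_one_over)
qed


lemma card_shift_out: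
  fixes z :: int
  shows "real (card {x\<in>idx n. x + z \<notin> idx n}) \<le> \<bar>real_of_int z\<bar>"
proof -
  have "card {x\<in>idx n. x + z \<notin> idx n} \<le> card (if 0 \<le> z then {int n - z<..int n} else {- int n..<- int n - z})"
    by (intro card_mono) (auto simp: idx_def)
  also have "\<dots> = nat \<bar>z\<bar>" by (auto simp: of_nat_diff)
  finally show ?thesis by linarith
qed

lemma card_idx: "real (card (idx n)) = size_of n"
  by (simp add: idx_def size_of_def)

text \<open>Counts the admissible positions of the root for given offsets y. By a union bound, at
  most |y a| positions are lost for each a; with offsets of order R = o(N) this is a vanishing
  proportion.\<close>

lemma card_shift_in:
  fixes y :: "nat \<Rightarrow> int"
  assumes "finite I"
  shows "\<bar>real (card {x\<in>idx n. \<forall>a\<in>I. x + y a \<in> idx n}) / size_of n - 1\<bar> \<le> (\<Sum>a\<in>I. \<bar>real_of_int (y a)\<bar>) / size_of n"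
proof -
  let ?A = "{x\<in>idx n. \<forall>a\<in>I. x + y a \<in> idx n}"
  have N: "0 < size_of n" by (simp add: size_of_def)
  have fi: "finite (idx n)" by (simp add: idx_def)
  have "card (idx n - ?A) \<le> card (\<Union>a\<in>I. {x\<in>idx n. x + y a \<notin> idx n})"
    using fi assms by (intro card_mono) auto
  also have "\<dots> \<le> (\<Sum>a\<in>I. card {x\<in>idx n. x + y a \<notin> idx n})"
    using assms by (rule card_UN_le)
  finally have "real (card (idx n - ?A)) \<le> (\<Sum>a\<in>I. real (card {x\<in>idx n. x + y a \<notin> idx n}))"
    unfolding of_nat_sum[symmetric] of_nat_le_iff .
  also have "\<dots> \<le> (\<Sum>a\<in>I. \<bar>real_of_int (y a)\<bar>)" by (intro sum_mono card_shift_out)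
  finally have out: "real (card (idx n - ?A)) \<le> (\<Sum>a\<in>I. \<bar>real_of_int (y a)\<bar>)" .
  have "card (idx n - ?A) = card (idx n) - card ?A"
    using fi by (intro card_Diff_subset) auto
  moreover have le: "card ?A \<le> card (idx n)" using fi by (intro card_mono) auto
  ultimately have eq: "real (card ?A) = size_of n - real (card (idx n - ?A))"
    by (simp add: card_idx[symmetric] of_nat_diff)
  have "real (card ?A) / size_of n - 1 = - (real (card (idx n - ?A)) / size_of n)"
    using N by (simp add: eq diff_divide_distrib)
  then show ?thesis using out N by (simp add: divide_right_mono)
qed

text \<open>The root vertex 0 carries the translation; the other vertices are measured relative to it.\<close>

lemma sum_inj_maps_root:
  fixes \<Phi> :: "(nat \<Rightarrow> int) \<Rightarrow> real"
  assumes v: "1 \<le> v" and \<Phi>: "\<And>g g'. (\<exists>x. \<forall>a<v. g a = x + g' a) \<Longrightarrow> \<Phi> g = \<Phi> g'"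
  shows "(\<Sum>g\<in>inj_maps v (idx n). \<Phi> g) =
    (\<Sum>y\<in>{1..<v} \<rightarrow>\<^sub>E {- 2 * int n..2 * int n}. (if inj_on (y(0 := 0)) {..<v} then \<Phi> (y(0 := 0)) else 0) *
       real (card {x\<in>idx n. \<forall>a\<in>{1..<v}. x + y a \<in> idx n}))"
proof -
  let ?I = "{1..<v}"
  let ?Y = "?I \<rightarrow>\<^sub>E {- 2 * int n..2 * int n}"
  let ?X = "\<lambda>y. {x\<in>idx n. \<forall>a\<in>?I. x + y a \<in> idx n}"
  let ?\<psi> = "\<lambda>y. if inj_on (y(0 := 0)) {..<v} then \<Phi> (y(0 := 0)) else 0"
  let ?S = "{(y, x). y \<in> ?Y \<and> inj_on (y(0 := 0)) {..<v} \<and> x \<in> ?X y}"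
  have fi: "finite (idx n)" by (simp add: idx_def)
  have finY: "finite ?Y" by (intro finite_PiE) auto
  define i where "i z = (\<lambda>a\<in>{..<v}. snd z + ((fst z)(0 := 0)) a)" for z :: "(nat \<Rightarrow> int) \<times> int"
  define j where "j g = (\<lambda>a\<in>?I. g a - g 0, g 0 :: int)" for g :: "nat \<Rightarrow> int"
  have "(\<Sum>g\<in>inj_maps v (idx n). \<Phi> g) = (\<Sum>(y, x)\<in>?S. \<Phi> (y(0 := 0)))"
  proof (rule sum.reindex_bij_witness[where i = i and j = j])
    fix g assume g: "g \<in> inj_maps v (idx n)"
    have gi: "g a \<in> idx n" if "a < v" for a using g that by (auto simp: inj_maps_def)
    have inj: "inj_on g {..<v}" using g by (simp add: inj_maps_def)
    define y where "y = (\<lambda>a\<in>?I. g a - g 0)"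
    have jg: "j g = (y, g 0)" by (simp add: j_def y_def)
    have y0: "(y(0 := 0)) a = g a - g 0" if "a < v" for a using that by (auto simp: y_def)
    show "i (j g) = g"
    proof
      fix a show "i (j g) a = g a"
        using y0[of a] g by (cases "a < v") (auto simp: jg i_def inj_maps_def PiE_iff extensional_def)
    qed
    have "inj_on (y(0 := 0)) {..<v}"
    proof (rule inj_onI)
      fix a b assume "a \<in> {..<v}" "b \<in> {..<v}" "(y(0 := 0)) a = (y(0 := 0)) b"
      then show "a = b" using inj y0[of a] y0[of b] by (simp add: inj_on_def)
    qed
    moreover have "y \<in> ?Y"
      unfolding y_def
    proof (rule restrict_PiE_iff[THEN iffD2], intro ballI)
      fix a assume "a \<in> ?I"
      then show "g a - g 0 \<in> {- 2 * int n..2 * int n}"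
        using gi[of a] gi[of 0] v by (auto simp: idx_def)
    qed
    moreover have "g 0 \<in> ?X y" using gi v by (auto simp: y_def)
    ultimately show "j g \<in> ?S" by (simp only: jg mem_Collect_eq prod.case) blast
    have "\<Phi> (y(0 := 0)) = \<Phi> g"
      by (rule \<Phi>, rule exI[of _ "- g 0"]) (use y0 in auto)
    then show "(case j g of (y, x) \<Rightarrow> \<Phi> (y(0 := 0))) = \<Phi> g" by (simp only: jg prod.case)
  next
    fix z assume "z \<in> ?S"
    then obtain y x where z: "z = (y, x)" and y: "y \<in> ?Y" and inj: "inj_on (y(0 := 0)) {..<v}" and x: "x \<in> ?X y"
      by auto
    define g where "g = i z"
    have g: "g a = (if a < v then x + (y(0 := 0)) a else undefined)" for a
      by (simp add: g_def i_def z)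
    have g0: "g 0 = x" using v by (simp add: g)
    have "(\<lambda>a\<in>?I. g a - g 0) = y"
    proof
      fix a show "(\<lambda>a\<in>?I. g a - g 0) a = y a"
        unfolding g0 using y by (cases "a \<in> ?I") (auto simp: g PiE_iff extensional_def)
    qed
    then have "j g = (y, x)" by (simp only: j_def g0)
    then show "j (i z) = z" by (simp only: g_def z)
    have "inj_on g {..<v}"
    proof (rule inj_onI)
      fix a b assume "a \<in> {..<v}" "b \<in> {..<v}" "g a = g b"
      then have "(y(0 := 0)) a = (y(0 := 0)) b" by (simp only: g lessThan_iff if_True add_left_cancel)
      then show "a = b" using inj \<open>a \<in> {..<v}\<close> \<open>b \<in> {..<v}\<close> by (meson inj_onD)
    qed
    moreover have "g \<in> {..<v} \<rightarrow>\<^sub>E idx n" using x by (auto simp: g PiE_iff extensional_def)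
    ultimately show "i z \<in> inj_maps v (idx n)"
      by (simp add: g_def inj_maps_def)
  qed
  also have "\<dots> = (\<Sum>(y, x)\<in>(SIGMA y:?Y. ?X y). ?\<psi> y)"
    using finY fi by (intro sum.mono_neutral_cong_left finite_SigmaI) (auto split: if_splits)
  also have "\<dots> = (\<Sum>y\<in>?Y. \<Sum>x\<in>?X y. ?\<psi> y)"
    using finY fi by (intro sum.Sigma[symmetric]) auto
  finally show ?thesis by (simp add: mult.commute)
qed


text \<open>The source of the tolerance 1 in the domination hypotheses: rounding changes a
  difference by at most 1, and dividing by R >= 1 cannot enlarge this.\<close>

lemma floor_scaled_diff:
  assumes "1 \<le> (R :: real)"
  shows "\<bar>real_of_int (\<lfloor>R * x\<rfloor> - \<lfloor>R * y\<rfloor>) / R - (x - y)\<bar> \<le> 1"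
proof -
  have "\<bar>real_of_int (\<lfloor>R * x\<rfloor> - \<lfloor>R * y\<rfloor>) - (R * x - R * y)\<bar> \<le> 1"
    using floor_correct[of "R * x"] floor_correct[of "R * y"] by linarith
  then have "\<bar>(real_of_int (\<lfloor>R * x\<rfloor> - \<lfloor>R * y\<rfloor>) - (R * x - R * y)) / R\<bar> \<le> 1 / R"
    using assms by (simp add: abs_divide divide_right_mono)
  also have "\<dots> \<le> 1" using assms by simp
  finally show ?thesis using assms by (simp add: diff_divide_distrib)
qed

lemma floor_scaled_tendsto:
  assumes "filterlim R at_top sequentially"
  shows "(\<lambda>m. real_of_int \<lfloor>R m * x\<rfloor> / R m) \<longlonglongrightarrow> x"
proof -
  have Rpos: "eventually (\<lambda>m. R m > 0) sequentially"
    using assms by (simp add: filterlim_at_top_dense)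
  have lim0: "(\<lambda>m. 1 / R m) \<longlonglongrightarrow> 0"
    using tendsto_inverse_0_at_top[OF assms] by (simp add: inverse_eq_divide)
  have "(\<lambda>m. real_of_int \<lfloor>R m * x\<rfloor> / R m - x) \<longlonglongrightarrow> 0"
  proof (rule tendsto_0_le[OF lim0, where K = 1])
    show "\<forall>\<^sub>F m in sequentially. norm (real_of_int \<lfloor>R m * x\<rfloor> / R m - x) \<le> norm (1 / R m) * 1"
      using Rpos
    proof eventually_elim
      case (elim m)
      have "\<bar>real_of_int \<lfloor>R m * x\<rfloor> - R m * x\<bar> \<le> 1"
        using floor_correct[of "R m * x"] by linarith
      then have "\<bar>(real_of_int \<lfloor>R m * x\<rfloor> - R m * x) / R m\<bar> \<le> 1 / R m"
        using elim by (simp add: abs_divide divide_right_mono)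
      then show ?case using elim by (simp add: diff_divide_distrib)
    qed
  qed
  then show ?thesis by (simp add: LIM_zero_iff)
qed

lemma integrable_grown_product:
  fixes D :: "real \<Rightarrow> real"
  assumes v: "1 \<le> v" and E: "E \<subseteq> nsets {..<v} 2" and grown: "grown E 0 {..<v}"
    and D: "integrable lborel D" "\<And>x. 0 \<le> D x" "\<And>x. D x \<le> B" "\<And>x. D (- x) = D x"
  shows "integrable (lebPi {1..<v}) (\<lambda>u. \<Prod>e\<in>E. D (gap (u(0 := 0)) e))"
proof (rule integrableI_nonneg)
  let ?I = "{1..<v}"
  have V: "{..<v} = insert 0 ?I" using v by auto
  have finE: "finite E" using E by (rule finite_subset) (auto intro: finite_imp_finite_nsets)
  have [measurable]: "D \<in> borel_measurable borel" using D by auto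
  have gm: "(\<lambda>u. gap (u(0 := 0 :: real)) e) \<in> borel_measurable (lebPi ?I)" if "e \<in> E" for e
    using that E unfolding V by (intro gap_measurable) auto
  show "(\<lambda>u. \<Prod>e\<in>E. D (gap (u(0 := 0)) e)) \<in> borel_measurable (lebPi ?I)"
    by (intro borel_measurable_prod measurable_compose[OF gm]) auto
  have "(\<integral>\<^sup>+x. ennreal (D x) \<partial>lborel) < \<infinity>"
    using D(1,2) by (simp add: integrable_iff_bounded)
  then have "(\<integral>\<^sup>+u. (\<Prod>e\<in>E \<inter> nsets {..<v} 2. ennreal (D (gap (u(0 := 0)) e))) \<partial>lebPi ({..<v} - {0})) < \<infinity>"
    using D(3) by (intro grown_dominating_finite[OF grown finE, where B = "max 1 B"]) (auto simp: D(4) le_max_iff_disj)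
  moreover have "{..<v} - {0} = ?I" by auto
  moreover have "E \<inter> nsets {..<v} 2 = E" using E by auto
  ultimately show "(\<integral>\<^sup>+u. ennreal (\<Prod>e\<in>E. D (gap (u(0 := 0)) e)) \<partial>lebPi ?I) < \<infinity>"
    using D(2) by (simp add: prod_ennreal)
qed (auto intro!: prod_nonneg D)

text \<open>The root contributes the factor N and each of the other v - 1 vertices a factor R. After
  these are divided out, the sum is the integral of a step function dominated by the product of D
  over the edges, integrable because the graph is connected. Continuity of the H e gives pointwise
  convergence.\<close>

lemma riemann_sum_limit:
  fixes H :: "nat set \<Rightarrow> real \<Rightarrow> real" and D :: "real \<Rightarrow> real" and n :: "nat \<Rightarrow> nat" and R :: "nat \<Rightarrow> real"
  assumes v: "1 \<le> v" and E: "E \<noteq> {}" "E \<subseteq> nsets {..<v} 2" and grown: "grown E 0 {..<v}"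
    and H: "\<And>e. e \<in> E \<Longrightarrow> continuous_on UNIV (H e)"
    and dom: "\<And>e x y. e \<in> E \<Longrightarrow> \<bar>x - y\<bar> \<le> 1 \<Longrightarrow> \<bar>H e x\<bar> \<le> D y"
    and D: "integrable lborel D" "\<And>x. D x \<le> B" "\<And>x. D (- x) = D x"
    and R: "\<And>m. 1 \<le> R m" "filterlim R at_top sequentially" "(\<lambda>m. R m / size_of (n m)) \<longlonglongrightarrow> 0"
  shows "(\<lambda>m. (\<Sum>g\<in>inj_maps v (idx (n m)). \<Prod>e\<in>E. H e (real_of_int (gap g e) / R m)) /
      (size_of (n m) * R m ^ (v - 1)))
    \<longlonglongrightarrow> (LINT u|lebPi {1..<v}. (\<Prod>e\<in>E. H e (gap (u(0 := 0)) e)))"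
proof -
  let ?I = "{1..<v}"
  have V: "{..<v} = insert 0 ?I" using v by auto
  have finE: "finite E" using E(2) by (rule finite_subset) (auto intro: finite_imp_finite_nsets)
  have [measurable]: "D \<in> borel_measurable borel" using D by auto
  have D0: "0 \<le> D y" for y
  proof -
    obtain e where "e \<in> E" using E(1) by auto
    then show ?thesis using dom[of e y y] by linarith
  qed
  have Dabs: "D \<bar>y\<bar> = D y" for y using D(3)[of y] by (auto simp: abs_if)
  have pair: "\<exists>a b. e = {a, b} \<and> a < v \<and> b < v \<and> a \<noteq> b" if "e \<in> E" for e
    using that E by (auto elim!: nsets2_E[of e "{..<v}"] dest!: subsetD)
  let ?u0 = "\<lambda>u :: nat \<Rightarrow> real. u(0 := 0)"
  let ?y = "\<lambda>m u. \<lambda>i\<in>?I. \<lfloor>R m * u i\<rfloor>"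
  define \<Phi> where "\<Phi> m g = (\<Prod>e\<in>E. H e (real_of_int (gap g e) / R m))" for m and g :: "nat \<Rightarrow> int"
  \<comment> \<open>Besides the edge product, F contains the injectivity constraint and the
    proportion of admissible root positions; both tend to 1 for almost every u.\<close>
  define F where "F m y = (if inj_on (y(0 := 0)) {..<v} then \<Phi> m (y(0 := 0)) else 0) *
    (real (card {x\<in>idx (n m). \<forall>a\<in>?I. x + y a \<in> idx (n m)}) / size_of (n m))" for m y
  have N: "0 < size_of k" for k by (simp add: size_of_def)
  have y0: "((?y m u)(0 := 0)) a = \<lfloor>R m * ?u0 u a\<rfloor>" if "a < v" for m u a
    using that by auto
  have gap_y: "real_of_int (gap ((?y m u)(0 := 0)) e) / R m =
      \<bar>real_of_int (\<lfloor>R m * ?u0 u a\<rfloor> - \<lfloor>R m * ?u0 u b\<rfloor>) / R m\<bar>"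
    if "e = {a, b}" "a < v" "b < v" for m u e a b
    using R(1)[of m] unfolding that(1) gap_doubleton y0[OF that(2)] y0[OF that(3)] by (simp add: abs_divide)
  have supp: "y \<in> ?I \<rightarrow>\<^sub>E {- 2 * int (n m)..2 * int (n m)}" if "y \<in> extensional ?I" "F m y \<noteq> 0" for m y
  proof -
    have "card {x\<in>idx (n m). \<forall>a\<in>?I. x + y a \<in> idx (n m)} \<noteq> 0" using that(2) by (auto simp: F_def)
    then obtain x where "x \<in> idx (n m)" "\<forall>a\<in>?I. x + y a \<in> idx (n m)"
      by (metis (mono_tags, lifting) card.empty empty_Collect_eq)
    then show ?thesis using that(1) by (auto simp: PiE_iff idx_def)
  qed
  have Rpos: "0 < R m" for m using R(1)[of m] by simp
  have sum_eq: "(\<Sum>g\<in>inj_maps v (idx (n m)). \<Phi> m g) / (size_of (n m) * R m ^ (v - 1)) =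
      (LINT u|lebPi ?I. F m (?y m u))" for m
  proof -
    have "\<Phi> m g = \<Phi> m g'" if ex: "\<exists>x. \<forall>a<v. g a = x + g' a" for g g'
    proof -
      obtain x where x: "\<And>a. a < v \<Longrightarrow> g a = x + g' a" using ex by auto
      have "gap g e = gap g' e" if e: "e \<in> E" for e
      proof -
        obtain a b where "e = {a, b}" "a < v" "b < v" using pair[OF e] by auto
        then show ?thesis using x[of a] x[of b] by simp
      qed
      then show ?thesis by (simp add: \<Phi>_def)
    qed
    from sum_inj_maps_root[where n = "n m" and \<Phi> = "\<Phi> m", OF v this]
    have "(\<Sum>g\<in>inj_maps v (idx (n m)). \<Phi> m g) / size_of (n m) =
      (\<Sum>y\<in>?I \<rightarrow>\<^sub>E {- 2 * int (n m)..2 * int (n m)}. F m y)"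
      by (simp only: F_def sum_divide_distrib times_divide_eq_right)
    then show ?thesis
      using sum_as_integral(2)[of ?I "{- 2 * int (n m)..2 * int (n m)}" "R m" "F m", OF _ _ Rpos supp]
      by (simp flip: divide_divide_eq_left)
  qed
  have "(\<lambda>m. LINT u|lebPi ?I. F m (?y m u)) \<longlonglongrightarrow> (LINT u|lebPi ?I. (\<Prod>e\<in>E. H e (gap (?u0 u) e)))"
  proof (rule integral_dominated_convergence[where w = "\<lambda>u. \<Prod>e\<in>E. D (gap (?u0 u) e)"])
    have gm: "(\<lambda>u. gap (?u0 u) e) \<in> borel_measurable (lebPi ?I)" if "e \<in> E" for e
      using that E unfolding V by (intro gap_measurable) auto
    show "(\<lambda>u. \<Prod>e\<in>E. H e (gap (?u0 u) e)) \<in> borel_measurable (lebPi ?I)"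
      by (intro borel_measurable_prod measurable_compose[OF gm] borel_measurable_continuous_onI H)
    show "(\<lambda>u. F m (?y m u)) \<in> borel_measurable (lebPi ?I)" for m
      by (rule sum_as_integral(1)[of ?I "{- 2 * int (n m)..2 * int (n m)}" "R m" "F m", OF _ _ Rpos supp]) auto
    show "integrable (lebPi ?I) (\<lambda>u. \<Prod>e\<in>E. D (gap (?u0 u) e))"
      by (rule integrable_grown_product[OF v E(2) grown D(1) D0 D(2,3)])
    show "AE u in lebPi ?I. norm (F m (?y m u)) \<le> (\<Prod>e\<in>E. D (gap (?u0 u) e))" for m
    proof (intro AE_I2)
      fix u
      have "\<bar>\<Phi> m ((?y m u)(0 := 0))\<bar> \<le> (\<Prod>e\<in>E. D (gap (?u0 u) e))"
        unfolding \<Phi>_def abs_prod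
      proof (intro prod_mono conjI abs_ge_zero)
        fix e assume e: "e \<in> E"
        obtain a b where ab: "e = {a, b}" "a < v" "b < v" using pair[OF e] by auto
        have "\<bar>H e (real_of_int (gap ((?y m u)(0 := 0)) e) / R m)\<bar> \<le> D \<bar>?u0 u a - ?u0 u b\<bar>"
          unfolding gap_y[OF ab]
          using floor_scaled_diff[OF R(1)[of m], of "?u0 u a" "?u0 u b"] by (intro dom[OF e]) linarith
        then show "\<bar>H e (real_of_int (gap ((?y m u)(0 := 0)) e) / R m)\<bar> \<le> D (gap (?u0 u) e)"
          unfolding ab(1) gap_doubleton .
      qed
      moreover have "real (card {x\<in>idx (n m). \<forall>a\<in>?I. x + ?y m u a \<in> idx (n m)}) / size_of (n m) \<le> 1"
      proof -
        have "card {x\<in>idx (n m). \<forall>a\<in>?I. x + ?y m u a \<in> idx (n m)} \<le> card (idx (n m))"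
          by (intro card_mono) (auto simp: idx_def)
        then show ?thesis using N[of "n m"] by (simp flip: card_idx)
      qed
      moreover have "0 \<le> real (card {x\<in>idx (n m). \<forall>a\<in>?I. x + ?y m u a \<in> idx (n m)}) / size_of (n m)"
        using N[of "n m"] by simp
      moreover have "0 \<le> (\<Prod>e\<in>E. D (gap (?u0 u) e))" by (intro prod_nonneg D0)
      ultimately show "norm (F m (?y m u)) \<le> (\<Prod>e\<in>E. D (gap (?u0 u) e))"
        unfolding F_def real_norm_def abs_mult
        by (intro order_trans[OF mult_right_le_one_le]) auto
    qed
    \<comment> \<open>Distinct real coordinates have distinct rounded values once R m is large, so
      for almost every u the constraint in F is eventually satisfied.\<close>
    have "AE u in lebPi ?I. inj_on (?u0 u) {..<v}"
      unfolding V by (rule AE_lebPi_inj) auto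
    then show "AE u in lebPi ?I. (\<lambda>m. F m (?y m u)) \<longlonglongrightarrow> (\<Prod>e\<in>E. H e (gap (?u0 u) e))"
    proof (rule AE_mp, intro AE_I2 impI)
      fix u assume inj: "inj_on (?u0 u) {..<v}"
      have dlim: "(\<lambda>m. real_of_int (\<lfloor>R m * x\<rfloor> - \<lfloor>R m * y\<rfloor>) / R m) \<longlonglongrightarrow> x - y" for x y
        using tendsto_diff[OF floor_scaled_tendsto[OF R(2), of x] floor_scaled_tendsto[OF R(2), of y]]
        by (simp add: diff_divide_distrib)
      have "\<forall>\<^sub>F m in sequentially. a \<noteq> b \<longrightarrow> \<lfloor>R m * ?u0 u a\<rfloor> \<noteq> \<lfloor>R m * ?u0 u b\<rfloor>"
        if ab: "a \<in> {..<v}" "b \<in> {..<v}" for a b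
      proof (cases "a = b")
        case False
        then have "?u0 u a - ?u0 u b \<noteq> 0" using inj ab by (meson eq_iff_diff_eq_0 inj_onD)
        from tendsto_imp_eventually_ne[OF dlim this]
        show ?thesis by eventually_elim (auto simp del: fun_upd_apply)
      qed simp
      then have "\<forall>\<^sub>F m in sequentially. \<forall>a\<in>{..<v}. \<forall>b\<in>{..<v}. a \<noteq> b \<longrightarrow> \<lfloor>R m * ?u0 u a\<rfloor> \<noteq> \<lfloor>R m * ?u0 u b\<rfloor>"
        by (simp only: eventually_ball_finite_distrib[OF finite_lessThan]) blast
      then have ev: "\<forall>\<^sub>F m in sequentially. inj_on ((?y m u)(0 := 0)) {..<v}"
      proof eventually_elim
        case (elim m)
        show ?case
        proof (rule inj_onI)
          fix a b assume ab: "a \<in> {..<v}" "b \<in> {..<v}" and eq: "((?y m u)(0 := 0)) a = ((?y m u)(0 := 0)) b"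
          then show "a = b" using elim y0[of a m u] y0[of b m u] by (metis lessThan_iff)
        qed
      qed
      have \<Phi>_lim: "(\<lambda>m. \<Phi> m ((?y m u)(0 := 0))) \<longlonglongrightarrow> (\<Prod>e\<in>E. H e (gap (?u0 u) e))"
        unfolding \<Phi>_def
      proof (rule tendsto_prod)
        fix e assume e: "e \<in> E"
        obtain a b where ab: "e = {a, b}" "a < v" "b < v" using pair[OF e] by auto
        have "isCont (H e) \<bar>?u0 u a - ?u0 u b\<bar>"
          using H[OF e] by (simp add: continuous_on_eq_continuous_at)
        then have "(\<lambda>m. H e \<bar>real_of_int (\<lfloor>R m * ?u0 u a\<rfloor> - \<lfloor>R m * ?u0 u b\<rfloor>) / R m\<bar>)
            \<longlonglongrightarrow> H e \<bar>?u0 u a - ?u0 u b\<bar>"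
          by (rule isCont_tendsto_compose) (intro tendsto_rabs dlim)
        moreover have "\<bar>?u0 u a - ?u0 u b\<bar> = gap (?u0 u) e" unfolding ab(1) gap_doubleton ..
        ultimately show "(\<lambda>m. H e (real_of_int (gap ((?y m u)(0 := 0)) e) / R m)) \<longlonglongrightarrow> H e (gap (?u0 u) e)"
          unfolding gap_y[OF ab] by simp
      qed
      \<comment> \<open>The offsets grow like R m while R m / N tends to 0, so asymptotically every
        root position is admissible.\<close>
      have card_lim: "(\<lambda>m. real (card {x\<in>idx (n m). \<forall>a\<in>?I. x + ?y m u a \<in> idx (n m)}) / size_of (n m)) \<longlonglongrightarrow> 1"
      proof -
        have l1: "(\<lambda>m. (\<Sum>a\<in>?I. \<bar>real_of_int \<lfloor>R m * u a\<rfloor> / R m\<bar>) * (R m / size_of (n m))) \<longlonglongrightarrow> (\<Sum>a\<in>?I. \<bar>u a\<bar>) * 0"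
          by (intro tendsto_mult tendsto_sum tendsto_rabs floor_scaled_tendsto R)
        have l2: "(\<Sum>a\<in>?I. \<bar>real_of_int \<lfloor>R m * u a\<rfloor> / R m\<bar>) * (R m / size_of (n m)) =
            (\<Sum>a\<in>?I. \<bar>real_of_int (?y m u a)\<bar>) / size_of (n m)" for m
          using Rpos[of m] by (simp add: sum_distrib_right sum_divide_distrib abs_divide)
        have lim: "(\<lambda>m. (\<Sum>a\<in>?I. \<bar>real_of_int (?y m u a)\<bar>) / size_of (n m)) \<longlonglongrightarrow> 0"
          using l1 unfolding l2 mult_zero_right .
        have "(\<lambda>m. real (card {x\<in>idx (n m). \<forall>a\<in>?I. x + ?y m u a \<in> idx (n m)}) / size_of (n m) - 1) \<longlonglongrightarrow> 0"
        proof (rule tendsto_0_le[OF lim, where K = 1], intro always_eventually allI)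
          fix m
          show "norm (real (card {x\<in>idx (n m). \<forall>a\<in>?I. x + ?y m u a \<in> idx (n m)}) / size_of (n m) - 1)
            \<le> norm ((\<Sum>a\<in>?I. \<bar>real_of_int (?y m u a)\<bar>) / size_of (n m)) * 1"
            using order_trans[OF card_shift_in[of ?I "n m" "?y m u", OF finite_atLeastLessThan] abs_ge_self]
            by (simp only: real_norm_def mult_1_right)
        qed
        then show ?thesis by (simp only: LIM_zero_iff)
      qed
      have "(\<lambda>m. \<Phi> m ((?y m u)(0 := 0)) * (real (card {x\<in>idx (n m). \<forall>a\<in>?I. x + ?y m u a \<in> idx (n m)}) / size_of (n m)))
          \<longlonglongrightarrow> (\<Prod>e\<in>E. H e (gap (?u0 u) e)) * 1"
        by (rule tendsto_mult[OF \<Phi>_lim card_lim])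
      then show "(\<lambda>m. F m (?y m u)) \<longlonglongrightarrow> (\<Prod>e\<in>E. H e (gap (?u0 u) e))"
        unfolding mult_1_right
        by (rule Lim_transform_eventually) (use ev in \<open>eventually_elim, simp only: F_def if_True\<close>)
    qed
  qed
  then show ?thesis unfolding sum_eq[symmetric] \<Phi>_def .
qed

subsection \<open>Asymptotics of the cumulants\<close>

text \<open>\<open>gam k s\<close> is the upper incomplete gamma integral of \<open>(1 + t) ^ k * exp (- t)\<close> over \<open>t \<ge> s\<close>:
  unlike its integrand it decreases in \<open>s\<close>, and it is still integrable when \<open>s = (\<psi> x)\<^sup>2\<close>.\<close>

primrec gam :: "nat \<Rightarrow> real \<Rightarrow> real" where
  "gam 0 s = exp (- s)"
| "gam (Suc k) s = (1 + s) ^ Suc k * exp (- s) + real (Suc k) * gam k s"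

lemma gam_ge: "0 \<le> s \<Longrightarrow> (1 + s) ^ k * exp (- s) \<le> gam k s"
proof (induction k)
  case (Suc k)
  have "0 \<le> (1 + s) ^ k * exp (- s)" using Suc.prems by simp
  also have "\<dots> \<le> gam k s" by (rule Suc.IH[OF Suc.prems])
  finally show ?case by simp
qed simp

lemma gam_nonneg: "0 \<le> s \<Longrightarrow> 0 \<le> gam k s"
  by (rule order_trans[OF _ gam_ge]) auto

text \<open>Integration by parts read backwards: differentiating (1 + s)^(k+1) exp (-s) also
  produces (k+1) (1 + s)^k exp (-s), which the recursive summand cancels.\<close>

lemma gam_has_derivative: "(gam k has_real_derivative - ((1 + s) ^ k * exp (- s))) (at s)"
proof (induction k)
  case 0
  have "gam 0 = (\<lambda>s. exp (- s))" by auto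
  then show ?case by (auto intro!: derivative_eq_intros)
next
  case (Suc k)
  have "gam (Suc k) = (\<lambda>s. (1 + s) ^ Suc k * exp (- s) + real (Suc k) * gam k s)" by auto
  moreover have "((\<lambda>s. (1 + s) ^ Suc k * exp (- s)) has_real_derivative
      (real (Suc k) * (1 + s) ^ k * exp (- s) - (1 + s) ^ Suc k * exp (- s))) (at s)"
    by (rule derivative_eq_intros refl)+ (simp add: algebra_simps)
  then have "((\<lambda>s. (1 + s) ^ Suc k * exp (- s) + real (Suc k) * gam k s) has_real_derivative
      (real (Suc k) * (1 + s) ^ k * exp (- s) - (1 + s) ^ Suc k * exp (- s)) +
      real (Suc k) * (- ((1 + s) ^ k * exp (- s)))) (at s)"
    by (intro DERIV_add DERIV_cmult Suc)
  ultimately show ?case by (simp only:) (simp add: algebra_simps)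
qed

lemma gam_antimono:
  assumes "0 \<le> s" "s \<le> t"
  shows "gam k t \<le> gam k s"
  using assms(2)
proof (rule DERIV_nonpos_imp_nonincreasing)
  fix x assume "s \<le> x" "x \<le> t"
  then have "- ((1 + x) ^ k * exp (- x)) \<le> 0" using assms(1) by simp
  then show "\<exists>y. (gam k has_real_derivative y) (at x) \<and> y \<le> 0" using gam_has_derivative by blast
qed

section \<open>Dominating functions for the edge factors\<close>

context
  fixes \<psi> :: "real \<Rightarrow> real" and \<alpha> :: real
  assumes even: "\<And>x. \<psi> (- x) = \<psi> x"
    and cont: "continuous_on UNIV \<psi>"
    and pos: "\<And>x. 0 < \<psi> x"
    and mono: "mono_on {0..} \<psi>"
    and intm: "\<And>m::nat. integrable lborel (\<lambda>s. (1 + (\<psi> s)\<^sup>2) ^ m * exp (- (\<psi> s)\<^sup>2))"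
    and alpha: "0 \<le> \<alpha>" "\<alpha> \<le> 1"
begin

private lemma sq_mono: "\<bar>x\<bar> \<le> \<bar>y\<bar> \<Longrightarrow> (\<psi> x)\<^sup>2 \<le> (\<psi> y)\<^sup>2"
proof -
  assume "\<bar>x\<bar> \<le> \<bar>y\<bar>"
  moreover have "\<psi> \<bar>z\<bar> = \<psi> z" for z using even[of z] by (auto simp: abs_if)
  ultimately have "\<psi> x \<le> \<psi> y" using mono_onD[OF mono, of "\<bar>x\<bar>" "\<bar>y\<bar>"] by simp
  then show ?thesis using pos[of x] by (intro power_mono) auto
qed

private definition dom :: "nat \<Rightarrow> real \<Rightarrow> real" where
  "dom k x = gam k ((\<psi> x)\<^sup>2)"

private lemma dom_antimono: "\<bar>x\<bar> \<le> \<bar>y\<bar> \<Longrightarrow> dom k y \<le> dom k x"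
  unfolding dom_def by (intro gam_antimono sq_mono) auto

private lemma dom_nonneg: "0 \<le> dom k x"
  unfolding dom_def by (rule gam_nonneg) simp

private lemma dom_integrable: "integrable lborel (dom k)"
proof (induction k)
  case 0
  show ?case using intm[of 0] by (simp add: dom_def[abs_def])
next
  case (Suc k)
  then show ?case
    using intm[of "Suc k"] by (simp add: dom_def[abs_def])
qed

private lemma h_fun_facts:
  shows h_cont: "continuous_on UNIV (h_fun \<psi> \<alpha> j)"
    and h_nonneg: "0 \<le> h_fun \<psi> \<alpha> j x"
    and h_even: "h_fun \<psi> \<alpha> j (- x) = h_fun \<psi> \<alpha> j x"
    and h_le_dom: "j \<le> k \<Longrightarrow> h_fun \<psi> \<alpha> j x \<le> dom k x"
proof -
  have "h_fun \<psi> \<alpha> j = (\<lambda>x. (1 + \<alpha> * (\<psi> x)\<^sup>2) ^ j * exp (- (\<psi> x)\<^sup>2))"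
    by (rule ext) (simp add: h_fun_def)
  then show "continuous_on UNIV (h_fun \<psi> \<alpha> j)"
    by (auto intro!: continuous_intros cont)
  have w: "0 \<le> 1 + \<alpha> * (\<psi> x)\<^sup>2" "1 + \<alpha> * (\<psi> x)\<^sup>2 \<le> 1 + (\<psi> x)\<^sup>2"
    using alpha by (auto intro: mult_left_le_one_le add_nonneg_nonneg)
  then show "0 \<le> h_fun \<psi> \<alpha> j x" by (simp add: h_fun_def)
  show "h_fun \<psi> \<alpha> j (- x) = h_fun \<psi> \<alpha> j x" by (simp add: h_fun_def even)
  assume "j \<le> k"
  have "(1 + \<alpha> * (\<psi> x)\<^sup>2) ^ j \<le> (1 + (\<psi> x)\<^sup>2) ^ j" using w by (intro power_mono) auto
  also have "\<dots> \<le> (1 + (\<psi> x)\<^sup>2) ^ k" using \<open>j \<le> k\<close> by (intro power_increasing) auto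
  finally have "h_fun \<psi> \<alpha> j x \<le> (1 + (\<psi> x)\<^sup>2) ^ k * exp (- (\<psi> x)\<^sup>2)"
    by (simp add: h_fun_def)
  also have "\<dots> \<le> dom k x" unfolding dom_def by (rule gam_ge) simp
  finally show "h_fun \<psi> \<alpha> j x \<le> dom k x" .
qed

private lemma h_integrable: "integrable lborel (h_fun \<psi> \<alpha> j)"
proof (rule Bochner_Integration.integrable_bound[OF dom_integrable[of j]])
  show "h_fun \<psi> \<alpha> j \<in> borel_measurable lborel"
    using borel_measurable_continuous_onI[OF h_cont] by simp
  show "AE x in lborel. norm (h_fun \<psi> \<alpha> j x) \<le> norm (dom j x)"
    using h_nonneg h_le_dom[OF order_refl] by (simp add: dom_nonneg)
qed

private lemma h_bounded: "\<bar>h_fun \<psi> \<alpha> j x\<bar> \<le> dom j 0"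
  using h_nonneg h_le_dom[OF order_refl, of j x] dom_antimono[of 0 x j] by simp

text \<open>Majorises \<open>dom\<close> on the whole interval of radius 1 around y. For |y| > 1 the
  point of that interval nearest the origin is y - 1 or y + 1, where the monotone \<open>dom\<close>
  is largest; for |y| <= 1 its maximal value \<open>dom k 0\<close> is used. Summing the three terms
  keeps the function even and integrable.\<close>

private definition Dom :: "nat \<Rightarrow> real \<Rightarrow> real" where
  "Dom k y = dom k 0 * indicator {-1..1} y + dom k (y - 1) + dom k (y + 1)"

private lemma Dom_facts:
  shows Dom_integrable: "integrable lborel (Dom k)"
    and Dom_le: "Dom k y \<le> 3 * dom k 0"
    and Dom_even: "Dom k (- y) = Dom k y"
    and Dom_nonneg: "0 \<le> Dom k y"
    and dom_le_Dom: "\<bar>x - y\<bar> \<le> 1 \<Longrightarrow> dom k x \<le> Dom k y"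
proof -
  have "integrable lborel (\<lambda>y. dom k (y + c))" for c
    using lborel_integrable_real_affine[OF dom_integrable, of 1 k c] by (simp add: add.commute)
  from this[of 1] this[of "- 1"] show "integrable lborel (Dom k)"
    by (auto simp: Dom_def[abs_def] intro!: Bochner_Integration.integrable_add integrable_mult_right)
  have le0: "dom k x \<le> dom k 0" for x by (rule dom_antimono) simp
  have "dom k 0 * indicator {-1..1} y \<le> dom k 0"
    using dom_nonneg by (auto simp: indicator_def)
  then show "Dom k y \<le> 3 * dom k 0" using le0[of "y - 1"] le0[of "y + 1"] by (simp add: Dom_def)
  have ev: "dom k (- x) = dom k x" for x by (simp add: dom_def even)
  have ind: "indicator {-1..1} (- y) = (indicator {-1..1} y :: real)" by (auto simp: indicator_def)
  have "dom k (- y - 1) = dom k (y + 1)" "dom k (- y + 1) = dom k (y - 1)"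
  proof -
    have "- y - 1 = - (y + 1)" "- y + 1 = - (y - 1)" by simp_all
    then show "dom k (- y - 1) = dom k (y + 1)" "dom k (- y + 1) = dom k (y - 1)" by (simp_all only: ev)
  qed
  then show "Dom k (- y) = Dom k y" unfolding Dom_def ind by simp
  show nn: "0 \<le> Dom k y" by (auto simp: Dom_def intro!: add_nonneg_nonneg mult_nonneg_nonneg dom_nonneg)
  assume xy: "\<bar>x - y\<bar> \<le> 1"
  consider "\<bar>y\<bar> \<le> 1" | "y > 1" | "y < -1" by linarith
  then show "dom k x \<le> Dom k y"
  proof cases
    case 1
    then have "indicator {-1..1} y = (1 :: real)" by (auto simp: indicator_def)
    then show ?thesis
      using le0[of x] dom_nonneg[of k "y - 1"] dom_nonneg[of k "y + 1"] by (simp add: Dom_def)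
  next
    case 2
    then have "dom k x \<le> dom k (y - 1)" using xy by (intro dom_antimono) linarith
    then show ?thesis using dom_nonneg[of k 0] dom_nonneg[of k "y + 1"] by (auto simp: Dom_def indicator_def)
  next
    case 3
    then have "dom k x \<le> dom k (y + 1)" using xy by (intro dom_antimono) linarith
    then show ?thesis using dom_nonneg[of k 0] dom_nonneg[of k "y - 1"] by (auto simp: Dom_def indicator_def)
  qed
qed

section \<open>Scaling and limit of the contribution of one pattern\<close>

private lemma pattern_facts:
  assumes \<tau>: "\<tau> \<in> patterns k v" and k: "k \<ge> 1"
  shows pattern_v: "3 \<le> v" "v \<le> k + 2"
    and pattern_edges: "edges \<tau> {..<k} \<noteq> {}" "edges \<tau> {..<k} \<subseteq> nsets {..<v} 2" "2 * v \<le> card (edges \<tau> {..<k}) + 3"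
    and pattern_grown: "grown (edges \<tau> {..<k}) 0 {..<v}"
proof -
  have sub: "\<tau> i \<subseteq> {..<v}" and c3: "card (\<tau> i) = 3" if "i \<in> {..<k}" for i
    using \<tau> that by (auto simp: patterns_def nsets_def PiE_iff)
  have un: "(\<Union>i\<in>{..<k}. \<tau> i) = {..<v}" and linked: "linked \<tau> {..<k}"
    using \<tau> by (auto simp: patterns_def)
  have 0: "0 \<in> {..<k}" using k by simp
  show v3: "3 \<le> v" using card_mono[OF _ sub[OF 0]] c3[OF 0] by simp
  have "2 * card (\<Union>i\<in>{..<k}. \<tau> i) \<le> card (edges \<tau> {..<k}) + 3 \<and> card (\<Union>i\<in>{..<k}. \<tau> i) \<le> card {..<k} + 2"
    using 0 by (intro linked_card linked c3) auto
  then show ev: "2 * v \<le> card (edges \<tau> {..<k}) + 3" and "v \<le> k + 2" unfolding un by simp_all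
  show "edges \<tau> {..<k} \<noteq> {}" using ev v3 by auto
  show "edges \<tau> {..<k} \<subseteq> nsets {..<v} 2"
    using sub by (auto simp: edges_def nsets_def)
  show "grown (edges \<tau> {..<k}) 0 {..<v}"
    using linked_grown[OF finite_lessThan linked c3, of 0] un v3 by simp
qed

private definition graph_integral :: "nat \<Rightarrow> nat \<Rightarrow> (nat \<Rightarrow> nat set) \<Rightarrow> real" where
  "graph_integral k v \<tau> = (LINT u|lebPi {1..<v}. (\<Prod>e\<in>edges \<tau> {..<k}. h_fun \<psi> \<alpha> (mult_edge \<tau> k e) (gap (u(0 := 0)) e)))"

private definition graph_sum :: "nat \<Rightarrow> nat \<Rightarrow> (nat \<Rightarrow> nat set) \<Rightarrow> nat \<Rightarrow> real \<Rightarrow> real" where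
  "graph_sum k v \<tau> n R = (\<Sum>g\<in>inj_maps v (idx n). \<Prod>e\<in>edges \<tau> {..<k}.
     h_fun \<psi> \<alpha> (mult_edge \<tau> k e) (real_of_int (gap g e) / R)) / (size_of n * R ^ (v - 1))"

private lemma mult_edge_le: "mult_edge \<tau> k e \<le> k"
  unfolding mult_edge_def using card_mono[of "{..<k}" "{i\<in>{..<k}. e \<in> nsets (\<tau> i) 2}"] by auto

private lemma graph_sum_limit:
  assumes \<tau>: "\<tau> \<in> patterns k v" and k: "k \<ge> 1"
    and R: "filterlim R at_top sequentially" "(\<lambda>m. R m / size_of (n m)) \<longlonglongrightarrow> 0"
  shows "(\<lambda>m. graph_sum k v \<tau> (n m) (R m)) \<longlonglongrightarrow> graph_integral k v \<tau>"
proof -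
  \<comment> \<open>\<open>riemann_sum_limit\<close> needs R >= 1 for every index; this modification
    changes only finitely many terms.\<close>
  let ?R = "\<lambda>m. max 1 (R m)"
  have ev: "\<forall>\<^sub>F m in sequentially. ?R m = R m"
  proof -
    have "\<forall>\<^sub>F m in sequentially. 1 \<le> R m" using R(1) by (simp add: filterlim_at_top)
    then show ?thesis by eventually_elim (simp add: max_def)
  qed
  have R': "filterlim ?R at_top sequentially" "(\<lambda>m. ?R m / size_of (n m)) \<longlonglongrightarrow> 0"
  proof -
    show "filterlim ?R at_top sequentially"
      by (rule filterlim_at_top_mono[OF R(1)]) (auto intro: always_eventually)
    show "(\<lambda>m. ?R m / size_of (n m)) \<longlonglongrightarrow> 0"
      by (rule Lim_transform_eventually[OF R(2)]) (use ev in \<open>eventually_elim, simp\<close>)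
  qed
  have v1: "1 \<le> v" using pattern_v[OF \<tau> k] by simp
  have "(\<lambda>m. graph_sum k v \<tau> (n m) (?R m)) \<longlonglongrightarrow> graph_integral k v \<tau>"
    unfolding graph_sum_def graph_integral_def
  proof (rule riemann_sum_limit[OF v1 pattern_edges(1,2)[OF \<tau> k] pattern_grown[OF \<tau> k] h_cont _
        Dom_integrable[of k] Dom_le Dom_even _ R'])
    fix e x and y :: real assume "\<bar>x - y\<bar> \<le> 1"
    then show "\<bar>h_fun \<psi> \<alpha> (mult_edge \<tau> k e) x\<bar> \<le> Dom k y"
      using h_nonneg h_le_dom[OF mult_edge_le] dom_le_Dom by (metis abs_of_nonneg order_trans)
  qed simp
  then show ?thesis
    by (rule Lim_transform_eventually) (use ev in \<open>eventually_elim, simp\<close>)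
qed

text \<open>With x = c / N, v = w + 3 and e = 2w + 3 + f both sides equal x^(2w+3+f) N R^(w+2). The
  hypotheses on v and e ensure that no subtraction on natural numbers is truncated.\<close>

private lemma scaling_identity:
  fixes c R N :: real
  assumes "0 < N" "3 \<le> v" "2 * v \<le> e + 3"
  shows "(c / N) ^ e * (N * R ^ (v - 1)) = c * R * (c\<^sup>2 * R / N\<^sup>2) ^ (v - 2) * (c / N) ^ (e + 3 - 2 * v)"
proof -
  obtain w where w: "v = w + 3" using assms(2) by (metis le_add_diff_inverse2)
  obtain f where f: "e = w + w + 3 + f" using assms(3) w by (auto simp: le_iff_add)
  define x where "x = c / N"
  have c: "c = x * N" and \<rho>: "c\<^sup>2 * R / N\<^sup>2 = x * x * R"
    using assms(1) by (simp_all add: x_def power2_eq_square)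
  have "e + 3 - 2 * v = f" "v - 1 = w + 2" "v - 2 = w + 1" using w f by simp_all
  then show ?thesis
    unfolding x_def[symmetric] \<rho> unfolding c
    by (simp add: f power_add power_mult power_mult_distrib power2_eq_square power3_eq_cube mult_ac)
qed

private lemma sum_linked_joint_moment:
  assumes k: "k \<ge> 1" and R: "0 < R"
  shows "(\<Sum>T\<in>{T\<in>{..<k} \<rightarrow>\<^sub>E nsets (idx n) 3. linked T {..<k}}. joint_moment \<psi> \<alpha> n c R T {..<k}) =
    (\<Sum>v\<le>k+2. 1 / fact v * (\<Sum>\<tau>\<in>patterns k v. 6 ^ k *
      (c * R * (c\<^sup>2 * R / (size_of n)\<^sup>2) ^ (v - 2) * (c / size_of n) ^ (card (edges \<tau> {..<k}) + 3 - 2 * v) *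
        graph_sum k v \<tau> n R)))"
proof -
  have fi: "finite (idx n)" by (simp add: idx_def)
  have N: "0 < size_of n" by (simp add: size_of_def)
  show ?thesis
    unfolding sum_linked_patterns[OF fi k]
  proof (intro sum.cong arg_cong[where f = "(*) _"] refl)
    fix v \<tau> assume \<tau>: "\<tau> \<in> patterns k v"
    let ?e = "card (edges \<tau> {..<k})"
    have "(\<Sum>g\<in>inj_maps v (idx n). joint_moment \<psi> \<alpha> n c R (\<lambda>i\<in>{..<k}. g ` \<tau> i) {..<k}) =
        6 ^ k * ((c / size_of n) ^ ?e * (size_of n * R ^ (v - 1)) * graph_sum k v \<tau> n R)"
    proof -
      have "(\<Sum>g\<in>inj_maps v (idx n). joint_moment \<psi> \<alpha> n c R (\<lambda>i\<in>{..<k}. g ` \<tau> i) {..<k}) =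
          6 ^ k * (c / size_of n) ^ ?e * (\<Sum>g\<in>inj_maps v (idx n). \<Prod>e\<in>edges \<tau> {..<k}.
            h_fun \<psi> \<alpha> (mult_edge \<tau> k e) (real_of_int (gap g e) / R))"
        unfolding sum_distrib_left by (intro sum.cong refl joint_moment_pattern[OF \<tau>])
      then show ?thesis using N R by (simp add: graph_sum_def)
    qed
    also note scaling_identity[OF N pattern_v(1)[OF \<tau> k] pattern_edges(3)[OF \<tau> k]]
    finally show "(\<Sum>g\<in>inj_maps v (idx n). joint_moment \<psi> \<alpha> n c R (\<lambda>i\<in>{..<k}. g ` \<tau> i) {..<k}) =
      6 ^ k * (c * R * (c\<^sup>2 * R / (size_of n)\<^sup>2) ^ (v - 2) * (c / size_of n) ^ (?e + 3 - 2 * v) *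
        graph_sum k v \<tau> n R)" .
  qed
qed

text \<open>\<open>A v\<close> stands for the limit of the normalised factor c R \<rho>^(v-2). The
  limit of (c / N)^(e+3-2v) is written as a power of 0: since 0 ^ 0 = 1, it acts as the indicator of
  e + 3 = 2v.\<close>

definition cumulant_limit :: "nat \<Rightarrow> (nat \<Rightarrow> real) \<Rightarrow> real" where
  "cumulant_limit k A = (\<Sum>v\<le>k+2. 1 / fact v * (\<Sum>\<tau>\<in>patterns k v.
     6 ^ k * (A v * 0 ^ (card (edges \<tau> {..<k}) + 3 - 2 * v) * graph_integral k v \<tau>)))"

text \<open>All three regimes are instances, differing only in the normalisation q and the limits A.
  The sum of joint moments over linked tuples converges term by term after normalisation; the error
  is at most C c / N times that convergent quantity in absolute value, hence tends to 0.\<close>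

lemma scaled_cumulant_limit:
  fixes n :: "nat \<Rightarrow> nat" and c R q :: "nat \<Rightarrow> real" and M :: "nat \<Rightarrow> 'w measure"
  assumes k: "k \<ge> 1"
    and lim: "limit_transition n c R"
    and fam: "\<And>m. edge_family \<psi> (n m) (c m) (R m) (M m) (a m)"
    and A: "\<And>v. 3 \<le> v \<Longrightarrow> v \<le> k + 2 \<Longrightarrow>
      (\<lambda>m. q m * (c m * R m * ((c m)\<^sup>2 * R m / (size_of (n m))\<^sup>2) ^ (v - 2))) \<longlonglongrightarrow> A v"
  shows "(\<lambda>m. q m * cumulant k (M m) (X3 \<psi> \<alpha> (n m) (R m) (a m))) \<longlonglongrightarrow> cumulant_limit k A"
proof -
  have c: "\<And>m. 0 < c m" "\<And>m. c m \<le> size_of (n m)" and Rpos: "\<And>m. 0 < R m"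
    and Rinf: "filterlim R at_top sequentially"
    using lim by (auto simp: limit_transition_def)
  have RN: "(\<lambda>m. R m / size_of (n m)) \<longlonglongrightarrow> 0" and \<delta>: "(\<lambda>m. c m / size_of (n m)) \<longlonglongrightarrow> 0"
    using lim by (auto simp: limit_transition_def dest: smalloD_tendsto)
  define S where "S m = (\<Sum>T\<in>{T\<in>{..<k} \<rightarrow>\<^sub>E nsets (idx (n m)) 3. linked T {..<k}}.
    joint_moment \<psi> \<alpha> (n m) (c m) (R m) T {..<k})" for m
  let ?\<rho> = "\<lambda>m. (c m)\<^sup>2 * R m / (size_of (n m))\<^sup>2"
  have "(\<lambda>m. \<Sum>v\<le>k+2. 1 / fact v * (\<Sum>\<tau>\<in>patterns k v. 6 ^ k *
      (q m * (c m * R m * ?\<rho> m ^ (v - 2)) * (c m / size_of (n m)) ^ (card (edges \<tau> {..<k}) + 3 - 2 * v) *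
        graph_sum k v \<tau> (n m) (R m)))) \<longlonglongrightarrow> cumulant_limit k A"
    unfolding cumulant_limit_def
  proof (intro tendsto_sum tendsto_mult tendsto_const)
    fix v \<tau> assume "\<tau> \<in> patterns k v"
    note \<tau> = this k
    show "(\<lambda>m. q m * (c m * R m * ?\<rho> m ^ (v - 2))) \<longlonglongrightarrow> A v"
      by (rule A[OF pattern_v[OF \<tau>]])
    show "(\<lambda>m. (c m / size_of (n m)) ^ (card (edges \<tau> {..<k}) + 3 - 2 * v)) \<longlonglongrightarrow> 0 ^ (card (edges \<tau> {..<k}) + 3 - 2 * v)"
      by (intro tendsto_power \<delta>)
    show "(\<lambda>m. graph_sum k v \<tau> (n m) (R m)) \<longlonglongrightarrow> graph_integral k v \<tau>"
      by (rule graph_sum_limit[OF \<tau> Rinf RN])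
  qed
  moreover have "(\<Sum>v\<le>k+2. 1 / fact v * (\<Sum>\<tau>\<in>patterns k v. 6 ^ k *
      (q m * (c m * R m * ?\<rho> m ^ (v - 2)) * (c m / size_of (n m)) ^ (card (edges \<tau> {..<k}) + 3 - 2 * v) *
        graph_sum k v \<tau> (n m) (R m)))) = q m * S m" for m
    unfolding S_def sum_linked_joint_moment[OF k Rpos] sum_distrib_left
    by (simp only: mult_ac)
  ultimately have qS: "(\<lambda>m. q m * S m) \<longlonglongrightarrow> cumulant_limit k A" by simp
  show ?thesis
  proof (rule cumulant_bound_linked[OF k])
    fix C assume C: "C \<ge> 0" and bound: "\<And>\<psi> \<alpha> n c R. 0 \<le> \<alpha> \<Longrightarrow> 0 < c \<Longrightarrow> c \<le> size_of n \<Longrightarrow>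
     \<bar>(\<Sum>T\<in>{..<k} \<rightarrow>\<^sub>E nsets (idx n) 3. set_cumulant (joint_moment \<psi> \<alpha> n c R T) {..<k})
       - (\<Sum>T\<in>{T\<in>{..<k} \<rightarrow>\<^sub>E nsets (idx n) 3. linked T {..<k}}. joint_moment \<psi> \<alpha> n c R T {..<k})\<bar>
     \<le> C * (c / size_of n) *
       (\<Sum>T\<in>{T\<in>{..<k} \<rightarrow>\<^sub>E nsets (idx n) 3. linked T {..<k}}. joint_moment \<psi> \<alpha> n c R T {..<k})"
    have diff: "\<bar>cumulant k (M m) (X3 \<psi> \<alpha> (n m) (R m) (a m)) - S m\<bar> \<le> C * (c m / size_of (n m)) * S m" for m
      unfolding cumulant_X3(1)[OF even fam k] S_def by (rule bound[OF alpha(1) c])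
    have "(\<lambda>m. q m * cumulant k (M m) (X3 \<psi> \<alpha> (n m) (R m) (a m)) - q m * S m) \<longlonglongrightarrow> 0"
    proof (rule tendsto_0_le[where K = 1])
      show "(\<lambda>m. C * (c m / size_of (n m)) * (q m * S m)) \<longlonglongrightarrow> 0"
        using tendsto_mult[OF tendsto_mult[OF tendsto_const[of C] \<delta>] qS] by simp
      show "\<forall>\<^sub>F m in sequentially. norm (q m * cumulant k (M m) (X3 \<psi> \<alpha> (n m) (R m) (a m)) - q m * S m)
          \<le> norm (C * (c m / size_of (n m)) * (q m * S m)) * 1"
      proof (intro always_eventually allI)
        fix m
        have "\<bar>q m * cumulant k (M m) (X3 \<psi> \<alpha> (n m) (R m) (a m)) - q m * S m\<bar> =
            \<bar>q m\<bar> * \<bar>cumulant k (M m) (X3 \<psi> \<alpha> (n m) (R m) (a m)) - S m\<bar>"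
          by (simp flip: abs_mult right_diff_distrib)
        also have "\<dots> \<le> \<bar>q m\<bar> * \<bar>C * (c m / size_of (n m)) * S m\<bar>"
          by (intro mult_left_mono order_trans[OF diff abs_ge_self]) simp
        also have "\<dots> = \<bar>C * (c m / size_of (n m)) * (q m * S m)\<bar>" by (simp add: abs_mult)
        finally show "norm (q m * cumulant k (M m) (X3 \<psi> \<alpha> (n m) (R m) (a m)) - q m * S m)
          \<le> norm (C * (c m / size_of (n m)) * (q m * S m)) * 1" by simp
      qed
    qed
    from tendsto_add[OF this qS] show ?thesis by simp
  qed
qed

lemma patterns_3: "k \<ge> 1 \<Longrightarrow> patterns k 3 = {\<lambda>i\<in>{..<k}. {..<3}}"
proof
  assume k: "k \<ge> 1"
  show "patterns k 3 \<subseteq> {\<lambda>i\<in>{..<k}. {..<3}}"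
    by (auto simp: patterns_def PiE_iff extensional_def fun_eq_iff nsets_self)
  let ?\<tau> = "\<lambda>i\<in>{..<k}. {..<3 :: nat}"
  have "edges ?\<tau> B = nsets {..<3} 2" if "B \<subseteq> {..<k}" "B \<noteq> {}" for B
    using that by (auto simp: edges_def subset_iff)
  moreover have "nsets {..<3 :: nat} 2 \<noteq> {}" by (simp add: nsets_eq_empty_iff)
  ultimately have "linked ?\<tau> {..<k}"
    unfolding linked_def by (metis Diff_eq_empty_iff Diff_subset Int_absorb subset_antisym)
  then show "{\<lambda>i\<in>{..<k}. {..<3}} \<subseteq> patterns k 3" using k by (auto simp: patterns_def lessThan_empty_iff)
qed

text \<open>With the root at 0 the integrand is h(u1) h(u1 - u2) h(u2), evenness removing the
  absolute values. Integrating over u2 gives the convolution of h with itself at u1; as this is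
  even, the remaining integral is a convolution evaluated at 0.\<close>

private lemma graph_integral_triangle:
  assumes k: "k \<ge> 1"
  shows "graph_integral k 3 (\<lambda>i\<in>{..<k}. {..<3}) =
    convol (h_fun \<psi> \<alpha> k) (convol (h_fun \<psi> \<alpha> k) (h_fun \<psi> \<alpha> k)) 0"
proof -
  let ?\<tau> = "\<lambda>i\<in>{..<k}. {..<3 :: nat}"
  let ?h = "h_fun \<psi> \<alpha> k"
  have \<tau>: "?\<tau> \<in> patterns k 3" by (simp add: patterns_3[OF k])
  have E0: "edges ?\<tau> {..<k} = nsets {..<3} 2"
    using k by (auto simp: edges_def lessThan_empty_iff)
  have "{..<3} = {0, 1, 2 :: nat}" by auto
  then have E: "edges ?\<tau> {..<k} = nsets {0, 1, 2} 2" unfolding E0 by simp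
  have mult: "mult_edge ?\<tau> k e = k" if "e \<in> edges ?\<tau> {..<k}" for e
  proof -
    have "{i\<in>{..<k}. e \<in> nsets (?\<tau> i) 2} = {..<k}" using that unfolding E0 by auto
    then show ?thesis by (simp add: mult_edge_def)
  qed
  have habs: "?h \<bar>x\<bar> = ?h x" for x using h_even[of k x] by (auto simp: abs_if)
  let ?f = "\<lambda>u. ?h (u 1) * ?h (u 1 - u 2) * ?h (u 2)"
  have prod: "(\<Prod>e\<in>edges ?\<tau> {..<k}. h_fun \<psi> \<alpha> (mult_edge ?\<tau> k e) (gap (u(0 := 0)) e)) = ?f u" for u
  proof -
    have "(\<Prod>e\<in>edges ?\<tau> {..<k}. h_fun \<psi> \<alpha> (mult_edge ?\<tau> k e) (gap (u(0 := 0)) e)) =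
        (\<Prod>e\<in>nsets {0, 1, 2} 2. ?h (gap (u(0 := 0)) e))"
      using mult E by (intro prod.cong) auto
    also have "\<dots> = ?f u"
      by (subst prod_nsets_3_2) (simp_all add: habs)
    finally show ?thesis .
  qed
  have I: "{1..<3} = insert 2 {1 :: nat}" by auto
  have [measurable]: "?h \<in> borel_measurable borel" by (rule borel_measurable_continuous_onI[OF h_cont])
  have int: "integrable (lebPi {1..<3}) ?f"
  proof (rule Bochner_Integration.integrable_bound)
    show "integrable (lebPi {1..<3}) (\<lambda>u. \<Prod>e\<in>edges ?\<tau> {..<k}. Dom k (gap (u(0 := 0)) e))"
      by (rule integrable_grown_product[OF _ pattern_edges(2)[OF \<tau> k] pattern_grown[OF \<tau> k]
            Dom_integrable Dom_nonneg Dom_le Dom_even]) simp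
    show "?f \<in> borel_measurable (lebPi {1..<3})" by measurable
    show "AE u in lebPi {1..<3}. norm (?f u) \<le> norm (\<Prod>e\<in>edges ?\<tau> {..<k}. Dom k (gap (u(0 := 0)) e))"
    proof (intro AE_I2)
      fix u
      show "norm (?f u) \<le> norm (\<Prod>e\<in>edges ?\<tau> {..<k}. Dom k (gap (u(0 := 0)) e))"
        unfolding prod[symmetric] real_norm_def abs_prod
      proof (intro prod_mono conjI abs_ge_zero)
        fix e
        show "\<bar>h_fun \<psi> \<alpha> (mult_edge ?\<tau> k e) (gap (u(0 := 0)) e)\<bar> \<le> \<bar>Dom k (gap (u(0 := 0)) e)\<bar>"
          using h_nonneg h_le_dom[OF mult_edge_le] dom_le_Dom[of "gap (u(0 := 0)) e" "gap (u(0 := 0)) e" k]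
          by (smt (verit) abs_of_nonneg)
      qed
    qed
  qed
  have conv_even: "convol ?h ?h (- x) = convol ?h ?h x" for x
  proof -
    have "convol ?h ?h (- x) = (LINT y|lborel. ?h (- y) * ?h (- x - - y))"
      unfolding convol_def
      using lborel_integral_real_affine[of "-1" "\<lambda>y. ?h y * ?h (- x - y)" 0] by simp
    also have "\<dots> = convol ?h ?h x"
    proof -
      have "?h (- x - - y) = ?h (x - y)" for y using h_even[of k "x - y"] by (simp add: algebra_simps)
      then show ?thesis by (simp only: convol_def h_even)
    qed
    finally show ?thesis .
  qed
  have cm: "(\<lambda>x. ?h x * convol ?h ?h x) \<in> borel_measurable lborel"
    using borel_measurable_continuous_onI[OF convol_bounded_continuous(1)[OF h_integrable h_cont h_bounded]] by simp
  have "graph_integral k 3 ?\<tau> = (LINT u|lebPi (insert 2 {1}). ?f u)"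
    by (simp only: graph_integral_def prod I)
  also have "\<dots> = (LINT u|lebPi {1}. LINT y|lborel. ?f (u(2 := y)))"
    using int unfolding I by (intro lebPi.product_integral_insert) auto
  also have "\<dots> = (LINT u|lebPi {1}. ?h (u 1) * convol ?h ?h (u 1))"
  proof (intro Bochner_Integration.integral_cong refl)
    fix u :: "nat \<Rightarrow> real"
    have "(LINT y|lborel. ?f (u(2 := y))) = (LINT y|lborel. ?h (u 1) * (?h y * ?h (u 1 - y)))"
      by (simp add: mult_ac)
    then show "(LINT y|lborel. ?f (u(2 := y))) = ?h (u 1) * convol ?h ?h (u 1)"
      by (simp only: integral_mult_right_zero convol_def)
  qed
  also have "\<dots> = (LINT x|lborel. ?h x * convol ?h ?h x)"
    using cm by (rule lebPi.product_integral_singleton)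
  also have "\<dots> = convol ?h (convol ?h ?h) 0"
    by (simp add: convol_def[of ?h "convol ?h ?h"] conv_even)
  finally show ?thesis .
qed

text \<open>Only v = 3 survives, with the single pattern in which all triangles coincide. Its three
  edges satisfy e + 3 = 2v, and 6 ^ k / 3! = 6 ^ (k - 1).\<close>

lemma cumulant_limit_triangle:
  assumes k: "k \<ge> 1"
  shows "complex_of_real (cumulant_limit k (\<lambda>v. 0 ^ (v - 3))) = 6 ^ (k - 1) * H3_tilde \<psi> \<alpha> k"
proof -
  let ?\<tau> = "\<lambda>i\<in>{..<k}. {..<3 :: nat}"
  have \<tau>: "?\<tau> \<in> patterns k 3" by (simp add: patterns_3[OF k])
  have e: "card (edges ?\<tau> {..<k}) = 3"
  proof -
    have "edges ?\<tau> {..<k} = nsets {..<3} 2" using k by (auto simp: edges_def lessThan_empty_iff)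
    then show ?thesis by (simp add: choose_two)
  qed
  let ?t = "\<lambda>v. 1 / fact v * (\<Sum>\<tau>\<in>patterns k v.
     6 ^ k * (0 ^ (v - 3) * 0 ^ (card (edges \<tau> {..<k}) + 3 - 2 * v) * graph_integral k v \<tau>))"
  have "cumulant_limit k (\<lambda>v. 0 ^ (v - 3)) = (\<Sum>v\<in>{3}. ?t v)"
    unfolding cumulant_limit_def
  proof (rule sum.mono_neutral_right)
    show "\<forall>v\<in>{..k+2} - {3}. ?t v = 0"
    proof
      fix v assume v: "v \<in> {..k+2} - {3}"
      \<comment> \<open>For v < 3 the truncated exponent would give 0 ^ 0 = 1; there the sum is
        empty instead, because a pattern has at least three vertices.\<close>
      have "0 ^ (v - 3) = (0 :: real)" if "\<tau> \<in> patterns k v" for \<tau>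
        using pattern_v(1)[OF that k] v by simp
      then have "(\<Sum>\<tau>\<in>patterns k v. 6 ^ k * (0 ^ (v - 3) * 0 ^ (card (edges \<tau> {..<k}) + 3 - 2 * v) * graph_integral k v \<tau>)) = 0"
        by (intro sum.neutral ballI) simp
      then show "?t v = 0" by simp
    qed
  qed (use k in auto)
  also have "\<dots> = 1 / 6 * 6 ^ k * graph_integral k 3 ?\<tau>"
    by (simp add: patterns_3[OF k] e fact_numeral)
  also have "\<dots> = 6 ^ (k - 1) * graph_integral k 3 ?\<tau>"
    using k by (cases k) auto
  finally show ?thesis
    unfolding graph_integral_triangle[OF k]
    using H3_tilde_eq[OF h_integrable h_cont h_bounded h_nonneg h_even, of k] by simp
qed

end

theorem theorem2p3:
  fixes \<psi> :: "real \<Rightarrow> real" and \<alpha> :: real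
  assumes even: "\<And>x. \<psi> (- x) = \<psi> x"
    and cont: "continuous_on UNIV \<psi>"
    and pos: "\<And>x. 0 < \<psi> x"
    and mono: "mono_on {0..} \<psi>"
    and int0: "integrable lborel (\<lambda>t. exp (- (\<psi> t)\<^sup>2))"
    and intm: "\<And>m::nat. integrable lborel (\<lambda>s. (1 + (\<psi> s)\<^sup>2) ^ m * exp (- (\<psi> s)\<^sup>2))"
    and alpha: "\<alpha> \<in> {0, 1}"
  shows "\<forall>k\<ge>1. \<exists>(\<Theta>i::real) (\<Theta>ii::real \<Rightarrow> real) (\<Theta>iii::real).
    complex_of_real \<Theta>iii = 6 ^ (k - 1) * H3_tilde \<psi> \<alpha> k \<and>
    (\<forall>(n::nat \<Rightarrow> nat) (c::nat \<Rightarrow> real) (R::nat \<Rightarrow> real)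
        (M::nat \<Rightarrow> 'w measure) (a::nat \<Rightarrow> int \<Rightarrow> int \<Rightarrow> 'w \<Rightarrow> real).
      limit_transition n c R \<longrightarrow>
      (\<forall>m. edge_family \<psi> (n m) (c m) (R m) (M m) (a m)) \<longrightarrow>
      (let N = (\<lambda>m. size_of (n m)); X = (\<lambda>m. X3 \<psi> \<alpha> (n m) (R m) (a m));
           \<rho> = (\<lambda>m. (c m)\<^sup>2 * R m / (N m)\<^sup>2)
       in (filterlim \<rho> at_top sequentially \<longrightarrow>
             (\<lambda>m. 1 / (c m * R m) *
                  cumulant k (M m) (\<lambda>\<omega>. (N m)\<^sup>2 / ((c m)\<^sup>2 * R m) * X m \<omega>)) \<longlonglongrightarrow> \<Theta>i) \<and>
          (\<forall>s>0. (\<forall>m. \<rho> m = s) \<longrightarrow>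
             (\<lambda>m. 1 / (c m * R m) * cumulant k (M m) (X m)) \<longlonglongrightarrow> \<Theta>ii s) \<and>
          (\<rho> \<longlonglongrightarrow> 0 \<longrightarrow>
             (\<lambda>m. (N m)\<^sup>2 / ((c m) ^ 3 * (R m)\<^sup>2) * cumulant k (M m) (X m)) \<longlonglongrightarrow> \<Theta>iii)))"
proof (intro allI impI)
  fix k :: nat assume k: "1 \<le> k"
  have alpha': "0 \<le> \<alpha>" "\<alpha> \<le> 1" using alpha by auto
  note ctx = even cont pos mono intm alpha'
  let ?L = "cumulant_limit \<psi> \<alpha> k"
  show "\<exists>(\<Theta>i::real) (\<Theta>ii::real \<Rightarrow> real) (\<Theta>iii::real).
    complex_of_real \<Theta>iii = 6 ^ (k - 1) * H3_tilde \<psi> \<alpha> k \<and>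
    (\<forall>(n::nat \<Rightarrow> nat) (c::nat \<Rightarrow> real) (R::nat \<Rightarrow> real)
        (M::nat \<Rightarrow> 'w measure) (a::nat \<Rightarrow> int \<Rightarrow> int \<Rightarrow> 'w \<Rightarrow> real).
      limit_transition n c R \<longrightarrow>
      (\<forall>m. edge_family \<psi> (n m) (c m) (R m) (M m) (a m)) \<longrightarrow>
      (let N = (\<lambda>m. size_of (n m)); X = (\<lambda>m. X3 \<psi> \<alpha> (n m) (R m) (a m));
           \<rho> = (\<lambda>m. (c m)\<^sup>2 * R m / (N m)\<^sup>2)
       in (filterlim \<rho> at_top sequentially \<longrightarrow>
             (\<lambda>m. 1 / (c m * R m) *
                  cumulant k (M m) (\<lambda>\<omega>. (N m)\<^sup>2 / ((c m)\<^sup>2 * R m) * X m \<omega>)) \<longlonglongrightarrow> \<Theta>i) \<and>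
          (\<forall>s>0. (\<forall>m. \<rho> m = s) \<longrightarrow>
             (\<lambda>m. 1 / (c m * R m) * cumulant k (M m) (X m)) \<longlonglongrightarrow> \<Theta>ii s) \<and>
          (\<rho> \<longlonglongrightarrow> 0 \<longrightarrow>
             (\<lambda>m. (N m)\<^sup>2 / ((c m) ^ 3 * (R m)\<^sup>2) * cumulant k (M m) (X m)) \<longlonglongrightarrow> \<Theta>iii)))"
  \<comment> \<open>The witnesses are the limits of the normalised \<rho>^(v-2) in the three
    regimes, with 0 ^ 0 = 1: for 3 <= v <= k + 2, \<open>0 ^ (k + 2 - v)\<close> selects v = k + 2,
    \<open>s ^ (v - 2)\<close> keeps every v, and \<open>0 ^ (v - 3)\<close> selects v = 3.\<close>
  proof (rule exI[of _ "?L (\<lambda>v. 0 ^ (k + 2 - v))"], rule exI[of _ "\<lambda>s. ?L (\<lambda>v. s ^ (v - 2))"],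
      rule exI[of _ "?L (\<lambda>v. 0 ^ (v - 3))"], intro conjI allI impI)
    show "complex_of_real (?L (\<lambda>v. 0 ^ (v - 3))) = 6 ^ (k - 1) * H3_tilde \<psi> \<alpha> k"
      by (rule cumulant_limit_triangle[OF ctx k])
    fix n :: "nat \<Rightarrow> nat" and c R :: "nat \<Rightarrow> real" and M :: "nat \<Rightarrow> 'w measure"
      and a :: "nat \<Rightarrow> int \<Rightarrow> int \<Rightarrow> 'w \<Rightarrow> real"
    assume lim: "limit_transition n c R"
      and fam: "\<forall>m. edge_family \<psi> (n m) (c m) (R m) (M m) (a m)"
    let ?N = "\<lambda>m. size_of (n m)"
    let ?X = "\<lambda>m. X3 \<psi> \<alpha> (n m) (R m) (a m)"
    let ?\<rho> = "\<lambda>m. (c m)\<^sup>2 * R m / (?N m)\<^sup>2"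
    have cR: "0 < c m" "0 < R m" for m using lim by (auto simp: limit_transition_def)
    have N: "0 < ?N m" for m by (simp add: size_of_def)
    have \<rho>: "0 < ?\<rho> m" for m using cR[of m] N[of m] by simp
    note limit = scaled_cumulant_limit[OF ctx k lim fam[rule_format]]
    have i: "(\<lambda>m. 1 / (c m * R m) * cumulant k (M m) (\<lambda>\<omega>. (?N m)\<^sup>2 / ((c m)\<^sup>2 * R m) * ?X m \<omega>))
      \<longlonglongrightarrow> ?L (\<lambda>v. 0 ^ (k + 2 - v))" if \<rho>_inf: "filterlim ?\<rho> at_top sequentially"
    proof -
      \<comment> \<open>The factor multiplying X is 1 / \<rho>, and by homogeneity of degree k of
        the cumulant it comes out as (1 / \<rho>)^k. The exponent of 1 / \<rho> left over is k - (v
        - 2) >= 0.\<close>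
      let ?q = "\<lambda>m. 1 / (c m * R m) * (1 / ?\<rho> m) ^ k"
      have "1 / (c m * R m) * cumulant k (M m) (\<lambda>\<omega>. (?N m)\<^sup>2 / ((c m)\<^sup>2 * R m) * ?X m \<omega>) =
          ?q m * cumulant k (M m) (?X m)" for m
        unfolding cumulant_X3(2)[OF even fam[rule_format] k] by simp
      moreover have "(\<lambda>m. ?q m * cumulant k (M m) (?X m)) \<longlonglongrightarrow> ?L (\<lambda>v. 0 ^ (k + 2 - v))"
      proof (rule limit)
        fix v :: nat assume v: "3 \<le> v" "v \<le> k + 2"
        have "(\<lambda>m. (1 / ?\<rho> m) ^ (k + 2 - v)) \<longlonglongrightarrow> 0 ^ (k + 2 - v)"
          using tendsto_inverse_0_at_top[OF \<rho>_inf] by (intro tendsto_power) (simp add: inverse_eq_divide)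
        moreover have "?q m * (c m * R m * ?\<rho> m ^ (v - 2)) = (1 / ?\<rho> m) ^ (k + 2 - v)" for m
        proof -
          have one: "1 / ?\<rho> m * ?\<rho> m = 1" using \<rho>[of m] by (intro nonzero_eq_divide_eq[THEN iffD1]) auto
          have "(1 / ?\<rho> m) ^ k = (1 / ?\<rho> m) ^ (k + 2 - v) * (1 / ?\<rho> m) ^ (v - 2)"
            using v by (simp flip: power_add)
          then have "(1 / ?\<rho> m) ^ k * ?\<rho> m ^ (v - 2) =
              (1 / ?\<rho> m) ^ (k + 2 - v) * (1 / ?\<rho> m * ?\<rho> m) ^ (v - 2)"
            by (simp only: power_mult_distrib mult.assoc)
          moreover have "?q m * (c m * R m * ?\<rho> m ^ (v - 2)) = (1 / ?\<rho> m) ^ k * ?\<rho> m ^ (v - 2)"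
            using cR[of m] by simp
          ultimately show ?thesis by (simp only: one power_one mult_1_right)
        qed
        ultimately show "(\<lambda>m. ?q m * (c m * R m * ?\<rho> m ^ (v - 2))) \<longlonglongrightarrow> 0 ^ (k + 2 - v)"
          by (simp only:)
      qed
      ultimately show ?thesis by (simp only:)
    qed
    have ii: "(\<lambda>m. 1 / (c m * R m) * cumulant k (M m) (?X m)) \<longlonglongrightarrow> ?L (\<lambda>v. s ^ (v - 2))"
      if \<rho>_s: "\<forall>m. ?\<rho> m = s" for s
    proof (rule limit)
      fix v :: nat
      have "1 / (c m * R m) * (c m * R m * ?\<rho> m ^ (v - 2)) = s ^ (v - 2)" for m
        unfolding \<rho>_s[rule_format] using cR[of m] by simp
      then show "(\<lambda>m. 1 / (c m * R m) * (c m * R m * ?\<rho> m ^ (v - 2))) \<longlonglongrightarrow> s ^ (v - 2)"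
        by (simp only: tendsto_const)
    qed
    have iii: "(\<lambda>m. (?N m)\<^sup>2 / ((c m) ^ 3 * (R m)\<^sup>2) * cumulant k (M m) (?X m)) \<longlonglongrightarrow> ?L (\<lambda>v. 0 ^ (v - 3))"
      if \<rho>_0: "?\<rho> \<longlonglongrightarrow> 0"
    proof (rule limit)
      fix v :: nat assume v: "3 \<le> v"
      \<comment> \<open>The normalisation equals 1 / (c R \<rho>), so it removes exactly one factor
        \<rho> and leaves \<rho>^(v-3).\<close>
      have "(?N m)\<^sup>2 / ((c m) ^ 3 * (R m)\<^sup>2) * (c m * R m * ?\<rho> m ^ (v - 2)) = ?\<rho> m ^ (v - 3)" for m
      proof -
        have "v - 2 = Suc (v - 3)" using v by simp
        then have "(?N m)\<^sup>2 / ((c m) ^ 3 * (R m)\<^sup>2) * (c m * R m * ?\<rho> m ^ (v - 2)) =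
            ((?N m)\<^sup>2 / ((c m) ^ 3 * (R m)\<^sup>2) * (c m * R m * ?\<rho> m)) * ?\<rho> m ^ (v - 3)"
          by (simp only: power_Suc mult.assoc)
        also have "(?N m)\<^sup>2 / ((c m) ^ 3 * (R m)\<^sup>2) * (c m * R m * ?\<rho> m) = 1"
          using cR[of m] N[of m] by (simp add: field_simps power2_eq_square power3_eq_cube)
        finally show ?thesis by simp
      qed
      then show "(\<lambda>m. (?N m)\<^sup>2 / ((c m) ^ 3 * (R m)\<^sup>2) * (c m * R m * ?\<rho> m ^ (v - 2))) \<longlonglongrightarrow> 0 ^ (v - 3)"
        by (simp only: tendsto_power[OF \<rho>_0])
    qed
    show "let N = ?N; X = ?X; \<rho> = (\<lambda>m. (c m)\<^sup>2 * R m / (N m)\<^sup>2)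
       in (filterlim \<rho> at_top sequentially \<longrightarrow>
             (\<lambda>m. 1 / (c m * R m) *
                  cumulant k (M m) (\<lambda>\<omega>. (N m)\<^sup>2 / ((c m)\<^sup>2 * R m) * X m \<omega>)) \<longlonglongrightarrow> ?L (\<lambda>v. 0 ^ (k + 2 - v))) \<and>
          (\<forall>s>0. (\<forall>m. \<rho> m = s) \<longrightarrow>
             (\<lambda>m. 1 / (c m * R m) * cumulant k (M m) (X m)) \<longlonglongrightarrow> ?L (\<lambda>v. s ^ (v - 2))) \<and>
          (\<rho> \<longlonglongrightarrow> 0 \<longrightarrow>
             (\<lambda>m. (N m)\<^sup>2 / ((c m) ^ 3 * (R m)\<^sup>2) * cumulant k (M m) (X m)) \<longlonglongrightarrow> ?L (\<lambda>v. 0 ^ (v - 3)))"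
      unfolding Let_def using i ii iii by blast
  qed
qed

end
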